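(* Let $A$ be a quantum nilpotent algebra in $N$ generators, with associated algebras $A^{(j)}$ ($2\le j\le N+1$) and maps $\psi_j:\mathrm{C.Spec}(A^{(j+1)})\to\mathrm{C.Spec}(A^{(j)})$ as in the context. For every $j\in[\![2,N]\!]$ the map $\psi_j$ is injective. Moreover, for each $\epsilon\in\{0,1\}$, $\psi_j$ induces by restriction a bi-increasing homeomorphism from $\mathcal{P}_j^{\epsilon}(A^{(j+1)})$ onto $\psi_j(\mathcal{P}_j^{\epsilon}(A^{(j+1)}))$, and this image is a closed subset of $\mathcal{P}_j^{\epsilon}(A^{(j)})$.
   Context: Notation: $\mathbb{K}$ is a field; $[\![a,b]\!]$ is the set of integers from $a$ to $b$. Ore extensions: in $R[x;\sigma,\delta]$, $\sigma$ is a $\mathbb{K}$-algebra automorphism of $R$, $\delta$ is a $\mathbb{K}$-linear $\sigma$-derivation, $\delta(ab)=\sigma(a)\delta(b)+\delta(a)b$, and $xr=\sigma(r)x+\delta(r)$. Higher skew derivations: for $1\ne q\in\mathbb{K}^*$, $\delta$ extends to a higher $q$-skew $\sigma$-derivation $\{d_n\}_{n\ge0}$ on $R$ if the $d_n$ are $\mathbb{K}$-linear operators on $R$ with $d_0=\mathrm{id}$, $d_1=\delta$, $d_n(rs)=\sum_{i=0}^n\sigma^{n-i}d_i(r)\,d_{n-i}(s)$ and $d_n\circ\sigma=q^n\sigma\circ d_n$ for all $n$. It is locally nilpotent if for each $r\in R$ there is $n_r\ge0$ with $d_n(r)=0$ for all $n\ge n_r$, and iterative if $d_nd_m=\binom{n+m}{m}_q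 d_{n+m}$ for all $n,m$. Quantum nilpotent algebra: $A=\mathbb{K}[X_1][X_2;\sigma_2,\delta_2]\cdots[X_N;\sigma_N,\delta_N]$ with $A_{i}=\mathbb{K}\langle X_1,\dots,X_i\rangle$ such that: (1) $\sigma_i(X_l)=\lambda_{i,l}X_l$ for $l<i$, $\lambda_{i,l}\in\mathbb{K}^*$; (2) $\Lambda=(\lambda_{i,j})\in M_N(\mathbb{K}^* )$ is multiplicatively antisymmetric ($\lambda_{i,l}=\lambda_{l,i}^{-1}$, $\lambda_{i,i}=1$); (3) for $2\le i\le N$ there is $1\ne q_i\in\mathbb{K}^*$ with $\delta_i\circ\sigma_i=q_i\sigma_i\circ\delta_i$; (4) for $2\le i\le N$, $\delta_i$ extends to a (fixed) locally nilpotent, iterative higher $q_i$-skew $\sigma_i$-derivation $\{d_{i,n}\}_{n\ge0}$ on $A_{i-1}$, and $\sigma_l\circ d_{i,n}=\lambda_{l,i}^n d_{i,n}\circ\sigma_l$ on $A_{i-1}$ for all $n\ge0$, $i+1\le l\le N$. Such an $A$ is a Noetherian domain. Deleting derivations algorithm: put $X_i^{(N+1)}=X_i$, and let $A^{(j)}$ be the subalgebra of $\mathrm{Frac}(A)$ generated by $X_1^{(j)},\dots,X_N^{(j)}$. For $j=N,N-1,\dots,2$ write $x_i=X_i^{(j+1)}$, $y_i=X_i^{(j)}$. There is a $\mathbb{K}$-algebra isomorphism $A^{(j+1)}\to\mathbb{K}[X_1]\cdots[X_j;\sigma_j,\delta_j][X_{j+1};\sigma_{j+1}^{(j+1)}]\cdots[X_N;\sigma_N^{(j+1)}]$,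 $x_i\mapsto X_i$, with $\sigma_i^{(j+1)}(X_l)=\lambda_{i,l}X_l$ for $l<i$; via it $\sigma_j$ and $d_{j,n}$ are regarded as maps on $\mathbb{K}\langle x_1,\dots,x_{j-1}\rangle\cong A_{j-1}$. Then $y_l=x_l$ for $l\ge j$ and $y_l=\sum_{n\ge0}q_j^{n(n+1)/2}(q_j-1)^{-n}d_{j,n}\circ\sigma_j^{-n}(x_l)\,x_j^{-n}$ (a finite sum) for $l<j$. The set $S_j=\{x_j^n\}_{n\ge0}=\{y_j^n\}_{n\ge0}$ is a two-sided Ore set of regular elements in $A^{(j)}$ and $A^{(j+1)}$, and $A^{(j)}S_j^{-1}=A^{(j+1)}S_j^{-1}$. Spectra: $\mathrm{C.Spec}(R)$ is the set of completely prime ideals of $R$ (ideals $P$ with $R/P$ a domain) with the Zariski topology. $\mathcal{P}_j^0(A^{(j)})$ (resp. $\mathcal{P}_j^1(A^{(j)})$) is the subspace of $P\in\mathrm{C.Spec}(A^{(j)})$ with $y_j\notin P$ (resp. $y_j\in P$); $\mathcal{P}_j^0(A^{(j+1)})$ (resp. $\mathcal{P}_j^1(A^{(j+1)})$) is the subspace of $P\in\mathrm{C.Spec}(A^{(j+1)})$ with $x_j\notin P$ (resp. $x_j\in P$). There is a surjective algebra homomorphism $g_j:A^{(j)}\to A^{(j+1)}/\langle x_j\rangle$, $y_i\mapsto x_i+\langle x_j\rangle$ for all $i$. Define $\psi_j(P)=PS_j^{-1}\cap A^{(j)}$ if $x_j\notin P$ and $\psi_j(P)=g_j^{-1}(P/\langle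 x_j\rangle)$ if $x_j\in P$. A homeomorphism between sets of ideals is bi-increasing if it and its inverse preserve inclusions. *)

theory Defs
  imports
    "HOL-Analysis.Abstract_Topology"
    "HOL-Library.Groups_Big_Fun"
    "HOL-Algebra.QuotRing"
    "HOL-Algebra.Generated_Rings"
    "HOL-Algebra.Algebraic_Closure_Type"
begin

section \<open>Algebras over a field inside an ambient ring\<close>

text \<open>
  All algebras below are subalgebras of an ambient ring given by a type of class
  \<^class>\<open>ring_1\<close>; in the theorem this type is the division ring of fractions Frac(A).
  The record \<open>ring_on S\<close> is the subset \<open>S\<close> with the operations of that type, so that
  ideals, quotients and homomorphisms are those of HOL-Algebra.
  A structure of algebra over the field \<open>'k\<close> is given by its structure map \<open>\<iota>\<close>, and
  the scalar multiple of \<open>a\<close> by \<open>c\<close> is \<open>\<iota> c * a\<close>.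
\<close>

abbreviation ring_on :: "'a::ring_1 set \<Rightarrow> 'a ring" where
  "ring_on S \<equiv> ring_of_type_algebra\<lparr>carrier := S\<rparr>"

definition algebra_map :: "('k::field \<Rightarrow> 'a::ring_1) \<Rightarrow> bool" where
  "algebra_map \<iota> \<longleftrightarrow> \<iota> 1 = 1 \<and> (\<forall>c d. \<iota> (c + d) = \<iota> c + \<iota> d) \<and> (\<forall>c d. \<iota> (c * d) = \<iota> c * \<iota> d)
     \<and> (\<forall>c a. \<iota> c * a = a * \<iota> c)"

definition gen_alg :: "('k::field \<Rightarrow> 'a::ring_1) \<Rightarrow> 'a set \<Rightarrow> 'a set" where
  "gen_alg \<iota> S = generate_ring ring_of_type_algebra (range \<iota> \<union> S)"

lemma ring_ring_of_type_algebra: "ring (ring_of_type_algebra :: 'a::ring_1 ring)"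
proof -
  have "\<exists>y. x + y = 0" for x :: 'a
    using add.right_inverse by blast
  then show ?thesis
    unfolding ring_of_type_algebra_def using add.right_inverse
    by unfold_locales (auto simp: algebra_simps Units_def)
qed

lemma ring_gen_alg: "ring (ring_on (gen_alg \<iota> S))"
  unfolding gen_alg_def
  by (rule ring.generate_ring_is_ring[OF ring_ring_of_type_algebra])
     (simp add: ring_of_type_algebra_def)

definition linear_on :: "('k::field \<Rightarrow> 'a::ring_1) \<Rightarrow> 'a set \<Rightarrow> ('a \<Rightarrow> 'a) \<Rightarrow> bool" where
  "linear_on \<iota> B f \<longleftrightarrow> f \<in> B \<rightarrow> B \<and> (\<forall>a\<in>B. \<forall>b\<in>B. f (a + b) = f a + f b)
     \<and> (\<forall>c. \<forall>a\<in>B. f (\<iota> c * a) = \<iota> c * f a)"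

definition alg_iso :: "('k::field \<Rightarrow> 'a::ring_1) \<Rightarrow> 'a set \<Rightarrow> 'a set \<Rightarrow> ('a \<Rightarrow> 'a) \<Rightarrow> bool" where
  "alg_iso \<iota> B C h \<longleftrightarrow> h \<in> ring_iso (ring_on B) (ring_on C) \<and> (\<forall>c. h (\<iota> c) = \<iota> c)"

section \<open>Ore extensions and higher skew derivations\<close>

definition skew_derivation ::
  "('k::field \<Rightarrow> 'a::ring_1) \<Rightarrow> 'a set \<Rightarrow> ('a \<Rightarrow> 'a) \<Rightarrow> ('a \<Rightarrow> 'a) \<Rightarrow> bool" where
  "skew_derivation \<iota> B \<sigma> \<delta> \<longleftrightarrow> linear_on \<iota> B \<delta>
     \<and> (\<forall>a\<in>B. \<forall>b\<in>B. \<delta> (a * b) = \<sigma> a * \<delta> b + \<delta> a * b)"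

text \<open>
  \<open>S = B[x;\<sigma>,\<delta>]\<close>: the bijection says that \<open>S\<close> is a free left \<open>B\<close>-module with basis
  the powers of \<open>x\<close>.
\<close>

definition ore_extension ::
  "('k::field \<Rightarrow> 'a::ring_1) \<Rightarrow> 'a set \<Rightarrow> 'a \<Rightarrow> ('a \<Rightarrow> 'a) \<Rightarrow> ('a \<Rightarrow> 'a) \<Rightarrow> 'a set \<Rightarrow> bool" where
  "ore_extension \<iota> B x \<sigma> \<delta> S \<longleftrightarrow>
     alg_iso \<iota> B B \<sigma> \<and> skew_derivation \<iota> B \<sigma> \<delta>
     \<and> (\<forall>b\<in>B. x * b = \<sigma> b * x + \<delta> b)
     \<and> bij_betw (\<lambda>c. Sum_any (\<lambda>n. c n * x ^ n)) {c. range c \<subseteq> B \<and> finite {n. c n \<noteq> 0}} S"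

text \<open>
  The value at \<open>q\<close> of the Gaussian binomial polynomial, by the \<open>q\<close>-Pascal rule: a quotient
  of \<open>q\<close>-factorials would be meaningless when \<open>q\<close> is a root of unity, which is allowed.
\<close>

fun qbinom :: "'k::field \<Rightarrow> nat \<Rightarrow> nat \<Rightarrow> 'k" where
  "qbinom q n 0 = 1"
| "qbinom q 0 (Suc m) = 0"
| "qbinom q (Suc n) (Suc m) = qbinom q n m + q ^ Suc m * qbinom q n (Suc m)"

definition higher_skew_derivation ::
  "('k::field \<Rightarrow> 'a::ring_1) \<Rightarrow> 'a set \<Rightarrow> 'k \<Rightarrow> ('a \<Rightarrow> 'a) \<Rightarrow> ('a \<Rightarrow> 'a) \<Rightarrow> (nat \<Rightarrow> 'a \<Rightarrow> 'a) \<Rightarrow> bool" where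
  "higher_skew_derivation \<iota> B q \<sigma> \<delta> d \<longleftrightarrow>
     (\<forall>n. linear_on \<iota> B (d n)) \<and> (\<forall>r\<in>B. d 0 r = r) \<and> (\<forall>r\<in>B. d 1 r = \<delta> r)
     \<and> (\<forall>n. \<forall>r\<in>B. \<forall>s\<in>B. d n (r * s) = (\<Sum>i=0..n. (\<sigma> ^^ (n - i)) (d i r) * d (n - i) s))
     \<and> (\<forall>n. \<forall>r\<in>B. d n (\<sigma> r) = \<iota> (q ^ n) * \<sigma> (d n r))"

definition loc_nilpotent :: "'a::ring_1 set \<Rightarrow> (nat \<Rightarrow> 'a \<Rightarrow> 'a) \<Rightarrow> bool" where
  "loc_nilpotent B d \<longleftrightarrow> (\<forall>r\<in>B. \<exists>m. \<forall>n\<ge>m. d n r = 0)"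

definition iterative ::
  "('k::field \<Rightarrow> 'a::ring_1) \<Rightarrow> 'a set \<Rightarrow> 'k \<Rightarrow> (nat \<Rightarrow> 'a \<Rightarrow> 'a) \<Rightarrow> bool" where
  "iterative \<iota> B q d \<longleftrightarrow>
     (\<forall>n m. \<forall>r\<in>B. d n (d m r) = \<iota> (qbinom q (n + m) m) * d (n + m) r)"

section \<open>Quantum nilpotent algebras\<close>

text \<open>
  \<open>hder Q i n\<close> is the map \<open>d\<^sub>i\<^sub>,\<^sub>n\<close>; the maps \<open>sigma Q i\<close>, \<open>delta Q i\<close> and \<open>hder Q i n\<close> only
  matter on \<open>subalg Q (i - 1)\<close> and for \<open>2 \<le> i \<le> ngens Q\<close>.
\<close>

record ('k, 'a) qna_data =
  scal :: "'k \<Rightarrow> 'a"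
  ngens :: nat
  gen :: "nat \<Rightarrow> 'a"
  sigma :: "nat \<Rightarrow> 'a \<Rightarrow> 'a"
  delta :: "nat \<Rightarrow> 'a \<Rightarrow> 'a"
  lam :: "nat \<Rightarrow> nat \<Rightarrow> 'k"
  qpar :: "nat \<Rightarrow> 'k"
  hder :: "nat \<Rightarrow> nat \<Rightarrow> 'a \<Rightarrow> 'a"

definition subalg :: "('k::field, 'a::ring_1) qna_data \<Rightarrow> nat \<Rightarrow> 'a set" where
  "subalg Q i = gen_alg (scal Q) (gen Q ` {1..i})"

definition quantum_nilpotent_algebra :: "('k::field, 'a::ring_1) qna_data \<Rightarrow> bool" where
  "quantum_nilpotent_algebra Q \<longleftrightarrow>
     algebra_map (scal Q) \<and> 1 \<le> ngens Q
     \<and> ore_extension (scal Q) (subalg Q 0) (gen Q 1) id (\<lambda>_. 0) (subalg Q 1)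
     \<and> (\<forall>i\<in>{2..ngens Q}. ore_extension (scal Q) (subalg Q (i - 1)) (gen Q i)
          (sigma Q i) (delta Q i) (subalg Q i))
     \<and> (\<forall>i\<in>{1..ngens Q}. \<forall>l\<in>{1..ngens Q}.
          lam Q i l \<noteq> 0 \<and> lam Q i l = inverse (lam Q l i) \<and> lam Q i i = 1)
     \<and> (\<forall>i\<in>{2..ngens Q}. \<forall>l\<in>{1..<i}. sigma Q i (gen Q l) = scal Q (lam Q i l) * gen Q l)
     \<and> (\<forall>i\<in>{2..ngens Q}. qpar Q i \<noteq> 0 \<and> qpar Q i \<noteq> 1
          \<and> (\<forall>a\<in>subalg Q (i - 1).
               delta Q i (sigma Q i a) = scal Q (qpar Q i) * sigma Q i (delta Q i a)))
     \<and> (\<forall>i\<in>{2..ngens Q}.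
          higher_skew_derivation (scal Q) (subalg Q (i - 1)) (qpar Q i)
            (sigma Q i) (delta Q i) (hder Q i)
          \<and> loc_nilpotent (subalg Q (i - 1)) (hder Q i)
          \<and> iterative (scal Q) (subalg Q (i - 1)) (qpar Q i) (hder Q i))
     \<and> (\<forall>i\<in>{2..ngens Q}. \<forall>l\<in>{i+1..ngens Q}. \<forall>n. \<forall>a\<in>subalg Q (i - 1).
          sigma Q l (hder Q i n a) = scal Q (lam Q l i ^ n) * hder Q i n (sigma Q l a))"

text \<open>The ambient type is Frac(A), that is, it consists of the fractions of \<open>A\<close>.\<close>

definition division_ring_of_fractions :: "'f::division_ring set \<Rightarrow> bool" where
  "division_ring_of_fractions A \<longleftrightarrow> (\<forall>z. \<exists>a\<in>A. \<exists>s\<in>A. s \<noteq> 0 \<and> z = a * inverse s)"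

section \<open>The deleting derivations algorithm\<close>

text \<open>
  For generators \<open>x\<close> of the \<open>(j+1)\<close>-st algebra, \<open>dda_iso Q j x\<close> is the isomorphism from
  \<open>K\<langle>x\<^sub>1,\<dots>,x\<^sub>j\<^sub>-\<^sub>1\<rangle>\<close> to \<open>subalg Q (j - 1)\<close> sending each \<open>x\<^sub>i\<close> to \<open>gen Q i\<close> (it is unique
  on its domain), and \<open>dda_transport Q j x f\<close> is the map \<open>f\<close> of the latter algebra viewed on
  the former.
\<close>

definition dda_low :: "('k::field, 'f::division_ring) qna_data \<Rightarrow> nat \<Rightarrow> (nat \<Rightarrow> 'f) \<Rightarrow> 'f set" where
  "dda_low Q j x = gen_alg (scal Q) (x ` {1..j - 1})"

definition dda_iso ::
  "('k::field, 'f::division_ring) qna_data \<Rightarrow> nat \<Rightarrow> (nat \<Rightarrow> 'f) \<Rightarrow> 'f \<Rightarrow> 'f" where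
  "dda_iso Q j x = (SOME h. alg_iso (scal Q) (dda_low Q j x) (subalg Q (j - 1)) h
     \<and> (\<forall>i\<in>{1..j - 1}. h (x i) = gen Q i))"

definition dda_transport ::
  "('k::field, 'f::division_ring) qna_data \<Rightarrow> nat \<Rightarrow> (nat \<Rightarrow> 'f) \<Rightarrow> ('f \<Rightarrow> 'f) \<Rightarrow> 'f \<Rightarrow> 'f" where
  "dda_transport Q j x f a = inv_into (dda_low Q j x) (dda_iso Q j x) (f (dda_iso Q j x a))"

text \<open>
  \<^const>\<open>Sum_any\<close> is the sum of a family with finite support; the support is finite here by
  local nilpotence.
\<close>

definition dda_step ::
  "('k::field, 'f::division_ring) qna_data \<Rightarrow> nat \<Rightarrow> (nat \<Rightarrow> 'f) \<Rightarrow> nat \<Rightarrow> 'f" where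
  "dda_step Q j x l =
     (if l < j then
        Sum_any (\<lambda>n. scal Q (qpar Q j ^ (n * (n + 1) div 2) * inverse ((qpar Q j - 1) ^ n))
          * dda_transport Q j x (hder Q j n)
              ((inv_into (dda_low Q j x) (dda_transport Q j x (sigma Q j)) ^^ n) (x l))
          * inverse (x j ^ n))
      else x l)"

primrec dda_iter :: "('k::field, 'f::division_ring) qna_data \<Rightarrow> nat \<Rightarrow> nat \<Rightarrow> 'f" where
  "dda_iter Q 0 = gen Q"
| "dda_iter Q (Suc k) = dda_step Q (ngens Q - k) (dda_iter Q k)"

text \<open>
  \<open>dda_gen Q j i\<close> and \<open>dda_alg Q j\<close> are \<open>X\<^sub>i\<^sup>(\<^sup>j\<^sup>)\<close> and \<open>A\<^sup>(\<^sup>j\<^sup>)\<close>, for \<open>2 \<le> j \<le> ngens Q + 1\<close>.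
\<close>

definition dda_gen :: "('k::field, 'f::division_ring) qna_data \<Rightarrow> nat \<Rightarrow> nat \<Rightarrow> 'f" where
  "dda_gen Q j = dda_iter Q (ngens Q + 1 - j)"

definition dda_alg :: "('k::field, 'f::division_ring) qna_data \<Rightarrow> nat \<Rightarrow> 'f set" where
  "dda_alg Q j = gen_alg (scal Q) (dda_gen Q j ` {1..ngens Q})"

lemma dda_gen_top: "dda_gen Q (ngens Q + 1) = gen Q"
  by (simp add: dda_gen_def)

lemma dda_gen_step:
  assumes "j \<in> {2..ngens Q}"
  shows "dda_gen Q j = dda_step Q j (dda_gen Q (j + 1))"
proof -
  have "ngens Q + 1 - j = Suc (ngens Q - j)" "ngens Q - (ngens Q - j) = j"
    using assms by auto
  then show ?thesis by (simp add: dda_gen_def)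
qed

section \<open>Completely prime spectra\<close>

text \<open>The locale \<^locale>\<open>domain\<close> of HOL-Algebra requires commutativity.\<close>

definition nc_domain :: "('a, 'm) ring_scheme \<Rightarrow> bool" where
  "nc_domain R \<longleftrightarrow> ring R \<and> \<one>\<^bsub>R\<^esub> \<noteq> \<zero>\<^bsub>R\<^esub>
     \<and> (\<forall>a\<in>carrier R. \<forall>b\<in>carrier R. a \<otimes>\<^bsub>R\<^esub> b = \<zero>\<^bsub>R\<^esub> \<longrightarrow> a = \<zero>\<^bsub>R\<^esub> \<or> b = \<zero>\<^bsub>R\<^esub>)"

definition CSpec :: "('a, 'm) ring_scheme \<Rightarrow> 'a set set" where
  "CSpec R = {P. ideal P R \<and> nc_domain (R Quot P)}"

definition zariski :: "('a, 'm) ring_scheme \<Rightarrow> 'a set topology" where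
  "zariski R = topology (\<lambda>U. \<exists>I. ideal I R \<and> U = CSpec R - {P \<in> CSpec R. I \<subseteq> P})"

lemma openin_zariski:
  assumes "ring R"
  shows "openin (zariski R) U
    \<longleftrightarrow> (\<exists>I. ideal I R \<and> U = CSpec R - {P \<in> CSpec R. I \<subseteq> P})"
proof -
  interpret R: ring R by fact
  let ?O = "\<lambda>U. \<exists>I. ideal I R \<and> U = CSpec R - {P \<in> CSpec R. I \<subseteq> P}"
  have prime: "a \<in> P \<or> b \<in> P"
    if P: "P \<in> CSpec R" and ab: "a \<in> carrier R" "b \<in> carrier R" "a \<otimes>\<^bsub>R\<^esub> b \<in> P" for P a b
  proof -
    from P interpret P: ideal P R by (simp add: CSpec_def)
    have D: "nc_domain (R Quot P)" using P by (simp add: CSpec_def)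
    have "(P +>\<^bsub>R\<^esub> a) \<otimes>\<^bsub>R Quot P\<^esub> (P +>\<^bsub>R\<^esub> b) = P +>\<^bsub>R\<^esub> (a \<otimes>\<^bsub>R\<^esub> b)"
      using ab by (simp add: FactRing_def P.rcoset_mult_add)
    also have "\<dots> = \<zero>\<^bsub>R Quot P\<^esub>"
      using ab by (simp add: FactRing_def P.a_rcos_const)
    finally have E: "(P +>\<^bsub>R\<^esub> a) \<otimes>\<^bsub>R Quot P\<^esub> (P +>\<^bsub>R\<^esub> b) = \<zero>\<^bsub>R Quot P\<^esub>" .
    have "P +>\<^bsub>R\<^esub> a = \<zero>\<^bsub>R Quot P\<^esub> \<or> P +>\<^bsub>R\<^esub> b = \<zero>\<^bsub>R Quot P\<^esub>"
    proof -
      have "P +>\<^bsub>R\<^esub> a \<in> carrier (R Quot P)" "P +>\<^bsub>R\<^esub> b \<in> carrier (R Quot P)"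
        using ab R.a_rcosetsI[OF P.a_subset] by (simp_all add: FactRing_def)
      then show ?thesis using D E unfolding nc_domain_def by blast
    qed
    then have "P +>\<^bsub>R\<^esub> a = P \<or> P +>\<^bsub>R\<^esub> b = P" by (simp add: FactRing_def)
    then show ?thesis
      using P.a_rcos_self[OF ab(1)] P.a_rcos_self[OF ab(2)] by blast
  qed
  have "istopology ?O"
    unfolding istopology_def
  proof (intro conjI allI impI)
    fix U V assume "?O U" "?O V"
    then obtain I J where I: "ideal I R" "U = CSpec R - {P \<in> CSpec R. I \<subseteq> P}"
      and J: "ideal J R" "V = CSpec R - {P \<in> CSpec R. J \<subseteq> P}" by blast
    interpret I: ideal I R by (rule I)
    interpret J: ideal J R by (rule J)
    have "I \<subseteq> P \<or> J \<subseteq> P" if P: "P \<in> CSpec R" "I \<inter> J \<subseteq> P" for P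
    proof (rule ccontr)
      assume "\<not> (I \<subseteq> P \<or> J \<subseteq> P)"
      then obtain a b where ab: "a \<in> I" "a \<notin> P" "b \<in> J" "b \<notin> P" by blast
      then have "a \<otimes>\<^bsub>R\<^esub> b \<in> I \<inter> J"
        using I.I_r_closed J.I_l_closed I.a_Hcarr J.a_Hcarr by blast
      then show False
        using prime[of P a b] P ab I.a_Hcarr J.a_Hcarr by blast
    qed
    then have "U \<inter> V = CSpec R - {P \<in> CSpec R. I \<inter> J \<subseteq> P}" using I J by blast
    then show "?O (U \<inter> V)" using R.i_intersect[OF I(1) J(1)] by blast
  next
    fix \<U> assume U: "\<forall>U\<in>\<U>. ?O U"
    then obtain f where f: "\<And>U. U \<in> \<U> \<Longrightarrow> ideal (f U) R \<and> U = CSpec R - {P \<in> CSpec R. f U \<subseteq> P}"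
      by metis
    define S where "S = \<Union> (f ` \<U>)"
    have S: "S \<subseteq> carrier R"
      using f ideal.Icarr unfolding S_def by fastforce
    have Idl: "Idl\<^bsub>R\<^esub> S \<subseteq> P \<longleftrightarrow> S \<subseteq> P" if "P \<in> CSpec R" for P
      using that R.genideal_self[OF S] R.genideal_minimal[of P S] by (auto simp: CSpec_def)
    have "\<Union> \<U> = CSpec R - {P \<in> CSpec R. Idl\<^bsub>R\<^esub> S \<subseteq> P}"
    proof (rule Set.set_eqI)
      fix P
      have "P \<in> \<Union> \<U> \<longleftrightarrow> (\<exists>U\<in>\<U>. P \<in> U)" by (rule Union_iff)
      also have "\<dots> \<longleftrightarrow> (\<exists>U\<in>\<U>. P \<in> CSpec R \<and> \<not> f U \<subseteq> P)"
      proof (rule bex_cong[OF refl])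
        fix U assume "U \<in> \<U>"
        then have U: "U = CSpec R - {P \<in> CSpec R. f U \<subseteq> P}" using f by simp
        show "P \<in> U \<longleftrightarrow> P \<in> CSpec R \<and> \<not> f U \<subseteq> P" by (subst U) blast
      qed
      also have "\<dots> \<longleftrightarrow> P \<in> CSpec R \<and> \<not> S \<subseteq> P" by (simp add: S_def UN_subset_iff)
      also have "\<dots> \<longleftrightarrow> P \<in> CSpec R - {P \<in> CSpec R. Idl\<^bsub>R\<^esub> S \<subseteq> P}" using Idl by auto
      finally show "P \<in> \<Union> \<U> \<longleftrightarrow> P \<in> CSpec R - {P \<in> CSpec R. Idl\<^bsub>R\<^esub> S \<subseteq> P}" .
    qed
    then show "?O (\<Union> \<U>)" using R.genideal_ideal[OF S] by blast
  qed
  then show ?thesis by (simp add: zariski_def)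
qed

text \<open>
  The subset of those \<open>P\<close> with \<open>z \<notin> P\<close> for \<open>e = 0\<close>, with \<open>z \<in> P\<close> for \<open>e = 1\<close>.
\<close>

definition stratum :: "('a, 'm) ring_scheme \<Rightarrow> 'a \<Rightarrow> nat \<Rightarrow> 'a set set" where
  "stratum R z e = {P \<in> CSpec R. if e = 0 then z \<notin> P else z \<in> P}"

definition bi_increasing_homeomorphism ::
  "'a set topology \<Rightarrow> 'b set topology \<Rightarrow> ('a set \<Rightarrow> 'b set) \<Rightarrow> bool" where
  "bi_increasing_homeomorphism T U f \<longleftrightarrow> homeomorphic_map T U f
     \<and> monotone_on (topspace T) (\<subseteq>) (\<subseteq>) f
     \<and> monotone_on (topspace U) (\<subseteq>) (\<subseteq>) (inv_into (topspace T) f)"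

section \<open>The maps between the completely prime spectra\<close>

abbreviation dda_ring :: "('k::field, 'f::division_ring) qna_data \<Rightarrow> nat \<Rightarrow> 'f ring" where
  "dda_ring Q j \<equiv> ring_on (dda_alg Q j)"

definition dda_ideal :: "('k::field, 'f::division_ring) qna_data \<Rightarrow> nat \<Rightarrow> 'f set" where
  "dda_ideal Q j = Idl\<^bsub>dda_ring Q (j + 1)\<^esub> {dda_gen Q (j + 1) j}"

text \<open>The homomorphism \<open>g\<^sub>j\<close>, which is unique on \<open>dda_alg Q j\<close>.\<close>

definition dda_g :: "('k::field, 'f::division_ring) qna_data \<Rightarrow> nat \<Rightarrow> 'f \<Rightarrow> 'f set" where
  "dda_g Q j = (SOME g. g \<in> ring_hom (dda_ring Q j) (dda_ring Q (j + 1) Quot dda_ideal Q j)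
     \<and> (\<forall>c. g (scal Q c) = dda_ideal Q j +>\<^bsub>dda_ring Q (j + 1)\<^esub> scal Q c)
     \<and> (\<forall>i\<in>{1..ngens Q}. g (dda_gen Q j i)
          = dda_ideal Q j +>\<^bsub>dda_ring Q (j + 1)\<^esub> dda_gen Q (j + 1) i))"

definition dda_localize ::
  "('k::field, 'f::division_ring) qna_data \<Rightarrow> nat \<Rightarrow> 'f set \<Rightarrow> 'f set" where
  "dda_localize Q j P = {p * inverse (dda_gen Q (j + 1) j ^ n) | p n. p \<in> P}"

definition psi :: "('k::field, 'f::division_ring) qna_data \<Rightarrow> nat \<Rightarrow> 'f set \<Rightarrow> 'f set" where
  "psi Q j P =
     (if dda_gen Q (j + 1) j \<notin> P then dda_localize Q j P \<inter> dda_alg Q j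
      else {a \<in> dda_alg Q j.
              dda_g Q j a \<in> (\<lambda>p. dda_ideal Q j +>\<^bsub>dda_ring Q (j + 1)\<^esub> p) ` P})"

end

theory Submission
  imports Defs
begin

text \<open>
  Completely prime ideals \<open>P\<close> avoiding \<open>x\<^sub>j\<close> correspond to those of the other algebra by
  extension to and contraction from the common localization at the powers of \<open>x\<^sub>j\<close>; the
  Ore condition and complete primeness make the extension of \<open>P\<close> two-sided. Completely prime
  ideals containing \<open>x\<^sub>j\<close> are pulled back along the surjection \<open>g\<^sub>j\<close>, so their images are
  those containing its kernel.

  What has to be established is the common localization and the existence of \<open>g\<^sub>j\<close>. Write \<open>B\<close>
  for the algebra generated by \<open>x\<^sub>1, \<dots>, x\<^sub>j\<^sub>-\<^sub>1\<close>. The deletion map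
  \<open>\<theta>(b) = \<Sum>\<^sub>n c\<^sub>n d\<^sub>n \<sigma>\<^sup>-\<^sup>n(b) x\<^sub>j\<^sup>-\<^sup>n\<close> satisfies \<open>x\<^sub>j \<theta>(b) = \<theta>(\<sigma>(b)) x\<^sub>j\<close>, by iterativity of
  \<open>d\<close> and \<open>(q - 1) c\<^sub>n\<^sub>+\<^sub>1 = q\<^sup>n\<^sup>+\<^sup>1 c\<^sub>n\<close>. This moves the powers of \<open>x\<^sub>j\<close> in \<open>\<theta>(a) \<theta>(b)\<close> to the
  right, after which multiplicativity is the \<open>q\<close>-Leibniz rule together with
  \<open>c\<^sub>i\<^sub>+\<^sub>k = q\<^sup>i\<^sup>k c\<^sub>i c\<^sub>k\<close>. Since \<open>\<theta>(b)\<close> is \<open>b\<close> plus terms of lower degree in \<open>x\<^sub>j\<close> with coefficients of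
  smaller nilpotency index, \<open>\<theta>\<close> is injective, \<open>B\<close> and \<open>\<theta>(B)\<close> lie in each other's localization,
  and the new algebra is again an iterated Ore extension; the latter makes \<open>g\<^sub>j\<close> well defined.
\<close>

section \<open>Ideals of subrings and completely prime spectra\<close>

text \<open>The weights c_n come from matching powers of x in x \<theta>(b) = \<theta>(\<sigma>(b))
  x: the coefficients at degree -n agree if c_{n+1} (q^{n+1} - 1) = c_n [n+1]_q q^{n+1}, and
  cancelling [n+1]_q suggests the quoted recursion. Only the product form is used, so q may be a
  root of unity.

  The main obstacle is the existence of g_j, as no presentation of the new algebra by relations is
  at hand. The homomorphism is replaced by the algebra generated by the pairs (y_i, x_i), shown to
  be single-valued modulo the ideal of x_j by adding one generator at a time. Below j it is the
  graph of the inverse of \<theta>; at j the missing derivation is harmless because x_j lies in the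
  ideal; above j both families obey the same skew commutation, and there the compatibility of
  \<sigma>_l with d_{j,n} enters.

  A single invariant, \<open>iterated_ore\<close>, is carried down through the steps. Freeness
  enters it in the weak form "r x_i in the lower algebra forces r = 0", which survives clearing
  denominators by powers of x_j.\<close>

lemma ring_of_type_algebra_simps [simp]:
  "a \<otimes>\<^bsub>ring_of_type_algebra\<^esub> b = a * b"
  "a \<oplus>\<^bsub>ring_of_type_algebra\<^esub> b = a + b"
  "\<one>\<^bsub>ring_of_type_algebra\<^esub> = 1"
  "\<zero>\<^bsub>ring_of_type_algebra\<^esub> = 0"
  by (simp_all add: ring_of_type_algebra_def)

definition subring_on :: "'a::ring_1 set \<Rightarrow> bool" where
  "subring_on S \<longleftrightarrow> 1 \<in> S \<and> (\<forall>a\<in>S. \<forall>b\<in>S. a - b \<in> S \<and> a * b \<in> S)"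

lemma subring_onD:
  assumes "subring_on S"
  shows "1 \<in> S" "0 \<in> S"
    and "a \<in> S \<Longrightarrow> b \<in> S \<Longrightarrow> a - b \<in> S" "a \<in> S \<Longrightarrow> b \<in> S \<Longrightarrow> a * b \<in> S"
    and "a \<in> S \<Longrightarrow> b \<in> S \<Longrightarrow> a + b \<in> S" "a \<in> S \<Longrightarrow> - a \<in> S" "a \<in> S \<Longrightarrow> a ^ n \<in> S"
proof -
  show one: "1 \<in> S" and diff: "\<And>a b. a \<in> S \<Longrightarrow> b \<in> S \<Longrightarrow> a - b \<in> S"
    and mult: "\<And>a b. a \<in> S \<Longrightarrow> b \<in> S \<Longrightarrow> a * b \<in> S"
    using assms by (auto simp: subring_on_def)
  show zero: "0 \<in> S" using diff[OF one one] by simp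
  show neg: "\<And>a. a \<in> S \<Longrightarrow> - a \<in> S" using diff[OF zero] by simp
  show "\<And>a b. a \<in> S \<Longrightarrow> b \<in> S \<Longrightarrow> a + b \<in> S" using diff neg by (metis diff_minus_eq_add)
  show "\<And>a. a \<in> S \<Longrightarrow> a ^ n \<in> S" using one mult by (induction n) auto
qed

lemma ring_ring_on: "subring_on S \<Longrightarrow> ring (ring_on S)"
proof -
  assume S: "subring_on S"
  note D = subring_onD[OF S]
  have "\<exists>y\<in>S. y + x = 0" if "x \<in> S" for x
    using D(6)[OF that] by (intro bexI[of _ "- x"]) auto
  then show ?thesis
    by (intro ringI abelian_groupI monoidI) (auto simp: D algebra_simps)
qed

lemma subring_on_if_ring: "ring (ring_on S) \<Longrightarrow> subring_on S"
proof -
  assume "ring (ring_on S)"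
  then interpret ring "ring_on S" .
  have neg: "- b \<in> S" if b: "b \<in> S" for b
  proof -
    obtain c where "c \<in> S" "b + c = 0" using b a_inv_closed[of b] r_neg[of b] by auto
    then show ?thesis using add_eq_0_iff[of b c] by simp
  qed
  have "a - b \<in> S" if "a \<in> S" "b \<in> S" for a b
    using a_closed[of a "- b"] neg that by simp
  then show ?thesis using one_closed m_closed by (simp add: subring_on_def)
qed

text \<open>Closure under negation is left to \<open>ideal_on_minus\<close>: it is multiplication by
  -1, which lies in any subring.\<close>

definition ideal_on :: "'a::ring_1 set \<Rightarrow> 'a set \<Rightarrow> bool" where
  "ideal_on S I \<longleftrightarrow> I \<subseteq> S \<and> 0 \<in> I \<and> (\<forall>a\<in>I. \<forall>b\<in>I. a + b \<in> I)
     \<and> (\<forall>a\<in>S. \<forall>p\<in>I. a * p \<in> I \<and> p * a \<in> I)"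

lemma ideal_onD:
  assumes "ideal_on S I"
  shows "I \<subseteq> S" "a \<in> I \<Longrightarrow> a \<in> S" "0 \<in> I"
    and "a \<in> I \<Longrightarrow> b \<in> I \<Longrightarrow> a + b \<in> I"
    and "a \<in> S \<Longrightarrow> p \<in> I \<Longrightarrow> a * p \<in> I" "a \<in> S \<Longrightarrow> p \<in> I \<Longrightarrow> p * a \<in> I"
  using assms by (auto simp: ideal_on_def)

lemma ideal_on_minus:
  assumes "subring_on S" "ideal_on S I"
  shows "a \<in> I \<Longrightarrow> - a \<in> I" "a \<in> I \<Longrightarrow> b \<in> I \<Longrightarrow> a - b \<in> I"
proof -
  have "- 1 \<in> S" using assms(1) by (simp add: subring_onD)
  then have neg: "- a \<in> I" if "a \<in> I" for a
    using ideal_onD(5)[OF assms(2), of "- 1" a] that by simp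
  show "a \<in> I \<Longrightarrow> - a \<in> I" by (rule neg)
  show "a \<in> I \<Longrightarrow> b \<in> I \<Longrightarrow> a - b \<in> I"
    using ideal_onD(4)[OF assms(2), of a "- b"] neg by simp
qed

lemma ideal_ring_on_iff:
  assumes S: "subring_on S"
  shows "ideal I (ring_on S) \<longleftrightarrow> ideal_on S I"
proof
  assume "ideal I (ring_on S)"
  then interpret ideal I "ring_on S" .
  show "ideal_on S I"
    using a_subset I_l_closed I_r_closed additive_subgroup.zero_closed[OF additive_subgroup_axioms]
      additive_subgroup.a_closed[OF additive_subgroup_axioms]
    by (auto simp: ideal_on_def)
next
  assume I: "ideal_on S I"
  interpret R: ring "ring_on S" by (rule ring_ring_on[OF S])
  have inv: "\<ominus>\<^bsub>ring_on S\<^esub> a = - a" if "a \<in> S" for a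
    using R.minus_equality[of "- a" a] that subring_onD[OF S] by simp
  have "subgroup I (add_monoid (ring_on S))"
  proof (rule R.add.subgroupI)
    show "I \<subseteq> carrier (ring_on S)" "I \<noteq> {}" using I by (auto simp: ideal_on_def)
    show "\<ominus>\<^bsub>ring_on S\<^esub> a \<in> I" if "a \<in> I" for a
      using that inv[of a] ideal_on_minus(1)[OF S I] ideal_onD(2)[OF I] by simp
  qed (use ideal_onD(4)[OF I] in simp)
  then show "ideal I (ring_on S)"
    by (intro idealI R.ring_axioms) (use ideal_onD[OF I] in auto)
qed

lemma a_r_coset_ring_on: "I +>\<^bsub>ring_on S\<^esub> a = {i + a | i. i \<in> I}"
  by (auto simp: a_r_coset_def')

lemma a_r_coset_eq_iff:
  assumes S: "subring_on S" and I: "ideal_on S I"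
  shows "I +>\<^bsub>ring_on S\<^esub> a = I +>\<^bsub>ring_on S\<^esub> b \<longleftrightarrow> a - b \<in> I"
proof
  assume "I +>\<^bsub>ring_on S\<^esub> a = I +>\<^bsub>ring_on S\<^esub> b"
  moreover have "a \<in> I +>\<^bsub>ring_on S\<^esub> a"
    using ideal_onD(3)[OF I] by (force simp: a_r_coset_ring_on)
  ultimately show "a - b \<in> I" by (auto simp: a_r_coset_ring_on)
next
  assume ab: "a - b \<in> I"
  have "\<exists>i'\<in>I. i + a = i' + b" if "i \<in> I" for i
    using ideal_onD(4)[OF I that ab] by (intro bexI[of _ "i + (a - b)"]) auto
  moreover have "\<exists>i'\<in>I. i + b = i' + a" if "i \<in> I" for i
    using ideal_on_minus(2)[OF S I that ab] by (intro bexI[of _ "i - (a - b)"]) auto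
  ultimately show "I +>\<^bsub>ring_on S\<^esub> a = I +>\<^bsub>ring_on S\<^esub> b"
    by (fastforce simp: a_r_coset_ring_on)
qed

section \<open>Completely prime ideals and Zariski-closed sets in terms of elements\<close>

definition cprime_on :: "'a::ring_1 set \<Rightarrow> 'a set \<Rightarrow> bool" where
  "cprime_on S P \<longleftrightarrow> ideal_on S P \<and> 1 \<notin> P \<and> (\<forall>a\<in>S. \<forall>b\<in>S. a * b \<in> P \<longrightarrow> a \<in> P \<or> b \<in> P)"

lemma cprime_onD:
  assumes "cprime_on S P"
  shows "ideal_on S P" "1 \<notin> P" "a \<in> S \<Longrightarrow> b \<in> S \<Longrightarrow> a * b \<in> P \<Longrightarrow> a \<in> P \<or> b \<in> P"
  using assms by (auto simp: cprime_on_def)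

lemma CSpec_ring_on_iff:
  assumes S: "subring_on S"
  shows "P \<in> CSpec (ring_on S) \<longleftrightarrow> cprime_on S P"
proof (cases "ideal_on S P")
  case False
  then show ?thesis by (simp add: CSpec_def cprime_on_def ideal_ring_on_iff[OF S])
next
  case I: True
  let ?R = "ring_on S"
  interpret P: ideal P ?R using I by (simp add: ideal_ring_on_iff[OF S])
  have zero: "P +>\<^bsub>?R\<^esub> a = P \<longleftrightarrow> a \<in> P" if "a \<in> S" for a
  proof -
    have "P = P +>\<^bsub>?R\<^esub> 0" by (auto simp: a_r_coset_ring_on)
    then show ?thesis using a_r_coset_eq_iff[OF S I, of a 0] by simp
  qed
  have car: "U \<in> carrier (?R Quot P) \<longleftrightarrow> (\<exists>a\<in>S. U = P +>\<^bsub>?R\<^esub> a)" for U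
    by (auto simp: FactRing_def A_RCOSETS_def')
  have "nc_domain (?R Quot P) \<longleftrightarrow> P +>\<^bsub>?R\<^esub> 1 \<noteq> P \<and>
    (\<forall>a\<in>S. \<forall>b\<in>S. P +>\<^bsub>?R\<^esub> (a * b) = P \<longrightarrow> P +>\<^bsub>?R\<^esub> a = P \<or> P +>\<^bsub>?R\<^esub> b = P)"
  proof -
    have mult: "(P +>\<^bsub>?R\<^esub> a) \<otimes>\<^bsub>?R Quot P\<^esub> (P +>\<^bsub>?R\<^esub> b) = P +>\<^bsub>?R\<^esub> (a * b)" if "a \<in> S" "b \<in> S" for a b
      using P.rcoset_mult_add[of a b] that by (simp add: FactRing_def)
    have "(\<forall>U\<in>carrier (?R Quot P). \<forall>Y\<in>carrier (?R Quot P). U \<otimes>\<^bsub>?R Quot P\<^esub> Y = P \<longrightarrow> U = P \<or> Y = P)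
      \<longleftrightarrow> (\<forall>a\<in>S. \<forall>b\<in>S. P +>\<^bsub>?R\<^esub> (a * b) = P \<longrightarrow> P +>\<^bsub>?R\<^esub> a = P \<or> P +>\<^bsub>?R\<^esub> b = P)"
      using mult car by (smt (verit, best))
    moreover have "\<one>\<^bsub>?R Quot P\<^esub> = P +>\<^bsub>?R\<^esub> 1" "\<zero>\<^bsub>?R Quot P\<^esub> = P"
      by (simp_all add: FactRing_def)
    ultimately show ?thesis
      unfolding nc_domain_def using P.quotient_is_ring by simp
  qed
  also have "\<dots> \<longleftrightarrow> 1 \<notin> P \<and> (\<forall>a\<in>S. \<forall>b\<in>S. a * b \<in> P \<longrightarrow> a \<in> P \<or> b \<in> P)"
    using zero subring_onD[OF S] by simp
  finally show ?thesis
    using I P.ideal_axioms by (simp add: CSpec_def cprime_on_def)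
qed

lemma Idl_subset_cprime_iff:
  assumes S: "subring_on S" and P: "cprime_on S P" and H: "H \<subseteq> S"
  shows "(genideal (ring_on S) H) \<subseteq> P \<longleftrightarrow> H \<subseteq> P"
proof -
  interpret ring "ring_on S" by (rule ring_ring_on[OF S])
  have "ideal P (ring_on S)" using P by (simp add: ideal_ring_on_iff[OF S] cprime_on_def)
  then show ?thesis using genideal_self[of H] genideal_minimal[of P H] H by auto
qed

lemma ideal_on_Idl:
  assumes S: "subring_on S" and H: "H \<subseteq> S"
  shows "ideal_on S (genideal (ring_on S) H)" "H \<subseteq> Idl\<^bsub>ring_on S\<^esub> H"
proof -
  interpret ring "ring_on S" by (rule ring_ring_on[OF S])
  show "ideal_on S (genideal (ring_on S) H)" "H \<subseteq> Idl\<^bsub>ring_on S\<^esub> H"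
    using genideal_ideal[of H] genideal_self[of H] H by (simp_all add: ideal_ring_on_iff[OF S])
qed

lemma closedin_zariski_iff:
  assumes S: "subring_on S"
  shows "closedin (zariski (ring_on S)) C
    \<longleftrightarrow> (\<exists>I. ideal_on S I \<and> C = {P \<in> CSpec (ring_on S). I \<subseteq> P})"
    and "topspace (zariski (ring_on S)) = CSpec (ring_on S)"
proof -
  let ?R = "ring_on S"
  have op: "openin (zariski ?R) U \<longleftrightarrow> (\<exists>I. ideal_on S I \<and> U = CSpec ?R - {P \<in> CSpec ?R. I \<subseteq> P})" for U
    using openin_zariski[OF ring_ring_on[OF S]] by (simp add: ideal_ring_on_iff[OF S])
  \<comment> \<open>The unit ideal has no completely prime ideal above it, so it witnesses that the
    whole spectrum is open.\<close>
  have "ideal_on S S" using subring_onD[OF S] by (simp add: ideal_on_def)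
  moreover have "{P \<in> CSpec ?R. S \<subseteq> P} = {}"
    using subring_onD[OF S] by (auto simp: CSpec_ring_on_iff[OF S] cprime_on_def)
  ultimately have "openin (zariski ?R) (CSpec ?R)"
    unfolding op by (intro exI[of _ S]) auto
  moreover have "topspace (zariski ?R) \<subseteq> CSpec ?R"
    unfolding topspace_def using op by fastforce
  ultimately show top: "topspace (zariski ?R) = CSpec ?R"
    by (simp add: openin_subset subset_antisym)
  show "closedin (zariski ?R) C \<longleftrightarrow> (\<exists>I. ideal_on S I \<and> C = {P \<in> CSpec ?R. I \<subseteq> P})"
  proof
    assume "closedin (zariski ?R) C"
    then obtain I where "ideal_on S I" "C \<subseteq> CSpec ?R" "CSpec ?R - C = CSpec ?R - {P \<in> CSpec ?R. I \<subseteq> P}"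
      by (auto simp: closedin_def op top)
    then show "\<exists>I. ideal_on S I \<and> C = {P \<in> CSpec ?R. I \<subseteq> P}"
      by (intro exI[of _ I]) blast
  qed (auto simp: closedin_def op top)
qed

text \<open>Allowing arbitrary subsets \<open>H\<close> instead of ideals means that sets
  transported from one algebra to another never have to be shown to be ideals.\<close>

lemma closedin_subtopology_zariski_iff:
  assumes S: "subring_on S" and U: "U \<subseteq> CSpec (ring_on S)"
  shows "closedin (subtopology (zariski (ring_on S)) U) C
    \<longleftrightarrow> (\<exists>H. H \<subseteq> S \<and> C = {P \<in> U. H \<subseteq> P})"
proof
  assume "closedin (subtopology (zariski (ring_on S)) U) C"
  then obtain I where "ideal_on S I" "C = {P \<in> CSpec (ring_on S). I \<subseteq> P} \<inter> U"
    by (auto simp: closedin_subtopology closedin_zariski_iff[OF S])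
  then show "\<exists>H. H \<subseteq> S \<and> C = {P \<in> U. H \<subseteq> P}"
    using U by (intro exI[of _ I]) (auto simp: ideal_on_def)
next
  assume "\<exists>H. H \<subseteq> S \<and> C = {P \<in> U. H \<subseteq> P}"
  then obtain H where H: "H \<subseteq> S" "C = {P \<in> U. H \<subseteq> P}" by blast
  let ?I = "Idl\<^bsub>ring_on S\<^esub> H"
  have "?I \<subseteq> P \<longleftrightarrow> H \<subseteq> P" if "P \<in> CSpec (ring_on S)" for P
    using that Idl_subset_cprime_iff[OF S _ H(1)] by (simp add: CSpec_ring_on_iff[OF S])
  then have "C = {P \<in> CSpec (ring_on S). ?I \<subseteq> P} \<inter> U" using H(2) U by blast
  then show "closedin (subtopology (zariski (ring_on S)) U) C"
    using ideal_on_Idl(1)[OF S H(1)] by (auto simp: closedin_subtopology closedin_zariski_iff[OF S])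
qed

text \<open>\<open>order\<close> yields injectivity by antisymmetry and monotonicity in both
  directions; \<open>bwd\<close> makes preimages of closed sets closed, \<open>fwd\<close> makes
  images of closed sets closed.\<close>

lemma bi_increasing_homeomorphismI:
  assumes R: "subring_on R" and R': "subring_on R'"
    and U: "U \<subseteq> CSpec (ring_on R)" and fU: "f ` U \<subseteq> CSpec (ring_on R')"
    and order: "\<And>P P'. P \<in> U \<Longrightarrow> P' \<in> U \<Longrightarrow> f P \<subseteq> f P' \<longleftrightarrow> P \<subseteq> P'"
    and fwd: "\<And>H. H \<subseteq> R \<Longrightarrow> \<exists>H'\<subseteq>R'. \<forall>P\<in>U. H \<subseteq> P \<longleftrightarrow> H' \<subseteq> f P"
    and bwd: "\<And>H'. H' \<subseteq> R' \<Longrightarrow> \<exists>H\<subseteq>R. \<forall>P\<in>U. H' \<subseteq> f P \<longleftrightarrow> H \<subseteq> P"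
  shows "bi_increasing_homeomorphism (subtopology (zariski (ring_on R)) U)
    (subtopology (zariski (ring_on R')) (f ` U)) f"
proof -
  let ?T = "subtopology (zariski (ring_on R)) U"
  let ?T' = "subtopology (zariski (ring_on R')) (f ` U)"
  have top: "topspace ?T = U" "topspace ?T' = f ` U"
    using U fU by (auto simp: closedin_zariski_iff(2)[OF R] closedin_zariski_iff(2)[OF R'])
  have inj: "inj_on f U"
    by (rule inj_onI) (use order in blast)
  note cl = closedin_subtopology_zariski_iff[OF R U] closedin_subtopology_zariski_iff[OF R' fU]
  have "continuous_map ?T ?T' f"
    unfolding continuous_map_closedin top
  proof (intro conjI allI impI ballI)
    fix C assume "closedin ?T' C"
    then obtain H' where H': "H' \<subseteq> R'" "C = {P \<in> f ` U. H' \<subseteq> P}" using cl by auto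
    obtain H where "H \<subseteq> R" "\<forall>P\<in>U. H' \<subseteq> f P \<longleftrightarrow> H \<subseteq> P" using bwd[OF H'(1)] by blast
    then show "closedin ?T {P \<in> U. f P \<in> C}"
      unfolding cl H'(2) by (intro exI[of _ H]) auto
  qed auto
  moreover have "closed_map ?T ?T' f"
    unfolding closed_map_def
  proof (intro allI impI)
    fix C assume "closedin ?T C"
    then obtain H where H: "H \<subseteq> R" "C = {P \<in> U. H \<subseteq> P}" using cl by auto
    obtain H' where "H' \<subseteq> R'" "\<forall>P\<in>U. H \<subseteq> P \<longleftrightarrow> H' \<subseteq> f P" using fwd[OF H(1)] by blast
    then show "closedin ?T' (f ` C)"
      unfolding cl H(2) by (intro exI[of _ H']) auto
  qed
  ultimately have "homeomorphic_map ?T ?T' f"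
    using inj by (intro bijective_closed_imp_homeomorphic_map) (simp_all only: top)
  moreover have "monotone_on (f ` U) (\<subseteq>) (\<subseteq>) (inv_into U f)"
    using order inj by (auto simp: monotone_on_def inv_into_f_f)
  moreover have "monotone_on U (\<subseteq>) (\<subseteq>) f"
    using order by (auto simp: monotone_on_def)
  ultimately show ?thesis unfolding bi_increasing_homeomorphism_def top by blast
qed

lemma stratum_ring_on:
  assumes "subring_on S"
  shows "stratum (ring_on S) z 0 = {P. cprime_on S P \<and> z \<notin> P}"
    and "stratum (ring_on S) z 1 = {P. cprime_on S P \<and> z \<in> P}"
  by (auto simp: stratum_def CSpec_ring_on_iff[OF assms])

section \<open>Contraction along a localization\<close>

text \<open>Read in the division ring, the equation turns the left fraction with denominator
  \<open>x ^ n\<close> into a right fraction with denominator \<open>x ^ k\<close>.\<close>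

definition ore_powers :: "'f::division_ring set \<Rightarrow> 'f \<Rightarrow> bool" where
  "ore_powers R x \<longleftrightarrow> x \<in> R \<and> x \<noteq> 0 \<and> (\<forall>r\<in>R. \<forall>n. \<exists>r'\<in>R. \<exists>k. r * x ^ k = x ^ n * r')"

lemma powers_commute: "x ^ m * x ^ n = x ^ n * (x :: 'a::monoid_mult) ^ m"
  by (metis add.commute power_add)

text \<open>The right fractions with numerator in \<open>P\<close>, phrased by a clearing exponent
  so that ideal arguments involve no inverses.\<close>

definition localized :: "'f::division_ring \<Rightarrow> 'f set \<Rightarrow> 'f set" where
  "localized x P = {z. \<exists>n. z * x ^ n \<in> P}"

lemma localized_eq_fractions:
  assumes "x \<noteq> 0"
  shows "localized x P = {p * inverse (x ^ n) | p n. p \<in> P}"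
proof -
  have nz: "x ^ n \<noteq> 0" for n using assms by simp
  have "\<exists>p n. z = p * inverse (x ^ n) \<and> p \<in> P" if "z * x ^ n \<in> P" for z n
  proof (intro exI conjI)
    show "z = z * x ^ n * inverse (x ^ n)" using assms by (simp only: mult.assoc right_inverse nz mult_1_right not_False_eq_True)
  qed fact
  moreover have "\<exists>n. p * inverse (x ^ m) * x ^ n \<in> P" if "p \<in> P" for p m
  proof
    show "p * inverse (x ^ m) * x ^ m \<in> P"
      using that assms by (simp only: mult.assoc left_inverse nz mult_1_right not_False_eq_True)
  qed
  ultimately show ?thesis by (auto simp: localized_def)
qed

text \<open>The class of \<open>x\<close> is a nonzero element of the domain \<open>R\<close> modulo
  \<open>P\<close>, hence so is each of its powers.\<close>

lemma cprime_on_cancel_power: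
  assumes R: "subring_on R" and P: "cprime_on R P" and x: "x \<in> R" "x \<notin> P" and a: "a \<in> R"
  shows "x ^ n \<notin> P" "a * x ^ n \<in> P \<longleftrightarrow> a \<in> P" "x ^ n * a \<in> P \<longleftrightarrow> a \<in> P"
proof -
  have pow: "x ^ n \<in> R" for n by (rule subring_onD(7)[OF R x(1)])
  show xn: "x ^ n \<notin> P"
  proof (induction n)
    case 0 then show ?case using cprime_onD(2)[OF P] by simp
  next
    case (Suc n) then show ?case unfolding power_Suc using cprime_onD(3)[OF P x(1) pow[of n]] x(2) by blast
  qed
  show "a * x ^ n \<in> P \<longleftrightarrow> a \<in> P"
    using cprime_onD(3)[OF P a pow[of n]] ideal_onD(6)[OF cprime_onD(1)[OF P] pow[of n], of a] xn by blast
  show "x ^ n * a \<in> P \<longleftrightarrow> a \<in> P"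
    using cprime_onD(3)[OF P pow[of n] a] ideal_onD(5)[OF cprime_onD(1)[OF P] pow[of n], of a] xn by blast
qed

text \<open>The symmetry between \<open>R\<close> and \<open>R'\<close> lets each statement about
  contraction be applied in both directions.\<close>

definition same_localization :: "'f::division_ring \<Rightarrow> 'f set \<Rightarrow> 'f set \<Rightarrow> bool" where
  "same_localization x R R' \<longleftrightarrow> subring_on R \<and> subring_on R' \<and> ore_powers R x \<and> ore_powers R' x
     \<and> R \<subseteq> localized x R' \<and> R' \<subseteq> localized x R"

lemma same_localization_sym: "same_localization x R R' \<Longrightarrow> same_localization x R' R"
  by (auto simp: same_localization_def)

lemma cprime_on_contraction:
  assumes L: "same_localization x R R'" and P: "cprime_on R P" "x \<notin> P"
  shows "cprime_on R' (localized x P \<inter> R')" "x \<notin> localized x P \<inter> R'"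
proof -
  have R: "subring_on R" "x \<in> R" and R': "subring_on R'" "x \<in> R'"
    and ore: "\<And>r n. r \<in> R \<Longrightarrow> \<exists>r'\<in>R. \<exists>k. r * x ^ k = x ^ n * r'"
    and loc: "\<And>a. a \<in> R' \<Longrightarrow> \<exists>n. a * x ^ n \<in> R"
    using L by (auto simp: same_localization_def ore_powers_def localized_def)
  note cancel = cprime_on_cancel_power[OF R(1) P(1) R(2) P(2)]
  note I = ideal_onD[OF cprime_onD(1)[OF P(1)]]
  note D = subring_onD[OF R(1)] and D' = subring_onD[OF R'(1)]
  have pow: "x ^ n \<in> R" for n by (rule D(7)[OF R(2)])
  let ?Q = "localized x P \<inter> R'"
  have QI: "a \<in> ?Q" if "a \<in> R'" "a * x ^ n \<in> P" for a n
    using that by (auto simp: localized_def)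
  have QE: "\<exists>n. a * x ^ n \<in> P" if "a \<in> ?Q" for a
    using that by (auto simp: localized_def)
  have add: "a + b \<in> ?Q" if a: "a \<in> ?Q" and b: "b \<in> ?Q" for a b
  proof -
    obtain n m where "a * x ^ n \<in> P" "b * x ^ m \<in> P" using QE a b by blast
    then have "a * x ^ n * x ^ m + b * x ^ m * x ^ n \<in> P" using I(4) I(6)[OF pow] by simp
    also have "a * x ^ n * x ^ m + b * x ^ m * x ^ n = (a + b) * x ^ (n + m)"
      by (simp add: distrib_right mult.assoc power_add powers_commute[of x m n])
    finally show ?thesis using D'(5)[of a b] a b by (intro QI[of _ "n + m"]) auto
  qed
  have mult: "a * p \<in> ?Q \<and> p * a \<in> ?Q" if a: "a \<in> R'" and p: "p \<in> ?Q" for a p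
  proof -
    obtain n where n: "p * x ^ n \<in> P" using QE p by blast
    obtain k where k: "a * x ^ k \<in> R" using loc a by blast
    \<comment> \<open>The denominator \<open>x ^ k\<close> of \<open>a\<close> has to pass to the
      right of the numerator of \<open>p\<close>. The new numerator \<open>r\<close> is in
      \<open>P\<close> because \<open>x ^ k * r\<close> is and powers of \<open>x\<close> cancel
      modulo \<open>P\<close>.\<close>
    obtain r m where r: "r \<in> R" "p * x ^ n * x ^ m = x ^ k * r"
      using ore[of "p * x ^ n" k] n I(2) by blast
    have "x ^ k * r \<in> P" using I(6)[OF pow[of m] n] by (simp only: r(2))
    then have "a * x ^ k * r \<in> P" using cancel(3)[OF r(1)] I(5)[OF k] by simp
    moreover have "a * x ^ k * r = a * p * x ^ (n + m)"
      using r(2) by (simp add: mult.assoc power_add)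
    ultimately have 1: "a * p * x ^ (n + m) \<in> P" by simp
    obtain r' l where r': "r' \<in> R" "a * x ^ k * x ^ l = x ^ n * r'"
      using ore[OF k] by blast
    have "p * x ^ n * r' \<in> P" by (rule I(6)[OF r'(1) n])
    moreover have "p * x ^ n * r' = p * a * x ^ (k + l)"
      using r'(2) by (simp add: mult.assoc power_add)
    ultimately have 2: "p * a * x ^ (k + l) \<in> P" by simp
    show ?thesis using QI[OF _ 1] QI[OF _ 2] D'(4)[of a p] D'(4)[of p a] a p by blast
  qed
  have prime: "a \<in> ?Q \<or> b \<in> ?Q" if a: "a \<in> R'" and b: "b \<in> R'" and ab: "a * b \<in> ?Q" for a b
  proof -
    obtain n where n: "a * b * x ^ n \<in> P" using QE ab by blast
    obtain k l where k: "a * x ^ k \<in> R" and l: "b * x ^ l \<in> R" using loc a b by blast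
    \<comment> \<open>As a fraction, \<open>s\<close> is \<open>b * x ^ (l + m)\<close> divided by
      \<open>x ^ k\<close> on the left, so \<open>a * x ^ k * s\<close> is \<open>a * b\<close>
      times a power of \<open>x\<close>.\<close>
    obtain s m where s: "s \<in> R" "b * x ^ l * x ^ m = x ^ k * s" using ore[OF l] by blast
    have "a * x ^ k * s * x ^ n = a * (b * x ^ l * x ^ m) * x ^ n"
      unfolding s(2) by (simp add: mult.assoc)
    also have "\<dots> = a * b * (x ^ (l + m) * x ^ n)" by (simp add: mult.assoc power_add)
    also have "\<dots> = a * b * x ^ n * x ^ (l + m)"
      by (simp add: powers_commute[of x "l + m" n] mult.assoc)
    also have "\<dots> \<in> P" by (rule I(6)[OF pow n])
    finally have "a * x ^ k * s * x ^ n \<in> P" .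
    then have "a * x ^ k * s \<in> P" using cancel(2)[OF D(4)[OF k s(1)]] by simp
    then consider "a * x ^ k \<in> P" | "s \<in> P" using cprime_onD(3)[OF P(1) k s(1)] by blast
    then show ?thesis
    proof cases
      case 1 then show ?thesis using QI a by blast
    next
      case 2
      then have "x ^ k * s \<in> P" by (rule I(5)[OF pow])
      then have "b * x ^ (l + m) \<in> P" by (simp add: s(2)[symmetric] mult.assoc power_add)
      then show ?thesis using QI b by blast
    qed
  qed
  have "0 \<in> ?Q" using QI[of 0 0] I(3) D'(2) by simp
  moreover have "1 \<notin> ?Q" using QE cancel(1)[OF D(1)] by fastforce
  ultimately show "cprime_on R' ?Q"
    using add mult prime unfolding cprime_on_def ideal_on_def by (intro conjI ballI impI) auto
  have "x * x ^ n \<notin> P" for n using cancel(1)[OF D(1), of "Suc n"] by simp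
  then show "x \<notin> ?Q" using QE by blast
qed

lemma contraction_contraction:
  assumes L: "same_localization x R R'" and P: "cprime_on R P" "x \<notin> P"
  shows "localized x (localized x P \<inter> R') \<inter> R = P"
proof -
  have R: "subring_on R" "x \<in> R" and R': "subring_on R'" "x \<in> R'"
    and loc: "\<And>a. a \<in> R \<Longrightarrow> \<exists>n. a * x ^ n \<in> R'"
    using L by (auto simp: same_localization_def ore_powers_def localized_def)
  note cancel = cprime_on_cancel_power[OF R(1) P(1) R(2) P(2)]
  note I = ideal_onD[OF cprime_onD(1)[OF P(1)]]
  show ?thesis
  proof (intro equalityI subsetI IntI)
    fix a assume a: "a \<in> localized x (localized x P \<inter> R') \<inter> R"
    then obtain n m where "a * x ^ n * x ^ m \<in> P" unfolding localized_def by blast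
    then have "a * x ^ (n + m) \<in> P" by (simp only: power_add mult.assoc)
    then show "a \<in> P" using cancel(2)[of a "n + m"] a by blast
  next
    fix a assume a: "a \<in> P"
    then show aR: "a \<in> R" by (rule I(2))
    obtain n where n: "a * x ^ n \<in> R'" using loc[OF aR] by blast
    have "a * x ^ n * x ^ 0 \<in> P"
      unfolding power_0 mult_1_right by (rule I(6)[OF subring_onD(7)[OF R] a])
    then have "a * x ^ n \<in> localized x P \<inter> R'" using n unfolding localized_def by blast
    then show "a \<in> localized x (localized x P \<inter> R')" unfolding localized_def by blast
  qed
qed

lemma contraction_bi_increasing_homeomorphism:
  assumes L: "same_localization x R R'"
  defines "f \<equiv> \<lambda>P. localized x P \<inter> R'"
  defines "U \<equiv> stratum (ring_on R) x 0"
  shows "f ` U = stratum (ring_on R') x 0"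
    and "bi_increasing_homeomorphism (subtopology (zariski (ring_on R)) U)
      (subtopology (zariski (ring_on R')) (f ` U)) f"
proof -
  have R: "subring_on R" "x \<in> R" and R': "subring_on R'" "x \<in> R'"
    and loc: "R \<subseteq> localized x R'" "R' \<subseteq> localized x R"
    using L by (auto simp: same_localization_def ore_powers_def)
  note L' = same_localization_sym[OF L]
  have U: "P \<in> U \<longleftrightarrow> cprime_on R P \<and> x \<notin> P" for P
    by (simp add: U_def stratum_ring_on[OF R(1)])
  have ff: "localized x (f P) \<inter> R = P" if "P \<in> U" for P
    unfolding f_def by (rule contraction_contraction[OF L]) (use that U in blast)+
  show im: "f ` U = stratum (ring_on R') x 0"
  proof (intro equalityI subsetI)
    fix P assume "P \<in> f ` U"
    then show "P \<in> stratum (ring_on R') x 0"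
      unfolding stratum_ring_on(1)[OF R'(1)] f_def using cprime_on_contraction[OF L] U by blast
  next
    fix P assume "P \<in> stratum (ring_on R') x 0"
    then have P: "cprime_on R' P" "x \<notin> P" unfolding stratum_ring_on(1)[OF R'(1)] by blast+
    have "localized x P \<inter> R \<in> U" unfolding U using cprime_on_contraction[OF L' P] by (rule conjI)
    moreover have "P = f (localized x P \<inter> R)"
      unfolding f_def by (rule contraction_contraction[OF L' P, symmetric])
    ultimately show "P \<in> f ` U" by blast
  qed
  have order: "f P \<subseteq> f P' \<longleftrightarrow> P \<subseteq> P'" if "P \<in> U" "P' \<in> U" for P P'
  proof
    assume "f P \<subseteq> f P'"
    then have "localized x (f P) \<inter> R \<subseteq> localized x (f P') \<inter> R" unfolding localized_def by blast
    then show "P \<subseteq> P'" unfolding ff[OF that(1)] ff[OF that(2)] .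
  next
    assume "P \<subseteq> P'"
    then show "f P \<subseteq> f P'" unfolding f_def localized_def by blast
  qed
  \<comment> \<open>Stated for an arbitrary pair so that it serves both directions.
    \<open>H'\<close> consists of the multiples of \<open>H\<close> by powers of \<open>x\<close>
    that fall into \<open>S'\<close>; each \<open>h\<close> has such a multiple, and powers of
    \<open>x\<close> cancel modulo the ideals considered.\<close>
  have corr: "\<exists>H'\<subseteq>S'. \<forall>P. cprime_on S P \<and> x \<notin> P \<longrightarrow> (H \<subseteq> P \<longleftrightarrow> H' \<subseteq> localized x P \<inter> S')"
    if S: "same_localization x S S'" and H: "H \<subseteq> S" for S S' H
  proof -
    have SR: "subring_on S" "x \<in> S" and loc: "S \<subseteq> localized x S'"
      using S by (auto simp: same_localization_def ore_powers_def)
    let ?H' = "{h * x ^ n | h n. h \<in> H \<and> h * x ^ n \<in> S'}"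
    have "H \<subseteq> P \<longleftrightarrow> ?H' \<subseteq> localized x P \<inter> S'" if P: "cprime_on S P" "x \<notin> P" for P
    proof
      assume HP: "H \<subseteq> P"
      have "h * x ^ n \<in> localized x P" if "h \<in> H" for h n
      proof -
        have "h * x ^ n * x ^ 0 \<in> P"
          unfolding power_0 mult_1_right
          using that HP H cprime_on_cancel_power(2)[OF SR(1) P(1) SR(2) P(2), of h n] by blast
        then show ?thesis unfolding localized_def by blast
      qed
      then show "?H' \<subseteq> localized x P \<inter> S'" by blast
    next
      assume HP: "?H' \<subseteq> localized x P \<inter> S'"
      show "H \<subseteq> P"
      proof
        fix h assume h: "h \<in> H"
        then obtain n where n: "h * x ^ n \<in> S'" using H loc unfolding localized_def by blast
        then have "h * x ^ n \<in> localized x P" using HP h by blast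
        then obtain m where "h * x ^ n * x ^ m \<in> P" unfolding localized_def by blast
        then have "h * x ^ (n + m) \<in> P" by (simp only: power_add mult.assoc)
        then show "h \<in> P"
          using cprime_on_cancel_power(2)[OF SR(1) P(1) SR(2) P(2), of h "n + m"] h H by blast
      qed
    qed
    then show ?thesis by (intro exI[of _ ?H']) blast
  qed
  show "bi_increasing_homeomorphism (subtopology (zariski (ring_on R)) U)
      (subtopology (zariski (ring_on R')) (f ` U)) f"
  proof (rule bi_increasing_homeomorphismI[OF R(1) R'(1) _ _ order])
    show "U \<subseteq> CSpec (ring_on R)" "f ` U \<subseteq> CSpec (ring_on R')"
      unfolding im by (auto simp: U_def stratum_def)
    show "\<exists>H'\<subseteq>R'. \<forall>P\<in>U. H \<subseteq> P \<longleftrightarrow> H' \<subseteq> f P" if H: "H \<subseteq> R" for H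
    proof -
      obtain H' where H': "H' \<subseteq> R'"
        "\<And>P. cprime_on R P \<Longrightarrow> x \<notin> P \<Longrightarrow> H \<subseteq> P \<longleftrightarrow> H' \<subseteq> localized x P \<inter> R'"
        using corr[OF L H] by metis
      have "H \<subseteq> P \<longleftrightarrow> H' \<subseteq> f P" if "P \<in> U" for P
        unfolding f_def by (rule H'(2)) (use that U in blast)+
      then show ?thesis using H'(1) by metis
    qed
    show "\<exists>H\<subseteq>R. \<forall>P\<in>U. H' \<subseteq> f P \<longleftrightarrow> H \<subseteq> P" if H': "H' \<subseteq> R'" for H'
    proof -
      obtain H where H: "H \<subseteq> R"
        "\<And>P. cprime_on R' P \<Longrightarrow> x \<notin> P \<Longrightarrow> H' \<subseteq> P \<longleftrightarrow> H \<subseteq> localized x P \<inter> R"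
        using corr[OF L' H'] by metis
      have "H' \<subseteq> f P \<longleftrightarrow> H \<subseteq> P" if "P \<in> U" for P
      proof -
        have P: "cprime_on R P" "x \<notin> P" using that U by blast+
        have "H' \<subseteq> f P \<longleftrightarrow> H \<subseteq> localized x (f P) \<inter> R"
          unfolding f_def by (rule H(2)[OF cprime_on_contraction[OF L P]])
        then show ?thesis unfolding ff[OF that] .
      qed
      then show ?thesis using H(1) by metis
    qed
  qed
qed

section \<open>Contraction along a surjection\<close>

text \<open>
  A surjection \<open>R' \<rightarrow> R / I\<close> is encoded by the correspondence \<open>T a r\<close>, saying that \<open>a\<close> is
  mapped to the class of \<open>r\<close>. This makes \<open>R\<close> and \<open>R'\<close> play symmetric roles.
\<close>

definition correspondence :: "'a::ring_1 set \<Rightarrow> 'a set \<Rightarrow> ('a \<Rightarrow> 'a \<Rightarrow> bool) \<Rightarrow> bool" where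
  "correspondence R' R T \<longleftrightarrow> subring_on R \<and> subring_on R' \<and> T 1 1
     \<and> (\<forall>a r b s. T a r \<longrightarrow> T b s \<longrightarrow> T (a - b) (r - s) \<and> T (a * b) (r * s))
     \<and> R' = {a. \<exists>r. T a r} \<and> R = {r. \<exists>a. T a r}"

lemma correspondence_sym: "correspondence R' R T \<Longrightarrow> correspondence R R' (\<lambda>r a. T a r)"
  unfolding correspondence_def by blast

lemma correspondenceD:
  assumes "correspondence R' R T"
  shows "subring_on R" "subring_on R'" "T 1 1" "T 0 0"
    and "T a r \<Longrightarrow> T b s \<Longrightarrow> T (a - b) (r - s)"
    and "T a r \<Longrightarrow> T b s \<Longrightarrow> T (a * b) (r * s)"
    and "T a r \<Longrightarrow> T b s \<Longrightarrow> T (a + b) (r + s)"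
    and "a \<in> R' \<longleftrightarrow> (\<exists>r. T a r)" "r \<in> R \<longleftrightarrow> (\<exists>a. T a r)"
proof -
  show "subring_on R" "subring_on R'" and 1: "T 1 1"
    and diff: "\<And>a b r s. T a r \<Longrightarrow> T b s \<Longrightarrow> T (a - b) (r - s)"
    and "\<And>a b r s. T a r \<Longrightarrow> T b s \<Longrightarrow> T (a * b) (r * s)"
    and "\<And>a. a \<in> R' \<longleftrightarrow> (\<exists>r. T a r)" "\<And>r. r \<in> R \<longleftrightarrow> (\<exists>a. T a r)"
    using assms unfolding correspondence_def by auto
  show 0: "T 0 0" using diff[OF 1 1] by simp
  show "T (a + b) (r + s)" if "T a r" "T b s" for a b r s
    using diff[OF that(1) diff[OF 0 that(2)]] by simp
qed

text \<open>For ideals \<open>P\<close> containing the kernel I on the side of \<open>R\<close>,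
  this is the preimage of P / I under the surjection encoded by \<open>T\<close>.\<close>

definition corr_image :: "('a \<Rightarrow> 'a \<Rightarrow> bool) \<Rightarrow> 'a set \<Rightarrow> 'a set" where
  "corr_image T P = {a. \<exists>p\<in>P. T a p}"

text \<open>Two partners of the same \<open>a\<close> differ by a partner of 0, which lies in
  \<open>P\<close>; membership may therefore be tested on any partner.\<close>

lemma corr_image_iff:
  assumes T: "correspondence R' R T" and P: "ideal_on R P" "{r. T 0 r} \<subseteq> P" and ar: "T a r"
  shows "a \<in> corr_image T P \<longleftrightarrow> r \<in> P"
proof
  assume "a \<in> corr_image T P"
  then obtain p where p: "p \<in> P" "T a p" unfolding corr_image_def by blast
  have "T (a - a) (r - p)" by (rule correspondenceD(5)[OF T ar p(2)])
  then have "r - p \<in> P" using P(2) by auto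
  then show "r \<in> P" using ideal_onD(4)[OF P(1) _ p(1), of "r - p"] by simp
qed (use ar in \<open>auto simp: corr_image_def\<close>)

text \<open>\<open>T\<close> induces an isomorphism between the quotients of \<open>R'\<close> and
  \<open>R\<close> by the two ideals; each ideal axiom is moved across by choosing partners. The
  second conclusion is the hypothesis needed for going back.\<close>

lemma cprime_on_corr_image:
  assumes T: "correspondence R' R T" and P: "cprime_on R P" "{r. T 0 r} \<subseteq> P"
  shows "cprime_on R' (corr_image T P)" "{a. T a 0} \<subseteq> corr_image T P"
proof -
  note D = correspondenceD[OF T]
  note I = cprime_onD(1)[OF P(1)]
  note iff = corr_image_iff[OF T I P(2)]
  let ?Q = "corr_image T P"
  have Q: "?Q \<subseteq> R'" unfolding corr_image_def using D(8) by blast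
  have zero: "0 \<in> ?Q" using iff[OF D(4)] ideal_onD(3)[OF I] by simp
  have add: "a + b \<in> ?Q" if ab: "a \<in> ?Q" "b \<in> ?Q" for a b
  proof -
    obtain r s where "r \<in> P" "T a r" "s \<in> P" "T b s" using ab unfolding corr_image_def by blast
    then show ?thesis using iff[OF D(7)] ideal_onD(4)[OF I] by blast
  qed
  have mult: "a * p \<in> ?Q \<and> p * a \<in> ?Q" if a: "a \<in> R'" and p: "p \<in> ?Q" for a p
  proof -
    obtain s where s: "s \<in> P" "T p s" using p unfolding corr_image_def by blast
    obtain r where r: "T a r" using a D(8) by blast
    have rR: "r \<in> R" using D(9) r by blast
    show ?thesis
      using iff[OF D(6)[OF r s(2)]] iff[OF D(6)[OF s(2) r]] ideal_onD(5,6)[OF I rR s(1)] by simp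
  qed
  have one: "1 \<notin> ?Q" using iff[OF D(3)] cprime_onD(2)[OF P(1)] by simp
  have prime: "a \<in> ?Q \<or> b \<in> ?Q" if ab: "a \<in> R'" "b \<in> R'" "a * b \<in> ?Q" for a b
  proof -
    obtain r s where rs: "T a r" "T b s" using ab D(8) by blast
    then have "r \<in> R" "s \<in> R" using D(9) by blast+
    moreover have "r * s \<in> P" using iff[OF D(6)[OF rs]] ab(3) by simp
    ultimately have "r \<in> P \<or> s \<in> P" by (rule cprime_onD(3)[OF P(1)])
    then show ?thesis using iff[OF rs(1)] iff[OF rs(2)] by simp
  qed
  show "cprime_on R' ?Q"
    unfolding cprime_on_def ideal_on_def using Q zero one add mult prime
    by (intro conjI ballI impI) simp_all
  show "{a. T a 0} \<subseteq> ?Q" using iff ideal_onD(3)[OF I] by blast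
qed

lemma corr_image_corr_image:
  assumes T: "correspondence R' R T" and P: "cprime_on R P" "{r. T 0 r} \<subseteq> P"
  shows "corr_image (\<lambda>r a. T a r) (corr_image T P) = P"
proof (intro equalityI subsetI)
  note iff = corr_image_iff[OF T cprime_onD(1)[OF P(1)] P(2)]
  fix r
  { assume "r \<in> corr_image (\<lambda>r a. T a r) (corr_image T P)"
    then obtain a where "a \<in> corr_image T P" "T a r"
      unfolding corr_image_def[of "\<lambda>r a. T a r"] by blast
    then show "r \<in> P" using iff by blast }
  { assume r: "r \<in> P"
    then obtain a where "T a r"
      using correspondenceD(9)[OF T] ideal_onD(2)[OF cprime_onD(1)[OF P(1)]] by blast
    then show "r \<in> corr_image (\<lambda>r a. T a r) (corr_image T P)"
      unfolding corr_image_def using r by blast }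
qed

lemma corr_image_bi_increasing_homeomorphism:
  assumes T: "correspondence R' R T"
  defines "U \<equiv> {P. cprime_on R P \<and> {r. T 0 r} \<subseteq> P}"
  shows "corr_image T ` U = {P. cprime_on R' P \<and> {a. T a 0} \<subseteq> P}"
    and "bi_increasing_homeomorphism (subtopology (zariski (ring_on R)) U)
      (subtopology (zariski (ring_on R')) (corr_image T ` U)) (corr_image T)"
proof -
  note T' = correspondence_sym[OF T]
  note R = correspondenceD(1)[OF T] and R' = correspondenceD(2)[OF T]
  note D = correspondenceD[OF T]
  have iff: "a \<in> corr_image T P \<longleftrightarrow> r \<in> P" if "P \<in> U" "T a r" for P a r
    using that(1) corr_image_iff[OF T cprime_onD(1) _ that(2)] unfolding U_def by blast
  have rtrip: "corr_image (\<lambda>r a. T a r) (corr_image T P) = P" if "P \<in> U" for P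
    using that corr_image_corr_image[OF T] unfolding U_def by blast
  show im: "corr_image T ` U = {P. cprime_on R' P \<and> {a. T a 0} \<subseteq> P}"
  proof (intro equalityI subsetI)
    fix P assume "P \<in> corr_image T ` U"
    then show "P \<in> {P. cprime_on R' P \<and> {a. T a 0} \<subseteq> P}"
      using cprime_on_corr_image[OF T] unfolding U_def by blast
  next
    fix P assume "P \<in> {P. cprime_on R' P \<and> {a. T a 0} \<subseteq> P}"
    then have P: "cprime_on R' P" "{a. T a 0} \<subseteq> P" by blast+
    have "corr_image (\<lambda>r a. T a r) P \<in> U"
      using cprime_on_corr_image[OF T' P] unfolding U_def by blast
    then show "P \<in> corr_image T ` U"
      using corr_image_corr_image[OF T' P] by (metis imageI)
  qed
  have mono: "corr_image V P \<subseteq> corr_image V P'" if "P \<subseteq> P'" for P P' :: "'a set" and V :: "'a \<Rightarrow> 'a \<Rightarrow> bool"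
    using that unfolding corr_image_def by blast
  show "bi_increasing_homeomorphism (subtopology (zariski (ring_on R)) U)
      (subtopology (zariski (ring_on R')) (corr_image T ` U)) (corr_image T)"
  proof (rule bi_increasing_homeomorphismI[OF R R'])
    show "U \<subseteq> CSpec (ring_on R)"
      unfolding U_def by (simp add: CSpec_ring_on_iff[OF R] subset_iff)
    show "corr_image T ` U \<subseteq> CSpec (ring_on R')"
      unfolding im by (simp add: CSpec_ring_on_iff[OF R'] subset_iff)
    show "corr_image T P \<subseteq> corr_image T P' \<longleftrightarrow> P \<subseteq> P'" if "P \<in> U" "P' \<in> U" for P P'
      using mono rtrip[OF that(1)] rtrip[OF that(2)] by metis
    show "\<exists>H'\<subseteq>R'. \<forall>P\<in>U. H \<subseteq> P \<longleftrightarrow> H' \<subseteq> corr_image T P" if H: "H \<subseteq> R" for H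
    proof (intro exI[of _ "corr_image T H"] conjI ballI)
      show "corr_image T H \<subseteq> R'" unfolding corr_image_def using D(8) by blast
      fix P assume P: "P \<in> U"
      show "H \<subseteq> P \<longleftrightarrow> corr_image T H \<subseteq> corr_image T P"
      proof
        assume sub: "corr_image T H \<subseteq> corr_image T P"
        show "H \<subseteq> P"
        proof
          fix r assume r: "r \<in> H"
          then obtain a where a: "T a r" using H D(9) by blast
          then have "a \<in> corr_image T P" using sub r unfolding corr_image_def[of T H] by blast
          then show "r \<in> P" using iff[OF P a] by blast
        qed
      qed (rule mono)
    qed
    show "\<exists>H\<subseteq>R. \<forall>P\<in>U. H' \<subseteq> corr_image T P \<longleftrightarrow> H \<subseteq> P" if H: "H' \<subseteq> R'" for H'
    proof (intro exI[of _ "corr_image (\<lambda>r a. T a r) H'"] conjI ballI)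
      show "corr_image (\<lambda>r a. T a r) H' \<subseteq> R" unfolding corr_image_def using D(9) by blast
      fix P assume P: "P \<in> U"
      show "H' \<subseteq> corr_image T P \<longleftrightarrow> corr_image (\<lambda>r a. T a r) H' \<subseteq> P"
      proof
        assume "H' \<subseteq> corr_image T P"
        then show "corr_image (\<lambda>r a. T a r) H' \<subseteq> P" using mono rtrip[OF P] by metis
      next
        assume sub: "corr_image (\<lambda>r a. T a r) H' \<subseteq> P"
        show "H' \<subseteq> corr_image T P"
        proof
          fix a assume a: "a \<in> H'"
          then obtain r where r: "T a r" using H D(8) by blast
          then have "r \<in> P" using sub a unfolding corr_image_def by blast
          then show "a \<in> corr_image T P" using iff[OF P r] by blast
        qed
      qed
    qed
  qed
qed

section \<open>Algebras over a field\<close>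

locale scalars =
  fixes \<iota> :: "'k::field \<Rightarrow> 'f::division_ring"
  assumes algebra_map: "algebra_map \<iota>"
begin

lemma iota_one [simp]: "\<iota> 1 = 1"
  and iota_add: "\<iota> (c + d) = \<iota> c + \<iota> d"
  and iota_mult: "\<iota> (c * d) = \<iota> c * \<iota> d"
  and iota_central: "\<iota> c * a = a * \<iota> c"
  using algebra_map unfolding algebra_map_def by blast+

lemma iota_zero [simp]: "\<iota> 0 = 0"
  using iota_add[of 0 0] by simp

lemma iota_minus: "\<iota> (- c) = - \<iota> c"
  using iota_add[of c "- c"] by (simp add: eq_neg_iff_add_eq_0 add.commute)

lemma iota_diff: "\<iota> (c - d) = \<iota> c - \<iota> d"
  using iota_add[of c "- d"] by (simp add: iota_minus)

lemma iota_left_commute: "a * (\<iota> c * b) = \<iota> c * (a * b)"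
  by (simp add: iota_central[of c] mult.assoc)

lemma iota_inverse: "c \<noteq> 0 \<Longrightarrow> \<iota> (inverse c) * (\<iota> c * a) = a" "c \<noteq> 0 \<Longrightarrow> \<iota> c * (\<iota> (inverse c) * a) = a"
  by (simp_all flip: mult.assoc iota_mult)

lemma iota_eq_0_iff [simp]: "\<iota> c = 0 \<longleftrightarrow> c = 0"
  using iota_inverse(1)[of c 1] by (cases "c = 0") auto

abbreviation galg :: "'f set \<Rightarrow> 'f set" where "galg \<equiv> gen_alg \<iota>"

lemma galg_scal: "\<iota> c \<in> galg G"
  and galg_incl: "g \<in> G \<Longrightarrow> g \<in> galg G"
  and galg_add: "a \<in> galg G \<Longrightarrow> b \<in> galg G \<Longrightarrow> a + b \<in> galg G"
  and galg_mult: "a \<in> galg G \<Longrightarrow> b \<in> galg G \<Longrightarrow> a * b \<in> galg G"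
  unfolding gen_alg_def
  using generate_ring.incl[of _ "range \<iota> \<union> G"] generate_ring.eng_add[of _ ring_of_type_algebra]
    generate_ring.eng_mult[of _ ring_of_type_algebra]
  by auto

lemma subring_on_galg: "subring_on (galg G)"
  using subring_on_if_ring[OF ring_gen_alg] .

text \<open>Additive inverses need no case of their own, since \<open>- h\<close> is
  \<open>\<iota> (- 1) * h\<close>.\<close>

lemma galg_induct [consumes 1, case_names scal incl add mult]:
  assumes "a \<in> galg G"
    and "\<And>c. P (\<iota> c)" "\<And>g. g \<in> G \<Longrightarrow> P g"
    and "\<And>a b. a \<in> galg G \<Longrightarrow> b \<in> galg G \<Longrightarrow> P a \<Longrightarrow> P b \<Longrightarrow> P (a + b)"
    and "\<And>a b. a \<in> galg G \<Longrightarrow> b \<in> galg G \<Longrightarrow> P a \<Longrightarrow> P b \<Longrightarrow> P (a * b)"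
  shows "P a"
  using assms(1) unfolding gen_alg_def
proof (induction rule: generate_ring.induct)
  case one
  show ?case using assms(2)[of 1] by simp
next
  case (incl h)
  then show ?case using assms(2,3) by auto
next
  case (a_inv h)
  interpret R: ring "ring_of_type_algebra :: 'f ring" by (rule Defs.ring_ring_of_type_algebra)
  have "\<ominus>\<^bsub>ring_of_type_algebra\<^esub> h = - h"
    using R.minus_equality[of "- h" h] by (simp add: ring_of_type_algebra_def)
  moreover have "P (\<iota> (- 1) * h)"
    using assms(5)[OF galg_scal _ assms(2) a_inv.IH] a_inv.hyps by (simp add: gen_alg_def)
  ultimately show ?case by (simp add: iota_minus)
qed (use assms(4,5) in \<open>simp_all add: gen_alg_def\<close>)

definition subalgebra_on :: "'f set \<Rightarrow> bool" where
  "subalgebra_on B \<longleftrightarrow> subring_on B \<and> range \<iota> \<subseteq> B"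

lemma subalgebra_on_galg: "subalgebra_on (galg G)"
  using subring_on_galg galg_scal unfolding subalgebra_on_def by blast

lemma galg_least:
  assumes "subalgebra_on B" "G \<subseteq> B"
  shows "galg G \<subseteq> B"
proof
  fix a assume "a \<in> galg G"
  then show "a \<in> B"
    using assms subring_onD[of B] unfolding subalgebra_on_def
    by (induction rule: galg_induct) auto
qed

lemma galg_mono: "G \<subseteq> H \<Longrightarrow> galg G \<subseteq> galg H"
  using galg_least[OF subalgebra_on_galg] galg_incl by blast

text \<open>The Ore condition passes from generators to products by chaining exponents: the exponent
  that \<open>a\<close> requires on its right becomes the one requested from
  \<open>b\<close>.\<close>

lemma ore_powers_galg:
  assumes x: "x \<in> galg G" "x \<noteq> 0"
    and G: "\<And>g n. g \<in> G \<Longrightarrow> \<exists>r\<in>galg G. \<exists>k. g * x ^ k = x ^ n * r"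
  shows "ore_powers (galg G) x"
proof -
  have pow: "x ^ n \<in> galg G" for n by (rule subring_onD(7)[OF subring_on_galg x(1)])
  have "\<exists>r\<in>galg G. \<exists>k. a * x ^ k = x ^ n * r" if "a \<in> galg G" for a n
    using that
  proof (induction arbitrary: n rule: galg_induct)
    case (scal c)
    have "\<iota> c * x ^ n = x ^ n * \<iota> c" by (rule iota_central)
    then show ?case using galg_scal by blast
  next
    case (add a b)
    obtain r k where r: "r \<in> galg G" "a * x ^ k = x ^ n * r" using add.IH(1) by blast
    obtain s l where s: "s \<in> galg G" "b * x ^ l = x ^ n * s" using add.IH(2) by blast
    have "(a + b) * x ^ (k + l) = a * x ^ k * x ^ l + b * (x ^ k * x ^ l)"
      by (simp only: distrib_right power_add mult.assoc)
    also have "\<dots> = a * x ^ k * x ^ l + b * x ^ l * x ^ k"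
      by (simp only: powers_commute[of x k l] mult.assoc)
    also have "\<dots> = x ^ n * (r * x ^ l + s * x ^ k)"
      unfolding r(2) s(2) by (simp only: distrib_left mult.assoc)
    finally show ?case using galg_add[OF galg_mult[OF r(1) pow] galg_mult[OF s(1) pow]] by blast
  next
    case (mult a b)
    obtain r k where r: "r \<in> galg G" "a * x ^ k = x ^ n * r" using mult.IH(1) by blast
    obtain s l where s: "s \<in> galg G" "b * x ^ l = x ^ k * s" using mult.IH(2) by blast
    have "a * b * x ^ l = a * x ^ k * s" by (simp only: mult.assoc s(2))
    also have "\<dots> = x ^ n * (r * s)" unfolding r(2) by (simp only: mult.assoc)
    finally show ?case using galg_mult[OF r(1) s(1)] by blast
  qed (rule G)
  then show ?thesis using x unfolding ore_powers_def by blast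
qed

text \<open>With this, \<open>galg_least\<close> reduces the inclusion of a generated algebra in a
  localization to its generators.\<close>

lemma subalgebra_on_localized:
  assumes R: "subalgebra_on R" and ore: "ore_powers R x"
  shows "subalgebra_on (localized x R)"
proof -
  have S: "subring_on R" "range \<iota> \<subseteq> R" using R unfolding subalgebra_on_def by auto
  have x: "x \<in> R" using ore unfolding ore_powers_def by blast
  have pow: "x ^ n \<in> R" for n by (rule subring_onD(7)[OF S(1) x])
  have incl: "R \<subseteq> localized x R"
  proof
    fix a assume "a \<in> R"
    then have "a * x ^ 0 \<in> R" by simp
    then show "a \<in> localized x R" unfolding localized_def by blast
  qed
  have diff: "a - b \<in> localized x R" if a: "a \<in> localized x R" and b: "b \<in> localized x R" for a b
  proof -
    obtain n where n: "a * x ^ n \<in> R" using a unfolding localized_def by blast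
    obtain m where m: "b * x ^ m \<in> R" using b unfolding localized_def by blast
    note nm = n m
    have "(a - b) * x ^ (n + m) = a * x ^ n * x ^ m - b * (x ^ n * x ^ m)"
      by (simp only: left_diff_distrib power_add mult.assoc)
    also have "\<dots> = a * x ^ n * x ^ m - b * x ^ m * x ^ n"
      by (simp only: powers_commute[of x n m] mult.assoc)
    also have "\<dots> \<in> R"
      by (rule subring_onD(3)[OF S(1) subring_onD(4)[OF S(1) nm(1) pow] subring_onD(4)[OF S(1) nm(2) pow]])
    finally show ?thesis unfolding localized_def by blast
  qed
  have mult: "a * b \<in> localized x R" if a: "a \<in> localized x R" and b: "b \<in> localized x R" for a b
  proof -
    obtain n where n: "a * x ^ n \<in> R" using a unfolding localized_def by blast
    obtain m where m: "b * x ^ m \<in> R" using b unfolding localized_def by blast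
    note nm = n m
    obtain t k where t: "t \<in> R" "b * x ^ m * x ^ k = x ^ n * t"
      using ore nm(2) unfolding ore_powers_def by metis
    have "a * b * x ^ (m + k) = a * (b * x ^ m * x ^ k)" by (simp only: power_add mult.assoc)
    also have "\<dots> = a * x ^ n * t" unfolding t(2) by (simp only: mult.assoc)
    also have "\<dots> \<in> R" by (rule subring_onD(4)[OF S(1) nm(1) t(1)])
    finally show ?thesis unfolding localized_def by blast
  qed
  have "1 \<in> localized x R" using incl subring_onD(1)[OF S(1)] by blast
  then show ?thesis
    using diff mult incl S(2) unfolding subalgebra_on_def subring_on_def by blast
qed

end

section \<open>Gaussian binomials and the weights of the deletion map\<close>

lemma qbinom_eq_0: "n < m \<Longrightarrow> qbinom q n m = 0"
  by (induction q n m rule: qbinom.induct) auto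

lemma qbinom_self: "qbinom q n n = 1"
  by (induction n) (auto simp: qbinom_eq_0)

text \<open>The binomial here is the q-integer 1 + q + ... + q^n, a geometric sum.\<close>

lemma qbinom_Suc_self: "(q - 1) * qbinom q (Suc n) n = q ^ Suc n - 1"
proof (induction n)
  case (Suc n)
  have "qbinom q (Suc (Suc n)) (Suc n) = qbinom q (Suc n) n + q ^ Suc n"
    by (simp only: qbinom.simps(3)[of q "Suc n"] qbinom_self mult_1_right)
  then have "(q - 1) * qbinom q (Suc (Suc n)) (Suc n)
      = (q - 1) * qbinom q (Suc n) n + (q - 1) * q ^ Suc n"
    by (simp only: distrib_left)
  also have "\<dots> = q ^ Suc (Suc n) - 1" unfolding Suc by (simp add: algebra_simps)
  finally show ?case .
qed simp

definition del_coeff :: "'k::field \<Rightarrow> nat \<Rightarrow> 'k" where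
  "del_coeff q n = q ^ (n * (n + 1) div 2) * inverse ((q - 1) ^ n)"

lemma del_coeff_0 [simp]: "del_coeff q 0 = 1"
  by (simp add: del_coeff_def)

text \<open>The exponents in the numerators are triangular numbers, and the triangular number of i +
  k exceeds the sum of those of i and k by i k.\<close>

lemma del_coeff_add: "del_coeff q (i + k) = q ^ (i * k) * (del_coeff q i * del_coeff q k)"
proof -
  \<comment> \<open>Products of consecutive numbers are even, so the truncating \<open>div 2\<close>
    is exact.\<close>
  obtain a where a: "i * (i + 1) = 2 * a" by (rule evenE[of "i * (i + 1)"]) auto
  obtain b where b: "k * (k + 1) = 2 * b" by (rule evenE[of "k * (k + 1)"]) auto
  have "(i + k) * (i + k + 1) = i * (i + 1) + k * (k + 1) + 2 * (i * k)"
    by (simp add: algebra_simps)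
  also have "\<dots> = 2 * (i * k + a + b)" unfolding a b by simp
  finally have "(i + k) * (i + k + 1) div 2 = i * k + i * (i + 1) div 2 + k * (k + 1) div 2"
    unfolding a b by simp
  then show ?thesis by (simp add: del_coeff_def power_add)
qed

lemma del_coeff_Suc:
  assumes "q \<noteq> 1"
  shows "(q - 1) * del_coeff q (Suc n) = q ^ Suc n * del_coeff q n"
proof -
  have 1: "(q - 1) * del_coeff q 1 = q" using assms by (simp add: del_coeff_def)
  have "(q - 1) * del_coeff q (Suc n) = q ^ n * del_coeff q n * ((q - 1) * del_coeff q 1)"
    using del_coeff_add[of q n 1] by (simp add: mult_ac)
  also have "\<dots> = q ^ Suc n * del_coeff q n" unfolding 1 by simp
  finally show ?thesis .
qed

section \<open>The deletion homomorphism\<close>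

lemma alg_isoD:
  assumes "alg_iso \<iota> B C h"
  shows "bij_betw h B C" "a \<in> B \<Longrightarrow> h a \<in> C" "h (\<iota> c) = \<iota> c"
    and "a \<in> B \<Longrightarrow> b \<in> B \<Longrightarrow> h (a + b) = h a + h b"
    and "a \<in> B \<Longrightarrow> b \<in> B \<Longrightarrow> h (a * b) = h a * h b"
proof -
  show "bij_betw h B C" "h (\<iota> c) = \<iota> c"
    and "a \<in> B \<Longrightarrow> b \<in> B \<Longrightarrow> h (a + b) = h a + h b"
    and "a \<in> B \<Longrightarrow> b \<in> B \<Longrightarrow> h (a * b) = h a * h b"
    using assms unfolding alg_iso_def ring_iso_def ring_hom_def by auto
  then show "a \<in> B \<Longrightarrow> h a \<in> C" using bij_betw_apply by metis
qed

lemma (in scalars) alg_isoI: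
  assumes "subalgebra_on B" "bij_betw h B C" "\<And>c. h (\<iota> c) = \<iota> c"
    and "\<And>a b. a \<in> B \<Longrightarrow> b \<in> B \<Longrightarrow> h (a + b) = h a + h b"
    and "\<And>a b. a \<in> B \<Longrightarrow> b \<in> B \<Longrightarrow> h (a * b) = h a * h b"
  shows "alg_iso \<iota> B C h"
  using assms assms(3)[of 1] bij_betw_apply[OF assms(2)]
  unfolding alg_iso_def ring_iso_def ring_hom_def by auto

lemma (in scalars) subalgebra_onD:
  assumes "subalgebra_on B"
  shows "\<iota> c \<in> B" "0 \<in> B" "1 \<in> B"
    and "a \<in> B \<Longrightarrow> b \<in> B \<Longrightarrow> a + b \<in> B" "a \<in> B \<Longrightarrow> b \<in> B \<Longrightarrow> a - b \<in> B"
    and "a \<in> B \<Longrightarrow> b \<in> B \<Longrightarrow> a * b \<in> B" "a \<in> B \<Longrightarrow> - a \<in> B" "a \<in> B \<Longrightarrow> a ^ n \<in> B"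
    and "a \<in> B \<Longrightarrow> \<iota> c * a \<in> B"
proof -
  have R: "subring_on B" and c: "\<And>c. \<iota> c \<in> B" using assms unfolding subalgebra_on_def by auto
  show "\<iota> c \<in> B" by (rule c)
  show "a \<in> B \<Longrightarrow> \<iota> c * a \<in> B" by (rule subring_onD(4)[OF R c])
qed (use assms subring_onD[of B] in \<open>simp_all add: subalgebra_on_def\<close>)

text \<open>An Ore extension of \<open>B\<close> by \<open>x\<close> inside the division ring.
  Freeness over the powers of \<open>x\<close> is recorded as the vanishing of the top coefficient
  of a relation, the form in which leading terms use it.\<close>

locale deletion_step = scalars \<iota> for \<iota> :: "'k::field \<Rightarrow> 'f::division_ring" +
  fixes B :: "'f set" and x :: 'f and \<sigma> \<delta> :: "'f \<Rightarrow> 'f" and d :: "nat \<Rightarrow> 'f \<Rightarrow> 'f" and q :: 'k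
  assumes B: "subalgebra_on B"
    and x0: "x \<noteq> 0"
    and iso: "alg_iso \<iota> B B \<sigma>"
    and q0: "q \<noteq> 0" and q1: "q \<noteq> 1"
    and hsd: "higher_skew_derivation \<iota> B q \<sigma> \<delta> d"
    and nilp: "loc_nilpotent B d"
    and iter: "iterative \<iota> B q d"
    and ore: "b \<in> B \<Longrightarrow> x * b = \<sigma> b * x + \<delta> b"
    and free: "(\<And>k. c k \<in> B) \<Longrightarrow> (\<Sum>k\<le>n. c k * x ^ k) = 0 \<Longrightarrow> c n = 0"
begin

lemmas BD = subalgebra_onD[OF B]
lemmas sigma = alg_isoD[OF iso]

definition \<tau> where "\<tau> = inv_into B \<sigma>"

lemma tau_mem [simp]: "b \<in> B \<Longrightarrow> \<tau> b \<in> B"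
  and sigma_tau [simp]: "b \<in> B \<Longrightarrow> \<sigma> (\<tau> b) = b"
  and tau_sigma [simp]: "b \<in> B \<Longrightarrow> \<tau> (\<sigma> b) = b"
  and sigma_mem [simp]: "b \<in> B \<Longrightarrow> \<sigma> b \<in> B"
  using sigma(1) bij_betw_inv_into[OF sigma(1)] unfolding \<tau>_def
  by (auto intro: bij_betw_apply bij_betw_inv_into_right bij_betw_inv_into_left)

lemma sigma_scal: "b \<in> B \<Longrightarrow> \<sigma> (\<iota> c * b) = \<iota> c * \<sigma> b"
  using sigma(5)[OF BD(1)] by (simp add: sigma(3))

lemma sigma_0 [simp]: "\<sigma> 0 = 0"
  using sigma(3)[of 0] by simp

lemma sigma_eq_0: "b \<in> B \<Longrightarrow> \<sigma> b = 0 \<Longrightarrow> b = 0"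
  using tau_sigma[of b] tau_sigma[OF BD(2)] by simp

lemma tau_scal: "\<tau> (\<iota> c) = \<iota> c"
  using tau_sigma[OF BD(1)[of c]] by (simp add: sigma(3))

lemma tau_add: "a \<in> B \<Longrightarrow> b \<in> B \<Longrightarrow> \<tau> (a + b) = \<tau> a + \<tau> b"
  using tau_sigma[of "\<tau> a + \<tau> b"] sigma(4)[of "\<tau> a" "\<tau> b"] BD(4) by simp

lemma tau_mult: "a \<in> B \<Longrightarrow> b \<in> B \<Longrightarrow> \<tau> (a * b) = \<tau> a * \<tau> b"
  using tau_sigma[of "\<tau> a * \<tau> b"] sigma(5)[of "\<tau> a" "\<tau> b"] BD(6) by simp

lemma tau_pow_mem [simp]: "b \<in> B \<Longrightarrow> (\<tau> ^^ n) b \<in> B"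
  and sigma_pow_mem [simp]: "b \<in> B \<Longrightarrow> (\<sigma> ^^ n) b \<in> B"
  by (induction n) auto

lemma tau_pow_scal [simp]: "(\<tau> ^^ n) (\<iota> c) = \<iota> c"
  by (induction n) (auto simp: tau_scal)

lemma tau_pow_add: "a \<in> B \<Longrightarrow> b \<in> B \<Longrightarrow> (\<tau> ^^ n) (a + b) = (\<tau> ^^ n) a + (\<tau> ^^ n) b"
  by (induction n) (auto simp: tau_add)

lemma tau_pow_mult: "a \<in> B \<Longrightarrow> b \<in> B \<Longrightarrow> (\<tau> ^^ n) (a * b) = (\<tau> ^^ n) a * (\<tau> ^^ n) b"
  by (induction n) (auto simp: tau_mult)

lemma sigma_pow_tau_pow: "b \<in> B \<Longrightarrow> (\<sigma> ^^ n) ((\<tau> ^^ n) b) = b"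
proof (induction n)
  case (Suc n)
  have "(\<sigma> ^^ Suc n) ((\<tau> ^^ Suc n) b) = (\<sigma> ^^ n) (\<sigma> (\<tau> ((\<tau> ^^ n) b)))"
    by (simp add: funpow_swap1)
  then show ?case using Suc by simp
qed simp

lemma d_mem [simp]: "b \<in> B \<Longrightarrow> d n b \<in> B"
  and d_add: "a \<in> B \<Longrightarrow> b \<in> B \<Longrightarrow> d n (a + b) = d n a + d n b"
  and d_scal: "b \<in> B \<Longrightarrow> d n (\<iota> c * b) = \<iota> c * d n b"
  and d_0 [simp]: "b \<in> B \<Longrightarrow> d 0 b = b"
  and d_1: "b \<in> B \<Longrightarrow> d 1 b = \<delta> b"
  and d_mult: "a \<in> B \<Longrightarrow> b \<in> B \<Longrightarrow> d n (a * b) = (\<Sum>i=0..n. (\<sigma> ^^ (n - i)) (d i a) * d (n - i) b)"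
  and d_sigma: "b \<in> B \<Longrightarrow> d n (\<sigma> b) = \<iota> (q ^ n) * \<sigma> (d n b)"
  using hsd unfolding higher_skew_derivation_def linear_on_def by blast+

lemma d_d: "b \<in> B \<Longrightarrow> d n (d m b) = \<iota> (qbinom q (n + m) m) * d (n + m) b"
  using iter unfolding iterative_def by blast

lemma d_zero [simp]: "d n 0 = 0"
  using d_scal[OF BD(2), of n 0] by simp

lemma d_sigma_pow: "b \<in> B \<Longrightarrow> d n ((\<sigma> ^^ k) b) = \<iota> (q ^ (n * k)) * (\<sigma> ^^ k) (d n b)"
proof (induction k)
  case (Suc k)
  then show ?case
    by (simp add: d_sigma sigma_scal power_add iota_mult mult.assoc)
qed simp

text \<open>\<open>M\<close> is any bound, not the least one, so that several elements can share
  it.\<close>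

definition nil :: "nat \<Rightarrow> 'f \<Rightarrow> bool" where
  "nil M b \<longleftrightarrow> b \<in> B \<and> (\<forall>n\<ge>M. d n b = 0)"

lemma nil_mem: "nil M b \<Longrightarrow> b \<in> B"
  by (simp add: nil_def)

lemma nil_mono: "nil M b \<Longrightarrow> M \<le> K \<Longrightarrow> nil K b"
  by (auto simp: nil_def)

lemma nil_exists:
  assumes "b \<in> B"
  obtains M where "nil M b"
  using nilp assms unfolding loc_nilpotent_def nil_def by blast

lemma nil_exists_both:
  assumes "a \<in> B" "b \<in> B"
  obtains M where "nil M a" "nil M b"
proof -
  obtain K where K: "nil K a" by (rule nil_exists[OF assms(1)])
  obtain L where L: "nil L b" by (rule nil_exists[OF assms(2)])
  show ?thesis by (rule that[of "max K L"]) (rule nil_mono[OF K] nil_mono[OF L]; simp)+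
qed

lemma nil_sigma: "nil M b \<Longrightarrow> nil M (\<sigma> b)"
  by (auto simp: nil_def d_sigma)

lemma nil_tau: "nil M b \<Longrightarrow> nil M (\<tau> b)"
proof -
  assume b: "nil M b"
  then have bB: "b \<in> B" by (rule nil_mem)
  have "d n (\<tau> b) = 0" if "n \<ge> M" for n
  proof -
    have "d n b = \<iota> (q ^ n) * \<sigma> (d n (\<tau> b))" using d_sigma[of "\<tau> b" n] bB by simp
    then have "\<sigma> (d n (\<tau> b)) = 0" using b that q0 by (simp add: nil_def)
    then show ?thesis using sigma_eq_0 bB by simp
  qed
  then show ?thesis using bB by (simp add: nil_def)
qed

lemma nil_tau_pow: "nil M b \<Longrightarrow> nil M ((\<tau> ^^ n) b)"
  by (induction n) (auto intro: nil_tau)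

text \<open>In each Leibniz summand of index at least 2 M, one of the two operators has index at
  least M.\<close>

lemma nil_mult:
  assumes a: "nil M a" and b: "nil M b"
  shows "nil (2 * M) (a * b)"
proof -
  have "(\<sigma> ^^ (n - i)) (d i a) * d (n - i) b = 0" if "n \<ge> 2 * M" "i \<in> {0..n}" for n i
  proof (cases "i \<ge> M")
    case True
    have "(\<sigma> ^^ k) 0 = 0" for k by (induction k) auto
    then show ?thesis using True a by (simp add: nil_def)
  next
    case False
    then have "n - i \<ge> M" using that by simp
    then show ?thesis using b by (simp add: nil_def)
  qed
  then have "d n (a * b) = 0" if "n \<ge> 2 * M" for n
    using that unfolding d_mult[OF nil_mem[OF a] nil_mem[OF b]] by (intro sum.neutral) blast
  then show ?thesis using nil_mem[OF a] nil_mem[OF b] BD(6) by (simp add: nil_def)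
qed

text \<open>By iterativity \<open>d n (d m b)\<close> is a multiple of \<open>d (n + m) b\<close>.
  This drop of the bound drives the inductions that express \<open>B\<close> through the image of
  \<open>\<theta>\<close>.\<close>

lemma nil_d: "nil M b \<Longrightarrow> nil (M - m) (d m b)"
  by (auto simp: nil_def d_d)

text \<open>Up to the weight \<open>c n\<close>, the coefficient of degree -n of the deletion
  map.\<close>

definition e :: "nat \<Rightarrow> 'f \<Rightarrow> 'f" where
  "e n b = d n ((\<tau> ^^ n) b)"

lemma e_mem [simp]: "b \<in> B \<Longrightarrow> e n b \<in> B"
  by (simp add: e_def)

lemma e_0 [simp]: "b \<in> B \<Longrightarrow> e 0 b = b"
  by (simp add: e_def)

lemma nil_e: "nil M b \<Longrightarrow> nil (M - n) (e n b)"
  unfolding e_def by (intro nil_d nil_tau_pow)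

lemma e_eq_0: "nil M b \<Longrightarrow> n \<ge> M \<Longrightarrow> e n b = 0"
  using nil_tau_pow[of M b n] by (simp add: e_def nil_def)

lemma e_sigma: "b \<in> B \<Longrightarrow> e n (\<sigma> b) = \<iota> (q ^ n) * \<sigma> (e n b)"
proof -
  assume b: "b \<in> B"
  have "(\<tau> ^^ n) (\<sigma> b) = \<sigma> ((\<tau> ^^ n) b)"
  proof (induction n)
    case (Suc n) then show ?case using b by simp
  qed simp
  then show ?thesis using d_sigma[of "(\<tau> ^^ n) b" n] b by (simp add: e_def)
qed

abbreviation c :: "nat \<Rightarrow> 'k" where "c \<equiv> del_coeff q"

text \<open>In the Leibniz rule applied to \<open>(\<tau> ^^ n) (a * b)\<close>, the outer power of
  \<open>\<sigma>\<close> cancels part of the power of \<open>\<tau>\<close> on \<open>a\<close>.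
  Commuting it past \<open>d i\<close> costs q^{i (n - i)}, exactly the factor supplied by
  \<open>del_coeff_add\<close>.\<close>

lemma e_mult:
  assumes a: "a \<in> B" and b: "b \<in> B"
  shows "\<iota> (c n) * e n (a * b) = (\<Sum>i\<le>n. \<iota> (c i) * e i a * (\<iota> (c (n - i)) * e (n - i) ((\<tau> ^^ i) b)))"
proof -
  have eq: "\<iota> (c n) * ((\<sigma> ^^ (n - i)) (d i ((\<tau> ^^ n) a)) * d (n - i) ((\<tau> ^^ n) b))
    = \<iota> (c i) * e i a * (\<iota> (c (n - i)) * e (n - i) ((\<tau> ^^ i) b))" if "i \<le> n" for i
  proof -
    define k where "k = n - i"
    have n: "n = i + k" "n = k + i" using that by (auto simp: k_def)
    have 1: "(\<tau> ^^ n) b = (\<tau> ^^ k) ((\<tau> ^^ i) b)" unfolding n(2) funpow_add by simp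
    have "(\<sigma> ^^ k) ((\<tau> ^^ n) a) = (\<tau> ^^ i) a"
      unfolding n(2) funpow_add using sigma_pow_tau_pow a by simp
    then have "\<iota> (q ^ (i * k)) * (\<sigma> ^^ k) (d i ((\<tau> ^^ n) a)) = e i a"
      using d_sigma_pow[of "(\<tau> ^^ n) a" i k] a by (simp add: e_def)
    then have 2: "e i a = \<iota> (q ^ (i * k)) * (\<sigma> ^^ k) (d i ((\<tau> ^^ n) a))" by (rule sym)
    define S where "S = (\<sigma> ^^ k) (d i ((\<tau> ^^ n) a))"
    define D where "D = e k ((\<tau> ^^ i) b)"
    have 3: "d k ((\<tau> ^^ n) b) = D" unfolding D_def e_def 1 ..
    have "c n = c i * (q ^ (i * k) * c k)" unfolding n(1) del_coeff_add by (simp only: mult_ac)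
    then show ?thesis
      unfolding k_def[symmetric] 2 3 S_def[symmetric] D_def[symmetric]
      by (simp only: iota_mult mult.assoc iota_left_commute[of S "c k" D])
  qed
  have "e n (a * b) = (\<Sum>i\<le>n. (\<sigma> ^^ (n - i)) (d i ((\<tau> ^^ n) a)) * d (n - i) ((\<tau> ^^ n) b))"
    using a b by (simp add: e_def tau_pow_mult d_mult atMost_atLeast0)
  then show ?thesis using eq by (simp only: sum_distrib_left) (intro sum.cong, auto)
qed

section \<open>The deletion map and its multiplicativity\<close>

definition \<theta> :: "'f \<Rightarrow> 'f" where
  "\<theta> b = Sum_any (\<lambda>n. \<iota> (c n) * e n b * inverse (x ^ n))"

abbreviation "u \<equiv> inverse x"

lemma xu [simp]: "x * u = 1" "u * x = 1" "x * (u * z) = z" "u * (x * z) = z"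
  using x0 by (simp_all flip: mult.assoc)

lemma theta_eq:
  assumes "nil M b"
  shows "\<theta> b = (\<Sum>n<M. \<iota> (c n) * e n b * u ^ n)"
proof -
  have "n < M" if "\<iota> (c n) * e n b * inverse (x ^ n) \<noteq> 0" for n
    using that e_eq_0[OF assms, of n] by (cases "n < M") auto
  then have "\<theta> b = (\<Sum>n<M. \<iota> (c n) * e n b * inverse (x ^ n))"
    unfolding \<theta>_def by (intro Sum_any.expand_superset) auto
  then show ?thesis by (simp only: power_inverse)
qed

lemma sigma_pow_1 [simp]: "(\<sigma> ^^ n) 1 = 1"
  using sigma(3)[of 1] by (induction n) auto

text \<open>In the Leibniz rule for 1 * 1 the inner summands vanish by induction and both extreme
  ones equal \<open>d n 1\<close>, whence \<open>d n 1 = d n 1 + d n 1\<close>.\<close>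

lemma d_one: "0 < n \<Longrightarrow> d n 1 = 0"
proof (induction n rule: less_induct)
  case (less n)
  define f where "f i = (\<sigma> ^^ (n - i)) (d i 1) * d (n - i) 1" for i
  have "d n 1 = (\<Sum>i\<in>{0..n}. f i)" using d_mult[OF BD(3) BD(3), of n] by (simp add: f_def)
  also have "\<dots> = (\<Sum>i\<in>{0, n}. f i)"
    by (rule sum.mono_neutral_right) (use less.IH in \<open>auto simp: f_def\<close>)
  also have "\<dots> = d n 1 + d n 1" using less.prems BD(3) by (simp add: f_def)
  finally show ?case by simp
qed

lemma theta_scal [simp]: "\<theta> (\<iota> a) = \<iota> a"
proof -
  have "nil 1 (\<iota> a)" using d_scal[OF BD(3), of _ a] d_one by (simp add: nil_def BD(1))
  then show ?thesis by (simp add: theta_eq BD(1))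
qed

lemma theta_add:
  assumes "a \<in> B" "b \<in> B"
  shows "\<theta> (a + b) = \<theta> a + \<theta> b"
proof -
  obtain M where a: "nil M a" and b: "nil M b" by (rule nil_exists_both[OF assms])
  then have "nil M (a + b)" using assms BD(4) by (simp add: nil_def d_add)
  then show ?thesis
    using assms by (simp add: theta_eq[OF a] theta_eq[OF b] theta_eq e_def tau_pow_add d_add
      distrib_left distrib_right sum.distrib)
qed

lemma x_theta:
  assumes b: "b \<in> B"
  shows "x * \<theta> b = \<theta> (\<sigma> b) * x"
proof -
  obtain M where "nil M b" by (rule nil_exists[OF b])
  \<comment> \<open>The bound is raised to a successor so that the summand at 0 can be split off and
    the index shifted.\<close>
  then have M: "nil (Suc M) b" by (rule nil_mono) simp
  have ux: "u ^ Suc n * x = u ^ n" for n by (simp only: power_Suc2 mult.assoc xu mult_1_right)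
  have xu_pow: "x * u ^ n = u ^ n * x" for n
  proof (cases n)
    case (Suc m)
    show ?thesis unfolding Suc ux unfolding power_Suc by (rule xu(3))
  qed simp
  \<comment> \<open>\<open>f n\<close> is what \<open>\<theta> (\<sigma> b) * x\<close> has in
    excess of the twisted part of \<open>x * \<theta> b\<close>, and \<open>g n\<close> is the part
    due to the derivation. They agree after a shift by one; \<open>f 0\<close> vanishes because q^0
    - 1 = 0, and \<open>g M\<close> by nilpotency.\<close>
  define f where "f n = \<iota> (c n) * (\<iota> (q ^ n) - 1) * \<sigma> (e n b) * (u ^ n * x)" for n
  define g where "g n = \<iota> (c n) * d 1 (e n b) * u ^ n" for n
  have coeff: "c (Suc n) * (q ^ Suc n - 1) = c n * (qbinom q (Suc n) n * q ^ Suc n)" for n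
  proof -
    have "c (Suc n) * (q ^ Suc n - 1) = (q - 1) * c (Suc n) * qbinom q (Suc n) n"
      unfolding qbinom_Suc_self[symmetric] by (simp only: mult_ac)
    then show ?thesis unfolding del_coeff_Suc[OF q1] by (simp only: mult_ac)
  qed
  have fg: "f (Suc n) = g n" for n
  proof -
    have "d 1 (e n b) = \<iota> (qbinom q (Suc n) n) * d (Suc n) ((\<tau> ^^ n) b)"
      using d_d[of "(\<tau> ^^ n) b" 1 n] b by (simp add: e_def)
    also have "d (Suc n) ((\<tau> ^^ n) b) = \<iota> (q ^ Suc n) * \<sigma> (e (Suc n) b)"
      using d_sigma[of "(\<tau> ^^ Suc n) b" "Suc n"] b by (simp add: e_def)
    finally have "g n = \<iota> (c n * (qbinom q (Suc n) n * q ^ Suc n)) * \<sigma> (e (Suc n) b) * u ^ n"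
      unfolding g_def iota_mult by (simp only: mult.assoc)
    also have "\<dots> = \<iota> (c (Suc n)) * (\<iota> (q ^ Suc n) - 1) * \<sigma> (e (Suc n) b) * u ^ n"
      unfolding coeff[symmetric] iota_mult iota_diff iota_one ..
    also have "u ^ n = u ^ Suc n * x" by (rule ux[symmetric])
    finally show ?thesis unfolding f_def by (rule sym)
  qed
  have gM: "g M = 0"
    using e_eq_0[OF M] nil_tau_pow[OF M, of M] d_d[of "(\<tau> ^^ M) b" 1 M] b
    by (simp add: g_def e_def nil_def)
  have "(\<Sum>n<Suc M. f n) = (\<Sum>n<M. f (Suc n))"
    unfolding sum.lessThan_Suc_shift by (simp add: f_def)
  also have "\<dots> = (\<Sum>n<Suc M. g n)" by (simp add: fg gM)
  finally have fg_sum: "(\<Sum>n<Suc M. f n) = (\<Sum>n<Suc M. g n)" .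
  have "x * \<theta> b = (\<Sum>n<Suc M. \<iota> (c n) * \<sigma> (e n b) * (u ^ n * x) + g n)"
    unfolding theta_eq[OF M] sum_distrib_left
  proof (rule sum.cong[OF refl])
    fix n
    have "x * (\<iota> (c n) * e n b * u ^ n) = \<iota> (c n) * (x * e n b) * u ^ n"
      by (simp only: mult.assoc iota_left_commute)
    also have "x * e n b = \<sigma> (e n b) * x + d 1 (e n b)" using ore[OF e_mem[OF b]] d_1[OF e_mem[OF b]] by (simp only:)
    finally show "x * (\<iota> (c n) * e n b * u ^ n) = \<iota> (c n) * \<sigma> (e n b) * (u ^ n * x) + g n"
      unfolding g_def by (simp only: distrib_left distrib_right mult.assoc xu_pow)
  qed
  also have "\<dots> = (\<Sum>n<Suc M. \<iota> (c n) * \<sigma> (e n b) * (u ^ n * x) + f n)"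
    unfolding sum.distrib fg_sum ..
  also have "\<dots> = \<theta> (\<sigma> b) * x"
    unfolding theta_eq[OF nil_sigma[OF M]] sum_distrib_right
  proof (rule sum.cong[OF refl])
    fix n
    show "\<iota> (c n) * \<sigma> (e n b) * (u ^ n * x) + f n = \<iota> (c n) * e n (\<sigma> b) * u ^ n * x"
      unfolding f_def e_sigma[OF b]
      by (simp only: mult.assoc left_diff_distrib right_diff_distrib mult_1_left) simp
  qed
  finally show ?thesis .
qed

text \<open>\<open>x_theta\<close> at \<open>\<tau> b\<close>, multiplied by \<open>u\<close> on
  both sides and iterated.\<close>

lemma u_pow_theta: "b \<in> B \<Longrightarrow> u ^ n * \<theta> b = \<theta> ((\<tau> ^^ n) b) * u ^ n"
proof (induction n)
  case (Suc n)
  have "x * \<theta> ((\<tau> ^^ Suc n) b) = \<theta> ((\<tau> ^^ n) b) * x"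
    using x_theta[of "(\<tau> ^^ Suc n) b"] Suc.prems by simp
  then have "u * (x * \<theta> ((\<tau> ^^ Suc n) b)) * u = u * (\<theta> ((\<tau> ^^ n) b) * x) * u" by simp
  then have "\<theta> ((\<tau> ^^ Suc n) b) * u = u * \<theta> ((\<tau> ^^ n) b)" by (simp add: mult.assoc)
  then have "\<theta> ((\<tau> ^^ Suc n) b) * u ^ Suc n = u * \<theta> ((\<tau> ^^ n) b) * u ^ n"
    by (simp only: power_Suc mult.assoc[symmetric])
  also have "\<dots> = u ^ Suc n * \<theta> b"
    using Suc.IH[OF Suc.prems] by (simp only: power_Suc mult.assoc)
  finally show ?case by (rule sym)
qed simp

lemma theta_mult:
  assumes aB: "a \<in> B" and bB: "b \<in> B"
  shows "\<theta> (a * b) = \<theta> a * \<theta> b"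
proof -
  obtain M where a: "nil M a" and b: "nil M b" by (rule nil_exists_both[OF assms])
  define F where "F = (\<lambda>(i, m). \<iota> (c i) * e i a * (\<iota> (c m) * e m ((\<tau> ^^ i) b)) * u ^ (i + m))"
  have "\<theta> a * \<theta> b = (\<Sum>i<M. \<iota> (c i) * e i a * (u ^ i * \<theta> b))"
    unfolding theta_eq[OF a] by (simp only: sum_distrib_right mult.assoc)
  also have "\<dots> = (\<Sum>i<M. \<Sum>m<M. F (i, m))"
  proof (rule sum.cong[OF refl])
    fix i
    show "\<iota> (c i) * e i a * (u ^ i * \<theta> b) = (\<Sum>m<M. F (i, m))"
      unfolding u_pow_theta[OF bB] theta_eq[OF nil_tau_pow[OF b]] F_def
      by (simp add: sum_distrib_left sum_distrib_right mult.assoc add.commute flip: power_add)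
  qed
  also have "\<dots> = sum F ({..<M} \<times> {..<M})" by (simp add: sum.cartesian_product)
  \<comment> \<open>The square is enlarged to a triangle by zero terms, so that the sum can be
    arranged by total degree; \<open>2 * M\<close> is the bound that \<open>nil_mult\<close> gives
    for the product.\<close>
  also have "\<dots> = sum F {(i, j). i + j < 2 * M}"
  proof (rule sum.mono_neutral_left)
    show "finite {(i, j). i + j < 2 * M}"
      by (rule finite_subset[of _ "{..<2 * M} \<times> {..<2 * M}"]) auto
    show "{..<M} \<times> {..<M} \<subseteq> {(i, j). i + j < 2 * M}" by auto
    show "\<forall>p\<in>{(i, j). i + j < 2 * M} - {..<M} \<times> {..<M}. F p = 0"
    proof
      fix p assume "p \<in> {(i, j). i + j < 2 * M} - {..<M} \<times> {..<M}"
      then obtain i j where "p = (i, j)" "M \<le> i \<or> M \<le> j" by (cases p) (auto simp: not_less)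
      then show "F p = 0" using e_eq_0[OF a, of i] e_eq_0[OF nil_tau_pow[OF b], of j i] by (auto simp: F_def)
    qed
  qed
  also have "\<dots> = (\<Sum>n<2 * M. \<Sum>i\<le>n. F (i, n - i))"
    using sum.triangle_reindex[of "\<lambda>i j. F (i, j)" "2 * M"] by simp
  also have "\<dots> = (\<Sum>n<2 * M. \<iota> (c n) * e n (a * b) * u ^ n)"
    unfolding e_mult[OF aB bB] sum_distrib_right by (simp add: F_def)
  also have "\<dots> = \<theta> (a * b)" by (rule theta_eq[OF nil_mult[OF a b], symmetric])
  finally show ?thesis by simp
qed

end

text \<open>These closure properties only involve denominators on the right and do not rest on the
  Ore condition, so they can be used to prove it in \<open>base_ore\<close>.\<close>

lemma (in scalars) localized_closed:
  assumes R: "subalgebra_on R" and x: "x \<in> R" "x \<noteq> 0"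
  shows "R \<subseteq> localized x R"
    and "a \<in> localized x R \<Longrightarrow> b \<in> localized x R \<Longrightarrow> a + b \<in> localized x R"
    and "a \<in> localized x R \<Longrightarrow> \<iota> c * a \<in> localized x R"
    and "a \<in> localized x R \<Longrightarrow> a * inverse x ^ n \<in> localized x R"
proof -
  note D = subalgebra_onD[OF R]
  show "R \<subseteq> localized x R"
  proof
    fix a assume "a \<in> R"
    then have "a * x ^ 0 \<in> R" by simp
    then show "a \<in> localized x R" unfolding localized_def by blast
  qed
  show "a + b \<in> localized x R" if a: "a \<in> localized x R" and b: "b \<in> localized x R"
  proof -
    obtain n where n: "a * x ^ n \<in> R" using a unfolding localized_def by blast
    obtain m where m: "b * x ^ m \<in> R" using b unfolding localized_def by blast
    have "(a + b) * x ^ (n + m) = a * x ^ n * x ^ m + b * (x ^ n * x ^ m)"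
      by (simp only: distrib_right power_add mult.assoc)
    also have "\<dots> = a * x ^ n * x ^ m + b * x ^ m * x ^ n"
      by (simp only: powers_commute[of x n m] mult.assoc)
    also have "\<dots> \<in> R"
      by (rule D(4)[OF D(6)[OF n D(8)[OF x(1)]] D(6)[OF m D(8)[OF x(1)]]])
    finally show ?thesis unfolding localized_def by blast
  qed
  show "\<iota> c * a \<in> localized x R" if a: "a \<in> localized x R"
  proof -
    obtain n where n: "a * x ^ n \<in> R" using a unfolding localized_def by blast
    have "\<iota> c * a * x ^ n \<in> R" unfolding mult.assoc by (rule D(9)[OF n])
    then show ?thesis unfolding localized_def by blast
  qed
  show "a * inverse x ^ n \<in> localized x R" if a: "a \<in> localized x R"
  proof -
    obtain m where m: "a * x ^ m \<in> R" using a unfolding localized_def by blast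
    have "inverse x ^ n * x ^ n = 1" using x(2) by (simp add: power_inverse)
    then have "a * inverse x ^ n * x ^ (n + m) = a * x ^ m"
      unfolding power_add mult.assoc by (simp add: mult.assoc[of "inverse x ^ n", symmetric])
    then have "a * inverse x ^ n * x ^ (n + m) \<in> R" using m by simp
    then show ?thesis unfolding localized_def by blast
  qed
qed

lemma (in scalars) localized_sum:
  assumes R: "subalgebra_on R" "x \<in> R" "x \<noteq> 0" and f: "\<And>i. i \<in> A \<Longrightarrow> f i \<in> localized x R"
  shows "sum f A \<in> localized x R"
proof -
  have "0 \<in> localized x R" using localized_closed(1)[OF R] subalgebra_onD(2)[OF R(1)] by blast
  then show ?thesis
    using f by (induction A rule: infinite_finite_induct) (simp_all add: localized_closed(2)[OF R])
qed

context deletion_step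
begin

section \<open>Leading terms in powers of \<open>x\<close> and injectivity of the deletion
  map\<close>

definition below :: "nat \<Rightarrow> 'f set" where
  "below n = {\<Sum>k<n. a k * x ^ k | a. \<forall>k. a k \<in> B}"

lemma below_monomial: "b \<in> B \<Longrightarrow> k < n \<Longrightarrow> b * x ^ k \<in> below n"
proof -
  assume b: "b \<in> B" and k: "k < n"
  have "(\<Sum>i<n. (if i = k then b else 0) * x ^ i) = (\<Sum>i<n. if i = k then b * x ^ i else 0)"
    by (rule sum.cong) auto
  also have "\<dots> = b * x ^ k" using k by simp
  finally show ?thesis unfolding below_def using b BD(2)
    by (intro CollectI exI[of _ "\<lambda>i. if i = k then b else 0"]) auto
qed

lemma below_add: "z \<in> below n \<Longrightarrow> w \<in> below n \<Longrightarrow> z + w \<in> below n"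
proof -
  assume "z \<in> below n" "w \<in> below n"
  then obtain a a' where "\<forall>k. a k \<in> B" "z = (\<Sum>k<n. a k * x ^ k)"
    "\<forall>k. a' k \<in> B" "w = (\<Sum>k<n. a' k * x ^ k)" unfolding below_def by auto
  then show ?thesis unfolding below_def using BD(4)
    by (intro CollectI exI[of _ "\<lambda>k. a k + a' k"]) (simp add: distrib_right sum.distrib)
qed

lemma below_0: "0 \<in> below n"
  unfolding below_def using BD(2) by (intro CollectI exI[of _ "\<lambda>_. 0"]) simp

lemma below_sum: "(\<And>i. i \<in> A \<Longrightarrow> f i \<in> below n) \<Longrightarrow> sum f A \<in> below n"
  by (induction A rule: infinite_finite_induct) (auto intro: below_0 below_add)

lemma below_mono: "z \<in> below n \<Longrightarrow> n \<le> m \<Longrightarrow> z \<in> below m"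
  unfolding below_def[of n] by (auto intro!: below_sum below_monomial)

text \<open>
  \<open>lead z b n\<close> says that \<open>z\<close> has leading summand \<open>b x\<^sup>n\<close> in the Laurent extension of \<open>B\<close>,
  with denominators cleared.
\<close>

definition lead :: "'f \<Rightarrow> 'f \<Rightarrow> nat \<Rightarrow> bool" where
  "lead z b n \<longleftrightarrow> b \<in> B \<and> (\<exists>M0. \<forall>M\<ge>M0. z * x ^ M - b * x ^ (n + M) \<in> below (n + M))"

lemma lead_zero:
  assumes "lead 0 b n"
  shows "b = 0"
proof -
  obtain M where "0 * x ^ M - b * x ^ (n + M) \<in> below (n + M)" and b: "b \<in> B"
    using assms unfolding lead_def by blast
  then have "- (b * x ^ (n + M)) \<in> below (n + M)" by (simp only: mult_zero_left diff_0)
  then obtain a where a: "\<And>k. a k \<in> B" "- (b * x ^ (n + M)) = (\<Sum>k<n + M. a k * x ^ k)"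
    unfolding below_def by blast
  \<comment> \<open>Appending \<open>b\<close> as top coefficient turns the equation into a
    polynomial relation, to which freeness applies.\<close>
  define a' where "a' = a(n + M := b)"
  have a': "a' (n + M) = b" "\<And>k. k < n + M \<Longrightarrow> a' k = a k" "\<And>k. a' k \<in> B"
    using a(1) b by (simp_all add: a'_def)
  have "(\<Sum>k\<le>n + M. a' k * x ^ k) = (\<Sum>k<n + M. a' k * x ^ k) + b * x ^ (n + M)"
    by (simp only: lessThan_Suc_atMost[symmetric] sum.lessThan_Suc a'(1))
  also have "(\<Sum>k<n + M. a' k * x ^ k) = (\<Sum>k<n + M. a k * x ^ k)"
    by (rule sum.cong) (simp_all add: a'(2))
  also have "\<dots> = - (b * x ^ (n + M))" by (rule a(2)[symmetric])
  finally have "(\<Sum>k\<le>n + M. a' k * x ^ k) = 0" by simp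
  then have "a' (n + M) = 0" by (rule free[OF a'(3)])
  then show ?thesis unfolding a'(1) .
qed

lemma lead_shift: "lead z b n \<Longrightarrow> lead (z * x) b (Suc n)"
proof -
  assume "lead z b n"
  then obtain M0 where b: "b \<in> B" and M0: "\<And>M. M \<ge> M0 \<Longrightarrow> z * x ^ M - b * x ^ (n + M) \<in> below (n + M)"
    unfolding lead_def by blast
  have "z * x * x ^ M - b * x ^ (Suc n + M) \<in> below (Suc n + M)" if "M \<ge> M0" for M
    using M0[of "Suc M"] that by (simp add: mult.assoc)
  then show ?thesis using b unfolding lead_def by blast
qed

lemma lead_add:
  assumes z: "lead z b n" and w: "lead w b' m" and "m < n"
  shows "lead (z + w) b n"
proof -
  obtain M0 where b: "b \<in> B" and M0: "\<And>M. M \<ge> M0 \<Longrightarrow> z * x ^ M - b * x ^ (n + M) \<in> below (n + M)"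
    using z unfolding lead_def by blast
  obtain M1 where b': "b' \<in> B" and M1: "\<And>M. M \<ge> M1 \<Longrightarrow> w * x ^ M - b' * x ^ (m + M) \<in> below (m + M)"
    using w unfolding lead_def by blast
  have "(z + w) * x ^ M - b * x ^ (n + M) \<in> below (n + M)" if M: "M \<ge> max M0 M1" for M
  proof -
    have "(w * x ^ M - b' * x ^ (m + M)) \<in> below (n + M)"
      using below_mono[OF M1] M \<open>m < n\<close> by simp
    moreover have "b' * x ^ (m + M) \<in> below (n + M)"
      using below_monomial[OF b'] \<open>m < n\<close> by simp
    ultimately have "(z * x ^ M - b * x ^ (n + M)) + ((w * x ^ M - b' * x ^ (m + M)) + b' * x ^ (m + M))
      \<in> below (n + M)"
      using M0[of M] M by (intro below_add) auto
    then show ?thesis by (simp add: algebra_simps)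
  qed
  then show ?thesis using b unfolding lead_def by blast
qed

lemma theta_Suc:
  assumes "nil (Suc K) b"
  shows "\<theta> b = b + (\<Sum>m<K. \<iota> (c (Suc m)) * e (Suc m) b * u ^ Suc m)"
  unfolding theta_eq[OF assms] sum.lessThan_Suc_shift using nil_mem[OF assms] by simp

lemma u_pow_x_pow: "m \<le> M \<Longrightarrow> u ^ m * x ^ M = x ^ (M - m)"
proof -
  assume m: "m \<le> M"
  have "x ^ M = x ^ m * x ^ (M - m)" using m by (simp flip: power_add)
  moreover have "u ^ m * x ^ m = 1" using x0 by (simp add: power_inverse)
  ultimately show ?thesis by (simp flip: mult.assoc)
qed

lemma lead_theta:
  assumes b: "b \<in> B"
  shows "lead (\<theta> b) b 0"
proof -
  obtain K where "nil K b" by (rule nil_exists[OF b])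
  then have K: "nil (Suc K) b" by (rule nil_mono) simp
  \<comment> \<open>Once \<open>M\<close> reaches the bound, every negative power of
    \<open>x\<close> is absorbed and only exponents below \<open>M\<close> remain beside
    \<open>b * x ^ M\<close>.\<close>
  have "\<theta> b * x ^ M - b * x ^ (0 + M) \<in> below (0 + M)" if "M \<ge> K" for M
  proof -
    have "\<theta> b * x ^ M - b * x ^ (0 + M) = (\<Sum>m<K. \<iota> (c (Suc m)) * e (Suc m) b * (u ^ Suc m * x ^ M))"
      unfolding theta_Suc[OF K] by (simp only: distrib_right sum_distrib_right mult.assoc) simp
    also have "\<dots> = (\<Sum>m<K. \<iota> (c (Suc m)) * e (Suc m) b * x ^ (M - Suc m))"
    proof (rule sum.cong[OF refl])
      fix m assume "m \<in> {..<K}"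
      then have "Suc m \<le> M" using that by simp
      then show "\<iota> (c (Suc m)) * e (Suc m) b * (u ^ Suc m * x ^ M)
        = \<iota> (c (Suc m)) * e (Suc m) b * x ^ (M - Suc m)" by (simp only: u_pow_x_pow)
    qed
    also have "\<dots> \<in> below (0 + M)"
      using that b by (intro below_sum below_monomial BD(9) e_mem) auto
    finally show ?thesis .
  qed
  then show ?thesis using b unfolding lead_def by blast
qed

lemma theta_eq_0: "b \<in> B \<Longrightarrow> \<theta> b = 0 \<Longrightarrow> b = 0"
  using lead_theta[of b] lead_zero[of b 0] by simp

lemma theta_zero [simp]: "\<theta> 0 = 0"
  using theta_scal[of 0] by simp

lemma theta_minus: "b \<in> B \<Longrightarrow> \<theta> (- b) = - \<theta> b"
  using theta_add[of b "- b"] BD(7)[of b] by (simp add: eq_neg_iff_add_eq_0 add.commute)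

lemma inj_theta: "inj_on \<theta> B"
proof (rule inj_onI)
  fix a b assume ab: "a \<in> B" "b \<in> B" "\<theta> a = \<theta> b"
  then have "\<theta> (a + - b) = 0" using theta_add[of a "- b"] BD(7)[of b] by (simp add: theta_minus)
  then have "a + - b = 0" by (rule theta_eq_0[OF BD(4)[OF ab(1) BD(7)[OF ab(2)]]])
  then show "a = b" by simp
qed

text \<open>Polynomials in \<open>x\<close> over the image of \<open>\<theta>\<close>, in Horner
  form: products and leading terms are then handled one coefficient at a time.\<close>

inductive_set poly :: "'f set" where
  zero: "0 \<in> poly"
| step: "z \<in> poly \<Longrightarrow> b \<in> B \<Longrightarrow> z * x + \<theta> b \<in> poly"

lemma poly_theta: "b \<in> B \<Longrightarrow> \<theta> b \<in> poly"
  using poly.step[OF poly.zero, of b] by simp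

lemma poly_x: "z \<in> poly \<Longrightarrow> z * x \<in> poly"
  using poly.step[of z 0] BD(2) by simp

lemma poly_add: "z \<in> poly \<Longrightarrow> w \<in> poly \<Longrightarrow> z + w \<in> poly"
proof (induction z arbitrary: w rule: poly.induct)
  case (step z b)
  from step.prems show ?case
  proof cases
    case zero
    then show ?thesis using poly.step[OF step.hyps(1,2)] by simp
  next
    case (step w' b')
    have "(z * x + \<theta> b) + w = (z + w') * x + \<theta> (b + b')"
      using step theta_add[OF \<open>b \<in> B\<close> step(3)] by (simp add: algebra_simps)
    then show ?thesis using poly.step[OF step.IH BD(4)] step \<open>b \<in> B\<close> by simp
  qed
qed simp

lemma poly_mult_theta: "z \<in> poly \<Longrightarrow> b \<in> B \<Longrightarrow> z * \<theta> b \<in> poly"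
proof (induction z arbitrary: b rule: poly.induct)
  case (step z a)
  have "(z * x + \<theta> a) * \<theta> b = z * \<theta> (\<sigma> b) * x + \<theta> (a * b)"
    using x_theta[OF step.prems] theta_mult[OF step.hyps(2) step.prems]
    by (simp add: distrib_right mult.assoc)
  moreover have "\<dots> \<in> poly"
    by (intro poly.step step.IH sigma_mem BD(6) step.hyps step.prems)
  ultimately show ?case by simp
qed (simp add: poly.zero)

lemma poly_mult: "w \<in> poly \<Longrightarrow> z \<in> poly \<Longrightarrow> z * w \<in> poly"
proof (induction w rule: poly.induct)
  case (step w b)
  have "z * (w * x + \<theta> b) = z * w * x + z * \<theta> b" by (simp add: distrib_left mult.assoc)
  then show ?case using poly_add[OF poly_x[OF step.IH] poly_mult_theta] step by simp
qed (simp add: poly.zero)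

lemma galg_theta_subset_poly: "galg (\<theta> ` B \<union> {x}) \<subseteq> poly"
proof (rule galg_least)
  have scal: "\<iota> a \<in> poly" for a using poly_theta[OF BD(1)[of a]] by simp
  have "z - w \<in> poly" if "z \<in> poly" "w \<in> poly" for z w
    using poly_add[OF that(1) poly_mult[OF that(2) scal[of "- 1"]]] by (simp add: iota_minus)
  then show "subalgebra_on poly"
    using poly_mult scal scal[of 1] unfolding subalgebra_on_def subring_on_def by auto
  have "x \<in> poly" using poly_x[OF poly_theta[OF BD(3)]] theta_scal[of 1] by simp
  then show "\<theta> ` B \<union> {x} \<subseteq> poly" using poly_theta by auto
qed

text \<open>Multiplication by \<open>x\<close> raises the degree above 0, so adding
  \<open>\<theta> b\<close> cannot cancel the leading term.\<close>

lemma poly_lead: "z \<in> poly \<Longrightarrow> z = 0 \<or> (\<exists>b n. b \<noteq> 0 \<and> lead z b n)"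
proof (induction z rule: poly.induct)
  case (step z b)
  show ?case
  proof (cases "z = 0")
    case True
    then show ?thesis using lead_theta[OF step.hyps(2)] by (cases "b = 0") auto
  next
    case False
    then obtain b' n where b': "b' \<noteq> 0" "lead z b' n" using step.IH by blast
    have "lead (z * x + \<theta> b) b' (Suc n)"
      by (rule lead_add[OF lead_shift[OF b'(2)] lead_theta[OF step.hyps(2)]]) simp
    then show ?thesis using b'(1) by blast
  qed
qed simp

lemma theta_poly_free:
  assumes r: "r \<in> galg (\<theta> ` B \<union> {x})" and rx: "r * x \<in> \<theta> ` B"
  shows "r = 0"
proof (rule ccontr)
  assume "r \<noteq> 0"
  then obtain b n where b: "b \<noteq> 0" "lead r b n"
    using poly_lead r galg_theta_subset_poly by blast
  obtain a where a: "a \<in> B" "r * x = \<theta> a" using rx by blast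
  have "lead (r * x + \<theta> (- a)) b (Suc n)"
    by (rule lead_add[OF lead_shift[OF b(2)] lead_theta[OF BD(7)[OF a(1)]]]) simp
  then have "lead 0 b (Suc n)" unfolding a(2) theta_minus[OF a(1)] by simp
  then show False using lead_zero b(1) by blast
qed

section \<open>\<open>B\<close> and its image in each other's localization, and the Ore
  condition\<close>

lemma theta_in_localized:
  assumes R: "subalgebra_on R" "B \<subseteq> R" "x \<in> R" and b: "b \<in> B"
  shows "\<theta> b \<in> localized x R"
proof -
  note L = localized_closed[OF R(1) R(3) x0]
  obtain M where M: "nil M b" by (rule nil_exists[OF b])
  have summand: "\<iota> (c n) * e n b * u ^ n \<in> localized x R" for n
    using L(1) R(2) e_mem[OF b] by (intro L(3,4)) blast
  show ?thesis unfolding theta_eq[OF M] by (rule localized_sum[OF R(1) R(3) x0 summand])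
qed

lemma base_in_localized:
  assumes R: "subalgebra_on R" "\<theta> ` B \<subseteq> R" "x \<in> R" and b: "b \<in> B"
  shows "b \<in> localized x R"
proof -
  note L = localized_closed[OF R(1) R(3) x0]
  have zero: "0 \<in> localized x R" using L(1) subalgebra_onD(2)[OF R(1)] by blast
  obtain M where "nil M b" by (rule nil_exists[OF b])
  then show ?thesis
  proof (induction M arbitrary: b rule: less_induct)
    case (less M)
    show ?case
    proof (cases M)
      case 0
      then have "b = 0" using less.prems d_0[of b] by (simp add: nil_def)
      then show ?thesis using zero by simp
    next
      case (Suc K)
      \<comment> \<open>Solving the formula for \<open>\<theta> b\<close> for \<open>b\<close>
        leaves only coefficients with strictly smaller bound.\<close>
      have "e (Suc m) b \<in> localized x R" if "m < K" for m
        using less.IH[of "M - Suc m"] nil_e[OF less.prems, of "Suc m"] that Suc by simp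
      then have summand: "\<iota> (- c (Suc m)) * e (Suc m) b * u ^ Suc m \<in> localized x R" if "m < K" for m
        using that by (intro L(3,4)) auto
      have partial: "(\<Sum>m<K. \<iota> (- c (Suc m)) * e (Suc m) b * u ^ Suc m) \<in> localized x R"
        by (rule localized_sum[OF R(1) R(3) x0], rule summand) simp
      have "\<theta> b \<in> localized x R" using L(1) R(2) nil_mem[OF less.prems] by blast
      then have "\<theta> b + (\<Sum>m<K. \<iota> (- c (Suc m)) * e (Suc m) b * u ^ Suc m) \<in> localized x R"
        using partial by (rule L(2))
      also have "\<theta> b + (\<Sum>m<K. \<iota> (- c (Suc m)) * e (Suc m) b * u ^ Suc m) = b"
        unfolding theta_Suc[OF less.prems[unfolded Suc]] by (simp add: iota_minus sum_negf)
      finally show ?thesis .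
    qed
  qed
qed

text \<open>Negative powers of \<open>x\<close> cross \<open>\<theta> b\<close> exactly, by
  \<open>u_pow_theta\<close>, whereas they cross \<open>b\<close> only with correction terms. Hence
  \<open>b\<close> is replaced by \<open>\<theta> b\<close> minus summands of smaller nilpotency
  bound, treated by induction.\<close>

lemma u_pow_base_in_localized:
  assumes R: "subalgebra_on R" "B \<subseteq> R" "x \<in> R" and b: "b \<in> B"
  shows "u ^ n * b \<in> localized x R"
proof -
  note L = localized_closed[OF R(1) R(3) x0]
  have zero: "0 \<in> localized x R" using L(1) subalgebra_onD(2)[OF R(1)] by blast
  obtain M where "nil M b" by (rule nil_exists[OF b])
  then show ?thesis
  proof (induction M arbitrary: b rule: less_induct)
    case (less M)
    have bB: "b \<in> B" by (rule nil_mem[OF less.prems])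
    show ?case
    proof (cases M)
      case 0
      then have "b = 0" using less.prems d_0[of b] by (simp add: nil_def)
      then show ?thesis using zero by simp
    next
      case (Suc K)
      have "u ^ n * e (Suc m) b \<in> localized x R" if "m < K" for m
        using less.IH[of "M - Suc m"] nil_e[OF less.prems, of "Suc m"] that Suc by simp
      then have summand: "\<iota> (- c (Suc m)) * (u ^ n * e (Suc m) b) * u ^ Suc m \<in> localized x R" if "m < K" for m
        using that by (intro L(3,4)) auto
      have partial: "(\<Sum>m<K. \<iota> (- c (Suc m)) * (u ^ n * e (Suc m) b) * u ^ Suc m) \<in> localized x R"
        by (rule localized_sum[OF R(1) R(3) x0], rule summand) simp
      have "u ^ n * \<theta> b \<in> localized x R"
        unfolding u_pow_theta[OF bB] by (intro L(4) theta_in_localized[OF R] tau_pow_mem bB)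
      then have "u ^ n * \<theta> b + (\<Sum>m<K. \<iota> (- c (Suc m)) * (u ^ n * e (Suc m) b) * u ^ Suc m) \<in> localized x R"
        using partial by (rule L(2))
      also have "(\<Sum>m<K. \<iota> (- c (Suc m)) * (u ^ n * e (Suc m) b) * u ^ Suc m)
        = - (\<Sum>m<K. u ^ n * (\<iota> (c (Suc m)) * e (Suc m) b * u ^ Suc m))"
        unfolding sum_negf[symmetric]
        by (rule sum.cong[OF refl])
          (simp only: iota_minus mult.assoc iota_left_commute[of "u ^ n"] mult_minus_left)
      finally show ?thesis
        unfolding theta_Suc[OF less.prems[unfolded Suc]] by (simp add: distrib_left sum_distrib_left)
    qed
  qed
qed

lemma base_ore:
  assumes R: "subalgebra_on R" "B \<subseteq> R" "x \<in> R" and b: "b \<in> B"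
  shows "\<exists>r\<in>R. \<exists>k. b * x ^ k = x ^ n * r"
proof -
  obtain k where k: "u ^ n * b * x ^ k \<in> R"
    using u_pow_base_in_localized[OF R b] unfolding localized_def by blast
  have "x ^ n * u ^ n = 1" using x0 by (simp add: power_inverse)
  then have "b * x ^ k = x ^ n * (u ^ n * b * x ^ k)" by (simp flip: mult.assoc)
  then show ?thesis using k by blast
qed

end

section \<open>The homomorphism onto the quotient\<close>

context scalars
begin

text \<open>The subalgebra of the product algebra generated by the pairs of generators. A
  homomorphism y_i to z_i modulo I exists as soon as every pair over 0 has its second component in
  I.\<close>

inductive graph :: "(nat \<Rightarrow> 'f) \<Rightarrow> (nat \<Rightarrow> 'f) \<Rightarrow> nat set \<Rightarrow> 'f \<Rightarrow> 'f \<Rightarrow> bool"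
  for y z :: "nat \<Rightarrow> 'f" and S :: "nat set" where
  scal: "graph y z S (\<iota> c) (\<iota> c)"
| incl: "i \<in> S \<Longrightarrow> graph y z S (y i) (z i)"
| add: "graph y z S a c \<Longrightarrow> graph y z S b d \<Longrightarrow> graph y z S (a + b) (c + d)"
| mult: "graph y z S a c \<Longrightarrow> graph y z S b d \<Longrightarrow> graph y z S (a * b) (c * d)"

lemma graph_mem:
  assumes "graph y z S a c"
  shows "a \<in> galg (y ` S)" "c \<in> galg (z ` S)"
  using assms by (induction rule: graph.induct) (auto intro: galg_scal galg_incl galg_add galg_mult)

lemma graph_total: "a \<in> galg (y ` S) \<Longrightarrow> \<exists>c. graph y z S a c"
  by (induction rule: galg_induct) (auto intro: graph.intros)

lemma graph_minus: "graph y z S a c \<Longrightarrow> graph y z S (- a) (- c)"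
  using graph.mult[OF graph.scal[of y z S "- 1"], of a c] by (simp add: iota_minus)

lemma graph_diff: "graph y z S a c \<Longrightarrow> graph y z S b d \<Longrightarrow> graph y z S (a - b) (c - d)"
  using graph.add[of y z S a c "- b" "- d"] graph_minus[of y z S b d] by simp

end

text \<open>
  The graph of \<open>y l \<mapsto> z l\<close> modulo \<open>I\<close> stays single-valued when the index \<open>i\<close> is added: the
  relations below reduce every pair of the new graph to a pair in Horner form in \<open>y i\<close> and
  \<open>z i\<close>, and \<open>free\<close> says that the Horner form of the left component is unique.
\<close>

locale graph_step = scalars \<iota> for \<iota> :: "'k::field \<Rightarrow> 'f::division_ring" +
  fixes y z :: "nat \<Rightarrow> 'f" and S :: "nat set" and i :: nat and C I :: "'f set"
  assumes C: "subalgebra_on C"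
    and I: "ideal_on C I"
    and zC: "z i \<in> C" "z ` S \<subseteq> C"
    and single: "graph y z S 0 c \<Longrightarrow> c \<in> I"
    and skew: "l \<in> S \<Longrightarrow> \<exists>t. y i * y l = \<iota> t * (y l * y i) \<and> z i * z l - \<iota> t * (z l * z i) \<in> I"
    and free: "r \<in> galg (y ` insert i S) \<Longrightarrow> r * y i \<in> galg (y ` S) \<Longrightarrow> r = 0"
begin

lemmas CD = subalgebra_onD[OF C]
lemmas ID = ideal_onD[OF I]

lemma graph_C: "graph y z S a c \<Longrightarrow> c \<in> C"
  using graph_mem(2) galg_least[OF C zC(2)] by blast

text \<open>One and the same pair of the graph serves both components: the relation is exact on the
  left and holds modulo \<open>I\<close> on the right.\<close>

lemma twist:
  assumes "graph y z S b d"
  shows "\<exists>b' d'. graph y z S b' d' \<and> y i * b = b' * y i \<and> z i * d - d' * z i \<in> I"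
  using assms
proof (induction rule: graph.induct)
  case (scal c)
  have "y i * \<iota> c = \<iota> c * y i" "z i * \<iota> c - \<iota> c * z i = 0" by (simp_all add: iota_central)
  then show ?case using graph.scal[of y z S c] ID(3) by (intro exI[of _ "\<iota> c"]) simp
next
  case (incl l)
  then obtain t where "y i * y l = \<iota> t * y l * y i" "z i * z l - \<iota> t * z l * z i \<in> I"
    using skew[OF incl] by (auto simp: mult.assoc)
  then show ?case using graph.mult[OF graph.scal graph.incl[OF incl]] by blast
next
  case (add a c b d)
  obtain a' c' b' d' where 1: "graph y z S a' c'" "y i * a = a' * y i" "z i * c - c' * z i \<in> I"
    and 2: "graph y z S b' d'" "y i * b = b' * y i" "z i * d - d' * z i \<in> I"
    using add.IH by blast
  have "y i * (a + b) = (a' + b') * y i" using 1 2 by (simp add: algebra_simps)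
  moreover have "(z i * c - c' * z i) + (z i * d - d' * z i) \<in> I" by (rule ID(4)[OF 1(3) 2(3)])
  then have "z i * (c + d) - (c' + d') * z i \<in> I" by (simp add: algebra_simps)
  ultimately show ?case using graph.add[OF 1(1) 2(1)] by blast
next
  case (mult a c b d)
  obtain a' c' b' d' where 1: "graph y z S a' c'" "y i * a = a' * y i" "z i * c - c' * z i \<in> I"
    and 2: "graph y z S b' d'" "y i * b = b' * y i" "z i * d - d' * z i \<in> I"
    using mult.IH by blast
  have "y i * (a * b) = a' * (y i * b)" using 1 by (simp flip: mult.assoc)
  also have "\<dots> = a' * b' * y i" using 2 by (simp add: mult.assoc)
  finally have "y i * (a * b) = a' * b' * y i" .
  \<comment> \<open>The two errors are added after multiplication by \<open>d\<close> on the right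
    and \<open>c'\<close> on the left, so \<open>I\<close> has to be two-sided.\<close>
  moreover have "(z i * c - c' * z i) * d + c' * (z i * d - d' * z i) \<in> I"
    by (intro ID(4) ID(5)[OF graph_C[OF 1(1)] 2(3)] ID(6)[OF graph_C[OF mult.hyps(2)] 1(3)])
  then have "z i * (c * d) - c' * d' * z i \<in> I" by (simp add: algebra_simps)
  ultimately show ?case using graph.mult[OF 1(1) 2(1)] by blast
qed

text \<open>Both clauses leave the right component free up to \<open>I\<close>, so that errors from
  \<open>twist\<close> can be absorbed by \<open>horner_cong\<close>.\<close>

inductive horner :: "'f \<Rightarrow> 'f \<Rightarrow> bool" where
  base: "f \<in> I \<Longrightarrow> horner 0 f"
| step: "horner a f \<Longrightarrow> graph y z S b d \<Longrightarrow> f' - (f * z i + d) \<in> I \<Longrightarrow> horner (a * y i + b) f'"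

lemma graph_0: "graph y z S 0 0"
  using graph.scal[of y z S 0] by simp

lemma horner_C: "horner a f \<Longrightarrow> f \<in> C"
proof (induction rule: horner.induct)
  case (base f)
  then show ?case by (rule ID(2))
next
  case (step a f b d f')
  have "(f' - (f * z i + d)) + (f * z i + d) \<in> C"
    by (rule CD(4)[OF ID(2)[OF step.hyps(3)] CD(4)[OF CD(6)[OF step.IH zC(1)] graph_C[OF step.hyps(2)]]])
  then show ?case by (simp only: diff_add_cancel)
qed

lemma horner_gen: "horner a f \<Longrightarrow> a \<in> galg (y ` insert i S)"
proof (induction rule: horner.induct)
  case (base f)
  show ?case by (rule subalgebra_onD(2)[OF subalgebra_on_galg])
next
  case (step a f b d f')
  have "galg (y ` S) \<subseteq> galg (y ` insert i S)" by (rule galg_mono) (rule image_mono, rule subset_insertI)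
  then have b: "b \<in> galg (y ` insert i S)" by (rule subsetD) (rule graph_mem(1)[OF step.hyps(2)])
  have "y i \<in> galg (y ` insert i S)" by (rule galg_incl) simp
  then show ?case by (rule galg_add[OF galg_mult[OF step.IH] b])
qed

lemma horner_cong:
  assumes "horner a f" "f' - f \<in> I"
  shows "horner a f'"
  using assms(1)
proof cases
  case base
  have "(f' - f) + f \<in> I" by (rule ID(4)[OF assms(2) base(2)])
  then have "f' \<in> I" by simp
  then show ?thesis unfolding base(1) by (rule horner.base)
next
  case (step a' g b d)
  have "(f' - f) + (f - (g * z i + d)) \<in> I" by (rule ID(4)[OF assms(2) step(4)])
  moreover have "(f' - f) + (f - (g * z i + d)) = f' - (g * z i + d)" by simp
  ultimately have "f' - (g * z i + d) \<in> I" by (simp only:)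
  then show ?thesis unfolding step(1) by (rule horner.step[OF step(2,3)])
qed

lemma horner_mult_gen: "horner a f \<Longrightarrow> horner (a * y i) (f * z i)"
  using horner.step[of a f 0 0 "f * z i"] graph_0 ID(3) by simp

lemma horner_graph: "graph y z S b d \<Longrightarrow> horner b d"
  using horner.step[of 0 0 b d d] horner.base ID(3) by simp

lemma horner_add: "horner a f \<Longrightarrow> horner b g \<Longrightarrow> horner (a + b) (f + g)"
proof (induction arbitrary: b g rule: horner.induct)
  case (base f)
  then show ?case by (auto intro: horner_cong)
next
  case (step a f b d f' b2 g2)
  from step.prems show ?case
  proof cases
    case base
    show ?thesis unfolding base(1)
      using horner_cong[OF horner.step[OF step.hyps], of "f' + g2"] base(2) by simp
  next
    case (step a3 f3 b3 d3)
    have "(f' - (f * z i + d)) + (g2 - (f3 * z i + d3)) \<in> I" by (rule ID(4)[OF \<open>f' - _ \<in> I\<close> step(4)])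
    then have "f' + g2 - ((f + f3) * z i + (d + d3)) \<in> I" by (simp add: algebra_simps)
    from horner.step[OF \<open>\<And>b g. horner b g \<Longrightarrow> _\<close>[OF step(2)] graph.add[OF \<open>graph y z S b d\<close> step(3)] this]
    show ?thesis unfolding step(1) by (simp add: algebra_simps)
  qed
qed

lemma horner_mult_graph: "horner a f \<Longrightarrow> graph y z S b d \<Longrightarrow> horner (a * b) (f * d)"
proof (induction arbitrary: b d rule: horner.induct)
  case (base f)
  then show ?case using horner.base ID(6) graph_C by simp
next
  case (step a f b d f' b2 d2)
  obtain b3 d3 where t: "graph y z S b3 d3" "y i * b2 = b3 * y i" "z i * d2 - d3 * z i \<in> I"
    using twist[OF step.prems] by blast
  have "horner (a * b3 * y i + b * b2) (f * d3 * z i + d * d2)"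
    by (rule horner.step[OF step.IH[OF t(1)] graph.mult[OF step.hyps(2) step.prems]]) (simp add: ID(3))
  moreover have "(f' - (f * z i + d)) * d2 + f * (z i * d2 - d3 * z i) \<in> I"
    by (intro ID(4) ID(6)[OF graph_C[OF step.prems] step.hyps(3)] ID(5)[OF horner_C[OF step.hyps(1)] t(3)])
  then have "f' * d2 - (f * d3 * z i + d * d2) \<in> I" by (simp add: algebra_simps)
  ultimately have "horner (a * b3 * y i + b * b2) (f' * d2)" by (rule horner_cong)
  moreover have "(a * y i + b) * b2 = a * b3 * y i + b * b2"
    using t(2) by (simp add: distrib_right mult.assoc)
  ultimately show ?case by simp
qed

lemma horner_mult: "horner b g \<Longrightarrow> horner a f \<Longrightarrow> horner (a * b) (f * g)"
proof (induction rule: horner.induct)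
  case (base g)
  then show ?case using horner.base ID(5) horner_C by simp
next
  case (step b g b2 d2 g')
  have "horner (a * b * y i + a * b2) (f * g * z i + f * d2)"
    by (rule horner_add[OF horner_mult_gen[OF step.IH[OF step.prems]] horner_mult_graph[OF step.prems step.hyps(2)]])
  moreover have "f * (g' - (g * z i + d2)) \<in> I"
    by (rule ID(5)[OF horner_C[OF step.prems] step.hyps(3)])
  then have "f * g' - (f * g * z i + f * d2) \<in> I" by (simp add: algebra_simps)
  ultimately have "horner (a * b * y i + a * b2) (f * g')" by (rule horner_cong)
  then show ?case by (simp add: distrib_left mult.assoc)
qed

lemma graph_insert_imp_horner: "graph y z (insert i S) a c \<Longrightarrow> horner a c"
proof (induction rule: graph.induct)
  case (scal c)
  show ?case by (rule horner_graph[OF graph.scal])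
next
  case (incl l)
  show ?case
  proof (cases "l = i")
    case True
    have "horner 1 1" using horner_graph[OF graph.scal[of y z S 1]] by simp
    then show ?thesis using horner_mult_gen[of 1 1] True by simp
  next
    case False
    then show ?thesis using incl by (intro horner_graph graph.incl) simp
  qed
next
  case (add a c b d)
  show ?case by (rule horner_add[OF add.IH])
next
  case (mult a c b d)
  show ?case by (rule horner_mult[OF mult.IH(2,1)])
qed

text \<open>If the left component vanishes, \<open>free\<close> removes its Horner head; the tail
  then vanishes too and is covered by \<open>single\<close>.\<close>

lemma horner_zero: "horner a f \<Longrightarrow> a = 0 \<Longrightarrow> f \<in> I"
proof (induction rule: horner.induct)
  case (step a f b d f')
  have "a * y i = - b" using step.prems by (simp only: eq_neg_iff_add_eq_0)
  moreover have "- b \<in> galg (y ` S)"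
    using graph_mem(1)[OF graph_minus[OF step.hyps(2)]] .
  ultimately have a: "a = 0" using free[OF horner_gen[OF step.hyps(1)]] by simp
  then have f: "f \<in> I" by (rule step.IH)
  have "b = 0" using step.prems a by simp
  then have d: "d \<in> I" using single step.hyps(2) by simp
  have "(f' - (f * z i + d)) + (f * z i + d) \<in> I"
    by (rule ID(4)[OF step.hyps(3) ID(4)[OF ID(6)[OF zC(1) f] d]])
  then show ?case by (simp only: diff_add_cancel)
qed

lemma single_insert: "graph y z (insert i S) 0 c \<Longrightarrow> c \<in> I"
  using graph_insert_imp_horner horner_zero by blast

end

section \<open>From a single-valued graph to a homomorphism and a correspondence\<close>

context scalars
begin

lemma quotient_ops:
  assumes R: "subring_on R" and I: "ideal_on R I" and ab: "a \<in> R" "b \<in> R"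
  shows "(I +>\<^bsub>ring_on R\<^esub> a) \<otimes>\<^bsub>ring_on R Quot I\<^esub> (I +>\<^bsub>ring_on R\<^esub> b) = I +>\<^bsub>ring_on R\<^esub> (a * b)"
    and "(I +>\<^bsub>ring_on R\<^esub> a) \<oplus>\<^bsub>ring_on R Quot I\<^esub> (I +>\<^bsub>ring_on R\<^esub> b) = I +>\<^bsub>ring_on R\<^esub> (a + b)"
proof -
  interpret I: ideal I "ring_on R" using I by (simp add: ideal_ring_on_iff[OF R])
  show "(I +>\<^bsub>ring_on R\<^esub> a) \<otimes>\<^bsub>ring_on R Quot I\<^esub> (I +>\<^bsub>ring_on R\<^esub> b) = I +>\<^bsub>ring_on R\<^esub> (a * b)"
    using I.rcoset_mult_add[of a b] ab by (simp add: FactRing_def)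
  show "(I +>\<^bsub>ring_on R\<^esub> a) \<oplus>\<^bsub>ring_on R Quot I\<^esub> (I +>\<^bsub>ring_on R\<^esub> b) = I +>\<^bsub>ring_on R\<^esub> (a + b)"
    using I.a_rcos_sum[of a b] ab by (simp add: FactRing_def)
qed

lemma quotient_carrier:
  "Z \<in> carrier (ring_on R Quot I) \<longleftrightarrow> (\<exists>r\<in>R. Z = I +>\<^bsub>ring_on R\<^esub> r)"
  by (auto simp: FactRing_def A_RCOSETS_def')

lemma graph_ring_hom:
  assumes I: "ideal_on (galg (z ` S)) I"
    and single: "\<And>c. graph y z S 0 c \<Longrightarrow> c \<in> I"
  shows "\<exists>g. g \<in> ring_hom (ring_on (galg (y ` S))) (ring_on (galg (z ` S)) Quot I)
    \<and> (\<forall>c. g (\<iota> c) = I +>\<^bsub>ring_on (galg (z ` S))\<^esub> \<iota> c)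
    \<and> (\<forall>i\<in>S. g (y i) = I +>\<^bsub>ring_on (galg (z ` S))\<^esub> z i)"
proof -
  let ?R = "galg (z ` S)"
  define g where "g a = I +>\<^bsub>ring_on ?R\<^esub> (SOME c. graph y z S a c)" for a
  have g: "g a = I +>\<^bsub>ring_on ?R\<^esub> c" if c: "graph y z S a c" for a c
  proof -
    define c' where "c' = (SOME c. graph y z S a c)"
    have "graph y z S a c'" unfolding c'_def by (rule someI[of _ c]) (rule c)
    then have "graph y z S 0 (c' - c)" using graph_diff[OF _ c] by fastforce
    then have "c' - c \<in> I" by (rule single)
    then show ?thesis unfolding g_def c'_def[symmetric] using a_r_coset_eq_iff[OF subring_on_galg I] by blast
  qed
  have "g \<in> ring_hom (ring_on (galg (y ` S))) (ring_on ?R Quot I)"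
  proof (rule ring_hom_memI)
    fix a b assume "a \<in> carrier (ring_on (galg (y ` S)))" "b \<in> carrier (ring_on (galg (y ` S)))"
    then obtain c d where cd: "graph y z S a c" "graph y z S b d"
      using graph_total[of a y S z] graph_total[of b y S z] by auto
    note ops = quotient_ops[OF subring_on_galg I graph_mem(2)[OF cd(1)] graph_mem(2)[OF cd(2)]]
    show "g a \<in> carrier (ring_on ?R Quot I)"
      unfolding quotient_carrier g[OF cd(1)] using graph_mem(2)[OF cd(1)] by blast
    show "g (a \<otimes>\<^bsub>ring_on (galg (y ` S))\<^esub> b) = g a \<otimes>\<^bsub>ring_on ?R Quot I\<^esub> g b"
      unfolding g[OF cd(1)] g[OF cd(2)] ops using g[OF graph.mult[OF cd]] by simp
    show "g (a \<oplus>\<^bsub>ring_on (galg (y ` S))\<^esub> b) = g a \<oplus>\<^bsub>ring_on ?R Quot I\<^esub> g b"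
      unfolding g[OF cd(1)] g[OF cd(2)] ops using g[OF graph.add[OF cd]] by simp
  next
    show "g \<one>\<^bsub>ring_on (galg (y ` S))\<^esub> = \<one>\<^bsub>ring_on ?R Quot I\<^esub>"
      using g[OF graph.scal[of y z S 1]] by (simp add: FactRing_def)
  qed
  then show ?thesis using g graph.scal graph.incl by blast
qed

text \<open>Stated for any \<open>g\<close> with the prescribed values on generators, since
  \<open>dda_g\<close> is obtained by choice. Surjectivity is an induction over the generated target
  algebra.\<close>

lemma correspondence_of_ring_hom:
  assumes I: "ideal_on (galg (z ` S)) I"
    and g: "g \<in> ring_hom (ring_on (galg (y ` S))) (ring_on (galg (z ` S)) Quot I)"
      "\<And>c. g (\<iota> c) = I +>\<^bsub>ring_on (galg (z ` S))\<^esub> \<iota> c"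
      "\<And>i. i \<in> S \<Longrightarrow> g (y i) = I +>\<^bsub>ring_on (galg (z ` S))\<^esub> z i"
  defines "T \<equiv> \<lambda>a r. a \<in> galg (y ` S) \<and> r \<in> galg (z ` S) \<and> g a = I +>\<^bsub>ring_on (galg (z ` S))\<^esub> r"
  shows "correspondence (galg (y ` S)) (galg (z ` S)) T" "{r. T 0 r} = I"
proof -
  let ?R = "galg (z ` S)" and ?R' = "galg (y ` S)"
  have g_add: "g (a + b) = g a \<oplus>\<^bsub>ring_on ?R Quot I\<^esub> g b"
    and g_mult: "g (a * b) = g a \<otimes>\<^bsub>ring_on ?R Quot I\<^esub> g b" if "a \<in> ?R'" "b \<in> ?R'" for a b
    using ring_hom_add[OF g(1), of a b] ring_hom_mult[OF g(1), of a b] that by simp_all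
  have T_mult: "T (a * b) (r * s)" and T_add: "T (a + b) (r + s)" if "T a r" "T b s" for a b r s
  proof -
    have ab: "a \<in> ?R'" "b \<in> ?R'" and rs: "r \<in> ?R" "s \<in> ?R"
      and eq: "g a = I +>\<^bsub>ring_on ?R\<^esub> r" "g b = I +>\<^bsub>ring_on ?R\<^esub> s"
      using that unfolding T_def by blast+
    show "T (a * b) (r * s)"
      unfolding T_def g_mult[OF ab] eq quotient_ops[OF subring_on_galg I rs]
      by (intro conjI galg_mult ab rs refl)
    show "T (a + b) (r + s)"
      unfolding T_def g_add[OF ab] eq quotient_ops[OF subring_on_galg I rs]
      by (intro conjI galg_add ab rs refl)
  qed
  have T_scal: "T (\<iota> c) (\<iota> c)" for c unfolding T_def by (intro conjI galg_scal g(2))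
  have T_incl: "T (y i) (z i)" if "i \<in> S" for i
    unfolding T_def using g(3)[OF that] galg_incl that by simp
  have T_diff: "T (a - b) (r - s)" if "T a r" "T b s" for a b r s
    using T_add[OF that(1) T_mult[OF T_scal[of "- 1"] that(2)]] by (simp add: iota_minus)
  have "\<exists>r. T a r" if a: "a \<in> ?R'" for a
  proof -
    have "g a \<in> carrier (ring_on ?R Quot I)" using ring_hom_closed[OF g(1), of a] a by simp
    then show ?thesis unfolding quotient_carrier T_def using a by blast
  qed
  then have dom: "?R' = {a. \<exists>r. T a r}" unfolding T_def by blast
  have "\<exists>a. T a r" if "r \<in> ?R" for r
    using that
  proof (induction rule: galg_induct)
    case (scal c)
    show ?case by (rule exI, rule T_scal)
  next
    case (incl r)
    then obtain i where "r = z i" "i \<in> S" by (rule imageE)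
    then show ?case using T_incl by blast
  next
    case (add r s)
    then obtain a b where "T a r" "T b s" by blast
    then show ?case by (intro exI) (rule T_add)
  next
    case (mult r s)
    then obtain a b where "T a r" "T b s" by blast
    then show ?case by (intro exI) (rule T_mult)
  qed
  then have ran: "?R = {r. \<exists>a. T a r}" unfolding T_def by blast
  have one: "T 1 1" using T_scal[of 1] by simp
  show "correspondence ?R' ?R T"
    unfolding correspondence_def
    by (intro conjI allI impI subring_on_galg one T_diff T_mult dom ran)
  have "T 0 r \<longleftrightarrow> r \<in> I" for r
  proof -
    have "T 0 r \<longleftrightarrow> r \<in> ?R \<and> I +>\<^bsub>ring_on ?R\<^esub> r = I +>\<^bsub>ring_on ?R\<^esub> 0"
      using g(2)[of 0] galg_scal[of 0] unfolding T_def by auto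
    also have "\<dots> \<longleftrightarrow> r \<in> I"
      unfolding a_r_coset_eq_iff[OF subring_on_galg I] using ideal_onD(1)[OF I] by auto
    finally show ?thesis .
  qed
  then show "{r. T 0 r} = I" by blast
qed

end

section \<open>Transport along isomorphisms\<close>

context scalars
begin

lemma alg_iso_sum:
  assumes h: "alg_iso \<iota> B C h" and B: "subalgebra_on B" and f: "\<And>i. i \<in> A \<Longrightarrow> f i \<in> B"
  shows "h (sum f A) = (\<Sum>i\<in>A. h (f i))" "sum f A \<in> B"
proof -
  have "sum f A \<in> B \<and> h (sum f A) = (\<Sum>i\<in>A. h (f i))"
    using f
  proof (induction A rule: infinite_finite_induct)
    case (insert i A)
    then show ?case using alg_isoD(4)[OF h, of "f i" "sum f A"] subalgebra_onD(4)[OF B, of "f i" "sum f A"]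
      by simp
  qed (use subalgebra_onD(2)[OF B] alg_isoD(3)[OF h, of 0] in simp_all)
  then show "h (sum f A) = (\<Sum>i\<in>A. h (f i))" "sum f A \<in> B" by simp_all
qed

lemma alg_iso_scal: "alg_iso \<iota> B C h \<Longrightarrow> subalgebra_on B \<Longrightarrow> a \<in> B \<Longrightarrow> h (\<iota> c * a) = \<iota> c * h a"
  using alg_isoD(5)[of \<iota> B C h "\<iota> c" a] alg_isoD(3)[of \<iota> B C h c] subalgebra_onD(1)[of B c] by simp

lemma alg_iso_power:
  assumes "alg_iso \<iota> B C h" "subalgebra_on B" "a \<in> B"
  shows "h (a ^ n) = h a ^ n"
proof (induction n)
  case 0
  show ?case using alg_isoD(3)[OF assms(1), of 1] by simp
next
  case (Suc n)
  then show ?case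
    using alg_isoD(5)[OF assms(1) assms(3) subalgebra_onD(8)[OF assms(2,3), of n]] by simp
qed

lemma alg_iso_inv:
  assumes h: "alg_iso \<iota> B C h" and B: "subalgebra_on B"
  shows "alg_iso \<iota> C B (inv_into B h)" "subalgebra_on C"
proof -
  note D = alg_isoD[OF h] subalgebra_onD[OF B]
  let ?g = "inv_into B h"
  have g: "?g a \<in> B" "h (?g a) = a" if "a \<in> C" for a
    using that D(1) by (simp_all add: bij_betw_inv_into_right bij_betw_def inv_into_into)
  have gh: "?g (h b) = b" if "b \<in> B" for b
    using that D(1) by (simp add: bij_betw_inv_into_left)
  have hc: "h (\<iota> a) = \<iota> a" for a by (rule D(3))
  have C: "a - b \<in> C" "a * b \<in> C" if "a \<in> C" "b \<in> C" for a b
  proof -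
    have "h (?g a + \<iota> (- 1) * ?g b) = a - b"
      using D(4)[OF g(1)[OF that(1)] D(14)[OF g(1)[OF that(2)]], of "- 1"]
        alg_iso_scal[OF h B g(1)[OF that(2)], of "- 1"] g(2) that by (simp add: iota_minus)
    then show "a - b \<in> C" using D(2)[OF D(9)[OF g(1)[OF that(1)] D(14)[OF g(1)[OF that(2)], of "- 1"]]] by simp
    show "a * b \<in> C"
      using D(2)[OF D(11)[OF g(1)[OF that(1)] g(1)[OF that(2)]]] D(5)[OF g(1)[OF that(1)] g(1)[OF that(2)]]
        g(2) that by simp
  qed
  have "\<iota> a \<in> C" for a using D(2)[OF D(6)[of a]] hc by simp
  then show SC: "subalgebra_on C" using C \<open>\<And>a. \<iota> a \<in> C\<close>[of 1] unfolding subalgebra_on_def subring_on_def by auto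
  show "alg_iso \<iota> C B ?g"
  proof (rule alg_isoI[OF SC bij_betw_inv_into[OF D(1)]])
    show "?g (\<iota> a) = \<iota> a" for a using gh[OF D(6)[of a]] hc by simp
    show "?g (a + b) = ?g a + ?g b" if "a \<in> C" "b \<in> C" for a b
      using gh[OF D(9)[OF g(1)[OF that(1)] g(1)[OF that(2)]]] D(4)[OF g(1)[OF that(1)] g(1)[OF that(2)]]
        g(2) that by simp
    show "?g (a * b) = ?g a * ?g b" if "a \<in> C" "b \<in> C" for a b
      using gh[OF D(11)[OF g(1)[OF that(1)] g(1)[OF that(2)]]] D(5)[OF g(1)[OF that(1)] g(1)[OF that(2)]]
        g(2) that by simp
  qed
qed

lemma alg_iso_comp:
  assumes f: "alg_iso \<iota> A B f" and g: "alg_iso \<iota> B C g" and A: "subalgebra_on A"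
  shows "alg_iso \<iota> A C (g \<circ> f)"
  using alg_isoD[OF f] alg_isoD[OF g]
  by (intro alg_isoI[OF A bij_betw_trans[OF alg_isoD(1)[OF f] alg_isoD(1)[OF g]]]) auto

lemma galg_image:
  assumes B: "subalgebra_on B" and G: "G \<subseteq> B"
    and h: "\<And>c. h (\<iota> c) = \<iota> c"
      "\<And>a b. a \<in> B \<Longrightarrow> b \<in> B \<Longrightarrow> h (a + b) = h a + h b"
      "\<And>a b. a \<in> B \<Longrightarrow> b \<in> B \<Longrightarrow> h (a * b) = h a * h b"
  shows "h ` galg G = galg (h ` G)"
proof (intro equalityI subsetI)
  have sub: "galg G \<subseteq> B" by (rule galg_least[OF B G])
  fix b
  { assume "b \<in> h ` galg G"
    then obtain a where a: "a \<in> galg G" "b = h a" by blast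
    have "h a \<in> galg (h ` G)"
      using a(1)
    proof (induction rule: galg_induct)
      case (scal c)
      show ?case unfolding h(1) by (rule galg_scal)
    next
      case (incl g)
      show ?case by (rule galg_incl[OF imageI[OF incl]])
    next
      case (add a b)
      show ?case unfolding h(2)[OF subsetD[OF sub add.hyps(1)] subsetD[OF sub add.hyps(2)]]
        by (rule galg_add[OF add.IH])
    next
      case (mult a b)
      show ?case unfolding h(3)[OF subsetD[OF sub mult.hyps(1)] subsetD[OF sub mult.hyps(2)]]
        by (rule galg_mult[OF mult.IH])
    qed
    then show "b \<in> galg (h ` G)" unfolding a(2) . }
  { assume "b \<in> galg (h ` G)"
    then show "b \<in> h ` galg G"
    proof (induction rule: galg_induct)
      case (scal c)
      have "h (\<iota> c) \<in> h ` galg G" by (rule imageI[OF galg_scal])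
      then show ?case unfolding h(1) .
    next
      case (incl g)
      then show ?case using galg_incl by blast
    next
      case (add a b)
      then obtain a' b' where ab: "a' \<in> galg G" "a = h a'" "b' \<in> galg G" "b = h b'" by blast
      have "h (a' + b') \<in> h ` galg G" by (rule imageI[OF galg_add[OF ab(1,3)]])
      then show ?case unfolding ab(2,4) h(2)[OF subsetD[OF sub ab(1)] subsetD[OF sub ab(3)]] .
    next
      case (mult a b)
      then obtain a' b' where ab: "a' \<in> galg G" "a = h a'" "b' \<in> galg G" "b = h b'" by blast
      have "h (a' * b') \<in> h ` galg G" by (rule imageI[OF galg_mult[OF ab(1,3)]])
      then show ?case unfolding ab(2,4) h(3)[OF subsetD[OF sub ab(1)] subsetD[OF sub ab(3)]] .
    qed }
qed

lemma alg_iso_restrict: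
  assumes h: "alg_iso \<iota> B C h" and B: "subalgebra_on B" and G: "G \<subseteq> B"
  shows "alg_iso \<iota> (galg G) (galg (h ` G)) h"
proof -
  note D = alg_isoD[OF h]
  have sub: "galg G \<subseteq> B" by (rule galg_least[OF B G])
  have "bij_betw h (galg G) (h ` galg G)"
    using inj_on_subset[OF bij_betw_imp_inj_on[OF D(1)] sub] by (simp add: bij_betw_def)
  then have "bij_betw h (galg G) (galg (h ` G))" using galg_image[OF B G D(3,4,5)] by simp
  then show ?thesis
    by (rule alg_isoI[OF subalgebra_on_galg]) (use D sub in \<open>auto simp: subset_iff\<close>)
qed

text \<open>Makes the choice in \<open>dda_iso\<close> harmless.\<close>

lemma alg_iso_unique:
  assumes f: "alg_iso \<iota> (galg G) C f" and g: "alg_iso \<iota> (galg G) C' g"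
    and eq: "\<And>a. a \<in> G \<Longrightarrow> f a = g a" and a: "a \<in> galg G"
  shows "f a = g a"
  using a
proof (induction rule: galg_induct)
  case (scal c)
  show ?case unfolding alg_isoD(3)[OF f] alg_isoD(3)[OF g] ..
next
  case (add a b)
  then show ?case using alg_isoD(4)[OF f add.hyps] alg_isoD(4)[OF g add.hyps] by simp
next
  case (mult a b)
  then show ?case using alg_isoD(5)[OF f mult.hyps] alg_isoD(5)[OF g mult.hyps] by simp
qed (rule eq)

lemma ore_extension_free:
  assumes ext: "ore_extension \<iota> A x \<sigma> \<delta> S" and A: "subalgebra_on A"
    and c: "\<And>k. c k \<in> A" and sum: "(\<Sum>k\<le>n. c k * x ^ k) = 0"
  shows "c n = 0"
proof -
  define f where "f c = Sum_any (\<lambda>n. c n * x ^ n)" for c :: "nat \<Rightarrow> 'f"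
  define D where "D = {c :: nat \<Rightarrow> 'f. range c \<subseteq> A \<and> finite {n. c n \<noteq> 0}}"
  have inj: "inj_on f D"
    using ext unfolding ore_extension_def f_def D_def by (simp add: bij_betw_def)
  \<comment> \<open>The sequence \<open>c\<close> may be nonzero beyond \<open>n\<close>; truncation
    brings it into the domain of the bijection.\<close>
  define c' where "c' k = (if k \<le> n then c k else 0)" for k
  have fin: "finite {k. c' k \<noteq> 0}" by (rule finite_subset[of _ "{..n}"]) (auto simp: c'_def)
  then have "c' \<in> D" using c subalgebra_onD(2)[OF A] by (auto simp: D_def c'_def)
  moreover have "(\<lambda>_. 0) \<in> D" using subalgebra_onD(2)[OF A] by (simp add: D_def)
  moreover have "f c' = f (\<lambda>_. 0)"
  proof -
    have "f c' = (\<Sum>k\<le>n. c' k * x ^ k)"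
      unfolding f_def by (rule Sum_any.expand_superset) (auto simp: c'_def)
    also have "\<dots> = (\<Sum>k\<le>n. c k * x ^ k)" by (rule sum.cong) (auto simp: c'_def)
    finally show ?thesis using sum by (simp add: f_def)
  qed
  ultimately have "c' = (\<lambda>_. 0)" using inj_onD[OF inj] by blast
  then have "c' n = 0" by simp
  then show ?thesis by (simp add: c'_def)
qed

text \<open>Every identity is checked after applying an injective isomorphism. Those within
  \<open>B\<close> use \<open>h0\<close>; the Ore relation and freeness involve \<open>x\<close> and
  use \<open>h\<close>, defined on the larger algebra and equal to \<open>h0\<close> on
  \<open>B\<close>.\<close>

lemma transport_deletion_step:
  assumes B: "subalgebra_on B" and h0: "alg_iso \<iota> B A h0"
    and S': "subalgebra_on S'" and h: "alg_iso \<iota> S' S h"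
    and BS: "B \<subseteq> S'" and x: "x \<in> S'" and hh: "\<And>b. b \<in> B \<Longrightarrow> h b = h0 b"
    and ext: "ore_extension \<iota> A (h x) \<sigma> \<delta> S"
    and q: "q \<noteq> 0" "q \<noteq> 1"
    and hsd: "higher_skew_derivation \<iota> A q \<sigma> \<delta> d"
    and nilp: "loc_nilpotent A d" and iter: "iterative \<iota> A q d"
    and tr: "\<And>f a. tr f a = inv_into B h0 (f (h0 a))"
  shows "deletion_step \<iota> B x (tr \<sigma>) (tr \<delta>) (\<lambda>n. tr (d n)) q"
proof -
  note BD = subalgebra_onD[OF B] and SD = subalgebra_onD[OF S']
  note H = alg_isoD[OF h] and H0 = alg_isoD[OF h0]
  note A = alg_iso_inv(2)[OF h0 B]
  note AD = subalgebra_onD[OF A]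
  have iso: "alg_iso \<iota> A A \<sigma>" using ext by (simp add: ore_extension_def)
  have inj0: "a = b" if "a \<in> B" "b \<in> B" "h0 a = h0 b" for a b
    using inj_onD[OF bij_betw_imp_inj_on[OF H0(1)] that(3,1,2)] .
  have inj: "a = b" if "a \<in> S'" "b \<in> S'" "h a = h b" for a b
    using inj_onD[OF bij_betw_imp_inj_on[OF H(1)] that(3,1,2)] .
  have trB: "tr f a \<in> B" and h0tr: "h0 (tr f a) = f (h0 a)" if "f \<in> A \<rightarrow> A" "a \<in> B" for f a
  proof -
    have "f (h0 a) \<in> A" using that H0(2) by blast
    then show "tr f a \<in> B" "h0 (tr f a) = f (h0 a)"
      unfolding tr using H0(1) by (simp_all add: bij_betw_inv_into_right bij_betw_def inv_into_into)
  qed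
  have sA: "\<sigma> \<in> A \<rightarrow> A" using alg_isoD(2)[OF iso] by blast
  have lin_d: "linear_on \<iota> A (d n)" for n using hsd by (simp add: higher_skew_derivation_def)
  have dA: "d n \<in> A \<rightarrow> A" for n using lin_d[of n] by (simp add: linear_on_def)
  have lin_delta: "linear_on \<iota> A \<delta>" using ext by (simp add: ore_extension_def skew_derivation_def)
  have deltaA: "\<delta> \<in> A \<rightarrow> A" using lin_delta by (simp add: linear_on_def)
  have tr_iso: "alg_iso \<iota> B B (tr \<sigma>)"
  proof -
    have "tr \<sigma> = inv_into B h0 \<circ> (\<sigma> \<circ> h0)" by (simp add: fun_eq_iff tr)
    then show ?thesis
      using alg_iso_comp[OF alg_iso_comp[OF h0 iso B] alg_iso_inv(1)[OF h0 B] B] by simp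
  qed
  have lin_tr: "linear_on \<iota> B (tr f)" if f: "linear_on \<iota> A f" for f
  proof -
    have fA: "f \<in> A \<rightarrow> A" using f by (simp add: linear_on_def)
    show ?thesis
      unfolding linear_on_def
    proof (intro conjI ballI allI funcsetI)
      show "tr f a \<in> B" if "a \<in> B" for a by (rule trB[OF fA that])
      show "tr f (a + b) = tr f a + tr f b" if ab: "a \<in> B" "b \<in> B" for a b
      proof (rule inj0[OF trB[OF fA BD(4)[OF ab]] BD(4)[OF trB[OF fA ab(1)] trB[OF fA ab(2)]]])
        show "h0 (tr f (a + b)) = h0 (tr f a + tr f b)"
          unfolding h0tr[OF fA BD(4)[OF ab]] H0(4)[OF trB[OF fA ab(1)] trB[OF fA ab(2)]]
            h0tr[OF fA ab(1)] h0tr[OF fA ab(2)] H0(4)[OF ab]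
          using f H0(2)[OF ab(1)] H0(2)[OF ab(2)] by (simp add: linear_on_def)
      qed
      show "tr f (\<iota> c * a) = \<iota> c * tr f a" if a: "a \<in> B" for c a
      proof (rule inj0[OF trB[OF fA BD(9)[OF a]] BD(9)[OF trB[OF fA a]]])
        show "h0 (tr f (\<iota> c * a)) = h0 (\<iota> c * tr f a)"
          unfolding h0tr[OF fA BD(9)[OF a]] alg_iso_scal[OF h0 B trB[OF fA a]] h0tr[OF fA a]
            alg_iso_scal[OF h0 B a]
          using f H0(2)[OF a] by (simp add: linear_on_def)
      qed
    qed
  qed
  have pow: "(tr \<sigma> ^^ k) a \<in> B \<and> h0 ((tr \<sigma> ^^ k) a) = (\<sigma> ^^ k) (h0 a)" if "a \<in> B" for k a
    using that by (induction k) (simp_all add: trB[OF sA] h0tr[OF sA])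
  have hsd': "higher_skew_derivation \<iota> B q (tr \<sigma>) (tr \<delta>) (\<lambda>n. tr (d n))"
    unfolding higher_skew_derivation_def
  proof (intro conjI allI ballI)
    show "linear_on \<iota> B (tr (d n))" for n by (rule lin_tr[OF lin_d])
    fix r assume r: "r \<in> B"
    show "tr (d 0) r = r"
      by (rule inj0[OF trB[OF dA r] r])
         (use hsd H0(2)[OF r] h0tr[OF dA r] in \<open>simp add: higher_skew_derivation_def\<close>)
    show "tr (d 1) r = tr \<delta> r"
      using hsd H0(2)[OF r] by (simp add: higher_skew_derivation_def tr)
    show "tr (d n) (tr \<sigma> r) = \<iota> (q ^ n) * tr \<sigma> (tr (d n) r)" for n
    proof (rule inj0[OF trB[OF dA trB[OF sA r]] BD(9)[OF trB[OF sA trB[OF dA r]]]])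
      show "h0 (tr (d n) (tr \<sigma> r)) = h0 (\<iota> (q ^ n) * tr \<sigma> (tr (d n) r))"
        unfolding h0tr[OF dA trB[OF sA r]] h0tr[OF sA r] alg_iso_scal[OF h0 B trB[OF sA trB[OF dA r]]]
          h0tr[OF sA trB[OF dA r]] h0tr[OF dA r]
        using hsd H0(2)[OF r] by (simp add: higher_skew_derivation_def)
    qed
    fix n s assume s: "s \<in> B"
    have mem: "(tr \<sigma> ^^ (n - i)) (tr (d i) r) * tr (d (n - i)) s \<in> B" for i
      by (rule BD(6)[OF conjunct1[OF pow[OF trB[OF dA r]]] trB[OF dA s]])
    show "tr (d n) (r * s) = (\<Sum>i=0..n. (tr \<sigma> ^^ (n - i)) (tr (d i) r) * tr (d (n - i)) s)"
    proof (rule inj0[OF trB[OF dA BD(6)[OF r s]] alg_iso_sum(2)[OF h0 B mem]])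
      have "h0 ((tr \<sigma> ^^ (n - i)) (tr (d i) r) * tr (d (n - i)) s)
        = (\<sigma> ^^ (n - i)) (d i (h0 r)) * d (n - i) (h0 s)" for i
        unfolding H0(5)[OF conjunct1[OF pow[OF trB[OF dA r]]] trB[OF dA s]]
          conjunct2[OF pow[OF trB[OF dA r]]] h0tr[OF dA r] h0tr[OF dA s] ..
      then show "h0 (tr (d n) (r * s)) = h0 (\<Sum>i=0..n. (tr \<sigma> ^^ (n - i)) (tr (d i) r) * tr (d (n - i)) s)"
        unfolding alg_iso_sum(1)[OF h0 B mem] h0tr[OF dA BD(6)[OF r s]] H0(5)[OF r s]
        using hsd H0(2)[OF r] H0(2)[OF s] by (simp add: higher_skew_derivation_def)
    qed
  qed
  have tr_0: "tr f a = 0" if "f \<in> A \<rightarrow> A" "a \<in> B" "f (h0 a) = 0" for f a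
    by (rule inj0[OF trB[OF that(1,2)] BD(2)]) (use h0tr[OF that(1,2)] that(3) H0(3)[of 0] in simp)
  have nilp': "loc_nilpotent B (\<lambda>n. tr (d n))"
    unfolding loc_nilpotent_def
  proof
    fix a assume a: "a \<in> B"
    then obtain m where "\<And>n. n \<ge> m \<Longrightarrow> d n (h0 a) = 0"
      using nilp H0(2)[OF a] unfolding loc_nilpotent_def by blast
    then show "\<exists>m. \<forall>n\<ge>m. tr (d n) a = 0" using tr_0[OF dA a] by blast
  qed
  have iter': "iterative \<iota> B q (\<lambda>n. tr (d n))"
    unfolding iterative_def
  proof (intro allI ballI)
    fix n m r assume r: "r \<in> B"
    show "tr (d n) (tr (d m) r) = \<iota> (qbinom q (n + m) m) * tr (d (n + m)) r"
    proof (rule inj0[OF trB[OF dA trB[OF dA r]] BD(9)[OF trB[OF dA r]]])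
      show "h0 (tr (d n) (tr (d m) r)) = h0 (\<iota> (qbinom q (n + m) m) * tr (d (n + m)) r)"
        unfolding h0tr[OF dA trB[OF dA r]] h0tr[OF dA r] alg_iso_scal[OF h0 B trB[OF dA r]]
        using iter H0(2)[OF r] by (simp add: iterative_def)
    qed
  qed
  have ore: "x * b = tr \<sigma> b * x + tr \<delta> b" if b: "b \<in> B" for b
  proof -
    have b': "b \<in> S'" "tr \<sigma> b \<in> S'" "tr \<delta> b \<in> S'" using BS b trB[OF sA b] trB[OF deltaA b] by auto
    show ?thesis
    proof (rule inj[OF SD(6)[OF x b'(1)] SD(4)[OF SD(6)[OF b'(2) x] b'(3)]])
      show "h (x * b) = h (tr \<sigma> b * x + tr \<delta> b)"
        unfolding H(5)[OF x b'(1)] H(4)[OF SD(6)[OF b'(2) x] b'(3)] H(5)[OF b'(2) x]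
          hh[OF b] hh[OF trB[OF sA b]] hh[OF trB[OF deltaA b]] h0tr[OF sA b] h0tr[OF deltaA b]
        using ext H0(2)[OF b] by (simp add: ore_extension_def)
    qed
  qed
  have free: "c n = 0" if c: "\<And>k. c k \<in> B" and sum: "(\<Sum>k\<le>n. c k * x ^ k) = 0" for c n
  proof -
    have cS: "c k * x ^ k \<in> S'" for k using SD(6)[OF subsetD[OF BS c] SD(8)[OF x]] .
    have "(\<Sum>k\<le>n. h0 (c k) * h x ^ k) = (\<Sum>k\<le>n. h (c k * x ^ k))"
      using H(5)[OF subsetD[OF BS c] SD(8)[OF x]] hh[OF c] alg_iso_power[OF h S' x] by simp
    also have "\<dots> = h (\<Sum>k\<le>n. c k * x ^ k)" by (rule alg_iso_sum(1)[OF h S' cS, symmetric])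
    also have "\<dots> = 0" unfolding sum using H(3)[of 0] by simp
    finally have "h0 (c n) = 0" by (rule ore_extension_free[OF ext A H0(2)[OF c]])
    then have "h0 (c n) = h0 0" using H0(3)[of 0] by simp
    then show ?thesis by (rule inj0[OF c BD(2)])
  qed
  \<comment> \<open>If \<open>x\<close> were 0, then 1 * x = 0 would be a relation with top
    coefficient 1.\<close>
  have "x \<noteq> 0"
  proof
    assume "x = 0"
    then have "(\<Sum>k\<le>1. (if k = 1 then 1 else 0) * x ^ k) = 0" by simp
    then have "(if (1::nat) = 1 then 1 else 0) = (0::'f)"
      by (rule free[rotated]) (use BD(2,3) in simp)
    then show False by simp
  qed
  then show ?thesis
    by unfold_locales (use B tr_iso q hsd' nilp' iter' ore free in blast)+
qed

end

section \<open>The deleting derivations algorithm\<close>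

locale qna =
  fixes Q :: "('k::field, 'f::division_ring) qna_data"
  assumes qna: "quantum_nilpotent_algebra Q"
begin

sublocale scalars "scal Q"
  using qna unfolding quantum_nilpotent_algebra_def by unfold_locales blast

abbreviation \<iota> where "\<iota> \<equiv> scal Q"
abbreviation N where "N \<equiv> ngens Q"

lemma subalg_eq: "subalg Q i = galg (gen Q ` {1..i})"
  by (simp add: subalg_def)

lemma subalgebra_on_subalg: "subalgebra_on (subalg Q i)"
  unfolding subalg_eq by (rule subalgebra_on_galg)

context
  fixes i assumes i: "i \<in> {2..N}"
begin

lemma ext: "ore_extension \<iota> (subalg Q (i - 1)) (gen Q i) (sigma Q i) (delta Q i) (subalg Q i)"
  using qna i unfolding quantum_nilpotent_algebra_def by blast

lemma sigma_gen: "l \<in> {1..<i} \<Longrightarrow> sigma Q i (gen Q l) = \<iota> (lam Q i l) * gen Q l"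
  using qna i unfolding quantum_nilpotent_algebra_def by blast

lemma qpar: "qpar Q i \<noteq> 0" "qpar Q i \<noteq> 1"
  using qna i unfolding quantum_nilpotent_algebra_def by blast+

lemma hder: "higher_skew_derivation \<iota> (subalg Q (i - 1)) (qpar Q i) (sigma Q i) (delta Q i) (hder Q i)"
  "loc_nilpotent (subalg Q (i - 1)) (hder Q i)"
  "iterative \<iota> (subalg Q (i - 1)) (qpar Q i) (hder Q i)"
  using qna i unfolding quantum_nilpotent_algebra_def by blast+

lemma sigma_hder: "l \<in> {i + 1..N} \<Longrightarrow> a \<in> subalg Q (i - 1) \<Longrightarrow>
  sigma Q l (hder Q i n a) = \<iota> (lam Q l i ^ n) * hder Q i n (sigma Q l a)"
  using qna i unfolding quantum_nilpotent_algebra_def by blast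

lemma sigma_iso: "alg_iso \<iota> (subalg Q (i - 1)) (subalg Q (i - 1)) (sigma Q i)"
  using ext by (simp add: ore_extension_def)

end

lemma lam: "i \<in> {1..N} \<Longrightarrow> l \<in> {1..N} \<Longrightarrow> lam Q i l \<noteq> 0"
  "i \<in> {1..N} \<Longrightarrow> l \<in> {1..N} \<Longrightarrow> lam Q i l * lam Q l i = 1"
proof -
  assume il: "i \<in> {1..N}" "l \<in> {1..N}"
  have *: "lam Q i l \<noteq> 0" "lam Q i l = inverse (lam Q l i)" if "i \<in> {1..N}" "l \<in> {1..N}" for i l
    using qna that unfolding quantum_nilpotent_algebra_def by blast+
  show "lam Q i l \<noteq> 0" by (rule *(1)[OF il])
  show "lam Q i l * lam Q l i = 1" using *(1)[OF il(2,1)] *(2)[OF il] by simp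
qed

text \<open>
  The second and third clauses say that for \<open>i \<ge> m\<close> the algebra generated by
  \<open>x\<^sub>1, \<dots>, x\<^sub>i\<close> is an Ore extension of the one generated by \<open>x\<^sub>1, \<dots>, x\<^sub>i\<^sub>-\<^sub>1\<close>.
\<close>

definition iterated_ore :: "nat \<Rightarrow> (nat \<Rightarrow> 'f) \<Rightarrow> bool" where
  "iterated_ore m x \<longleftrightarrow>
     (\<exists>h. alg_iso \<iota> (galg (x ` {1..m - 1})) (subalg Q (m - 1)) h \<and> (\<forall>i\<in>{1..m - 1}. h (x i) = gen Q i))
     \<and> (\<forall>i\<in>{m..N}. \<forall>l\<in>{1..<i}. x i * x l = \<iota> (lam Q i l) * (x l * x i))
     \<and> (\<forall>i\<in>{m..N}. x i \<noteq> 0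
          \<and> (\<forall>r\<in>galg (x ` {1..i}). r * x i \<in> galg (x ` {1..i - 1}) \<longrightarrow> r = 0))"

text \<open>At \<open>N + 1\<close> the two clauses on high generators range over an empty set, and
  the identity is the isomorphism.\<close>

lemma iterated_ore_top: "iterated_ore (N + 1) (gen Q)"
proof -
  have "alg_iso \<iota> (galg (gen Q ` {1..N})) (subalg Q N) id"
    unfolding subalg_eq by (rule alg_isoI[OF subalgebra_on_galg]) auto
  then show ?thesis unfolding iterated_ore_def by auto
qed

end

locale qna_step = qna Q for Q :: "('k::field, 'f::division_ring) qna_data" +
  fixes j :: nat and x :: "nat \<Rightarrow> 'f"
  assumes j: "j \<in> {2..ngens Q}"
    and inv: "iterated_ore (j + 1) x"
begin

abbreviation y where "y \<equiv> dda_step Q j x"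
abbreviation B where "B \<equiv> dda_low Q j x"
abbreviation h0 where "h0 \<equiv> dda_iso Q j x"
abbreviation tr where "tr \<equiv> dda_transport Q j x"

lemma B_eq: "B = galg (x ` {1..j - 1})"
  by (simp add: dda_low_def)

lemma inv_iso: "\<exists>h. alg_iso \<iota> (galg (x ` {1..j})) (subalg Q j) h \<and> (\<forall>i\<in>{1..j}. h (x i) = gen Q i)"
  and inv_comm: "i \<in> {j + 1..N} \<Longrightarrow> l \<in> {1..<i} \<Longrightarrow> x i * x l = \<iota> (lam Q i l) * (x l * x i)"
  and inv_nz: "i \<in> {j + 1..N} \<Longrightarrow> x i \<noteq> 0"
  and inv_free: "i \<in> {j + 1..N} \<Longrightarrow> r \<in> galg (x ` {1..i}) \<Longrightarrow> r * x i \<in> galg (x ` {1..i - 1}) \<Longrightarrow> r = 0"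
  using inv unfolding iterated_ore_def by (simp_all only: add_diff_cancel_right') blast+

lemma h0: "alg_iso \<iota> B (subalg Q (j - 1)) h0" "i \<in> {1..j - 1} \<Longrightarrow> h0 (x i) = gen Q i"
  and step: "deletion_step \<iota> B (x j) (tr (sigma Q j)) (tr (delta Q j)) (\<lambda>n. tr (hder Q j n)) (qpar Q j)"
proof -
  obtain h where h: "alg_iso \<iota> (galg (x ` {1..j})) (subalg Q j) h" "\<And>i. i \<in> {1..j} \<Longrightarrow> h (x i) = gen Q i"
    using inv_iso by blast
  have sub: "x ` {1..j - 1} \<subseteq> galg (x ` {1..j})" using galg_incl[of _ "x ` {1..j}"] by auto
  have "h ` x ` {1..j - 1} = gen Q ` {1..j - 1}"
    unfolding image_image by (rule image_cong) (use h(2) in auto)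
  then have hB: "alg_iso \<iota> B (subalg Q (j - 1)) h"
    using alg_iso_restrict[OF h(1) subalgebra_on_galg sub] unfolding B_eq subalg_eq by simp
  have "\<exists>h. alg_iso \<iota> B (subalg Q (j - 1)) h \<and> (\<forall>i\<in>{1..j - 1}. h (x i) = gen Q i)"
    by (intro exI[of _ h] conjI ballI hB h(2)) auto
  then have *: "alg_iso \<iota> B (subalg Q (j - 1)) h0 \<and> (\<forall>i\<in>{1..j - 1}. h0 (x i) = gen Q i)"
    unfolding dda_iso_def by (rule someI_ex)
  then show h0: "alg_iso \<iota> B (subalg Q (j - 1)) h0" and h0x: "\<And>i. i \<in> {1..j - 1} \<Longrightarrow> h0 (x i) = gen Q i"
    by blast+
  have hh: "h b = h0 b" if "b \<in> B" for b
    by (rule alg_iso_unique[OF hB[unfolded B_eq] h0[unfolded B_eq]]) (use h(2) h0x that B_eq in auto)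
  have xj: "x j \<in> galg (x ` {1..j})" using j by (intro galg_incl) auto
  have hx: "h (x j) = gen Q j" using h(2) j by simp
  have Bsub: "B \<subseteq> galg (x ` {1..j})" unfolding B_eq by (rule galg_least[OF subalgebra_on_galg sub])
  show "deletion_step \<iota> B (x j) (tr (sigma Q j)) (tr (delta Q j)) (\<lambda>n. tr (hder Q j n)) (qpar Q j)"
    by (rule transport_deletion_step[OF _ h0 subalgebra_on_galg h(1) Bsub xj hh _ qpar[OF j] hder[OF j]])
       (use ext[OF j] hx subalgebra_on_galg B_eq in \<open>simp_all add: dda_transport_def\<close>)
qed

sublocale D: deletion_step \<iota> B "x j" "tr (sigma Q j)" "tr (delta Q j)" "\<lambda>n. tr (hder Q j n)" "qpar Q j"
  by (rule step)

lemma y_low: "l \<in> {1..j - 1} \<Longrightarrow> y l = D.\<theta> (x l)"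
  by (auto simp: dda_step_def D.\<theta>_def D.e_def D.\<tau>_def del_coeff_def)

lemma y_high: "j \<le> l \<Longrightarrow> y l = x l"
  by (simp add: dda_step_def)

lemma x_low: "l \<in> {1..j - 1} \<Longrightarrow> x l \<in> B"
  unfolding B_eq by (rule galg_incl) simp

lemma h0_mem: "b \<in> B \<Longrightarrow> h0 b \<in> subalg Q (j - 1)"
  by (rule alg_isoD(2)[OF h0(1)])

lemma inv_h0: "b \<in> B \<Longrightarrow> inv_into B h0 (h0 b) = b"
  by (rule bij_betw_inv_into_left[OF alg_isoD(1)[OF h0(1)]])

lemma inv_h0_iso: "alg_iso \<iota> (subalg Q (j - 1)) B (inv_into B h0)"
  by (rule alg_iso_inv(1)[OF h0(1) D.B])

lemma inv_h0_scal: "a \<in> subalg Q (j - 1) \<Longrightarrow> inv_into B h0 (\<iota> c * a) = \<iota> c * inv_into B h0 a"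
  by (rule alg_iso_scal[OF inv_h0_iso subalgebra_on_subalg])

lemma tr_sigma_x: "l \<in> {1..j - 1} \<Longrightarrow> tr (sigma Q j) (x l) = \<iota> (lam Q j l) * x l"
proof -
  assume l: "l \<in> {1..j - 1}"
  have "l \<in> {1..<j}" using l j by auto
  then have "sigma Q j (h0 (x l)) = \<iota> (lam Q j l) * h0 (x l)" using sigma_gen[OF j] h0(2)[OF l] by simp
  then show ?thesis
    unfolding dda_transport_def using inv_h0_scal[OF h0_mem[OF x_low[OF l]]] inv_h0[OF x_low[OF l]] by simp
qed

lemma image_y_low: "y ` {1..j - 1} = D.\<theta> ` x ` {1..j - 1}"
  unfolding image_image by (rule image_cong) (use y_low in auto)

lemma galg_y_low: "galg (y ` {1..j - 1}) = D.\<theta> ` B"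
proof -
  have "x ` {1..j - 1} \<subseteq> B" using x_low by blast
  then have "D.\<theta> ` galg (x ` {1..j - 1}) = galg (D.\<theta> ` x ` {1..j - 1})"
    by (rule galg_image[OF D.B]) (auto simp: D.theta_add D.theta_mult)
  then show ?thesis unfolding image_y_low B_eq by simp
qed

lemma comm_j: "l \<in> {1..j - 1} \<Longrightarrow> x j * y l = \<iota> (lam Q j l) * (y l * x j)"
  unfolding y_low D.x_theta[OF x_low] tr_sigma_x
  by (simp add: D.theta_mult x_low D.BD(1) mult.assoc)

text \<open>The automorphism scales generators, so it preserves the smaller algebra, the only place
  where transport along \<open>h0\<close> is meaningful.\<close>

lemma sigma_high_mem:
  assumes i: "i \<in> {j + 1..N}" and a: "a \<in> subalg Q (j - 1)"
  shows "sigma Q i a \<in> subalg Q (j - 1)"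
proof -
  have i2: "i \<in> {2..N}" using i j by auto
  note S = alg_isoD[OF sigma_iso[OF i2]]
  have "gen Q ` {1..j - 1} \<subseteq> gen Q ` {1..i - 1}" using i by auto
  then have sub: "subalg Q (j - 1) \<subseteq> subalg Q (i - 1)" unfolding subalg_eq by (rule galg_mono)
  from a show ?thesis
    unfolding subalg_eq
  proof (induction rule: galg_induct)
    case (scal c)
    show ?case unfolding S(3) by (rule galg_scal)
  next
    case (incl g)
    then obtain l where l: "g = gen Q l" "l \<in> {1..j - 1}" by blast
    then have "l \<in> {1..<i}" using i by auto
    then show ?case unfolding l(1) sigma_gen[OF i2 \<open>l \<in> {1..<i}\<close>]
      using l(2) by (intro galg_mult galg_scal galg_incl imageI)
  next
    case (add a b)
    have "a \<in> subalg Q (i - 1)" "b \<in> subalg Q (i - 1)"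
      using add.hyps sub unfolding subalg_eq by blast+
    then show ?case unfolding S(4)[OF \<open>a \<in> subalg Q (i - 1)\<close> \<open>b \<in> subalg Q (i - 1)\<close>]
      by (intro galg_add add.IH)
  next
    case (mult a b)
    have "a \<in> subalg Q (i - 1)" "b \<in> subalg Q (i - 1)"
      using mult.hyps sub unfolding subalg_eq by blast+
    then show ?case unfolding S(5)[OF \<open>a \<in> subalg Q (i - 1)\<close> \<open>b \<in> subalg Q (i - 1)\<close>]
      by (intro galg_mult mult.IH)
  qed
qed

lemma x_high_base:
  assumes i: "i \<in> {j + 1..N}" and b: "b \<in> B"
  shows "x i * b = tr (sigma Q i) b * x i"
proof -
  have i2: "i \<in> {2..N}" using i j by auto
  note S = alg_isoD[OF sigma_iso[OF i2]] and H = alg_isoD[OF h0(1)] and G = alg_isoD[OF inv_h0_iso]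
  have "gen Q ` {1..j - 1} \<subseteq> gen Q ` {1..i - 1}" using i by auto
  then have sub: "subalg Q (j - 1) \<subseteq> subalg Q (i - 1)" unfolding subalg_eq by (rule galg_mono)
  from b show ?thesis
    unfolding B_eq
  proof (induction rule: galg_induct)
    case (scal c)
    show ?case unfolding dda_transport_def H(3) S(3) G(3) by (rule iota_central[symmetric])
  next
    case (incl g)
    then obtain l where l: "g = x l" "l \<in> {1..j - 1}" by blast
    then have li: "l \<in> {1..<i}" using i by auto
    have "tr (sigma Q i) (x l) = \<iota> (lam Q i l) * x l"
      unfolding dda_transport_def h0(2)[OF l(2)] sigma_gen[OF i2 li]
      using inv_h0_scal[OF h0_mem[OF x_low[OF l(2)]]] inv_h0[OF x_low[OF l(2)]] h0(2)[OF l(2)] by simp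
    then show ?case unfolding l(1) using inv_comm[OF i li] by (simp add: mult.assoc)
  next
    case (add a b)
    have ab: "a \<in> B" "b \<in> B" using add.hyps unfolding B_eq .
    note m = h0_mem[OF ab(1)] h0_mem[OF ab(2)]
    have "tr (sigma Q i) (a + b) = tr (sigma Q i) a + tr (sigma Q i) b"
      unfolding dda_transport_def H(4)[OF ab] S(4)[OF subsetD[OF sub m(1)] subsetD[OF sub m(2)]]
      by (rule G(4)[OF sigma_high_mem[OF i m(1)] sigma_high_mem[OF i m(2)]])
    then show ?case by (simp only: distrib_left distrib_right add.IH)
  next
    case (mult a b)
    have ab: "a \<in> B" "b \<in> B" using mult.hyps unfolding B_eq .
    note m = h0_mem[OF ab(1)] h0_mem[OF ab(2)]
    have "tr (sigma Q i) (a * b) = tr (sigma Q i) a * tr (sigma Q i) b"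
      unfolding dda_transport_def H(5)[OF ab] S(5)[OF subsetD[OF sub m(1)] subsetD[OF sub m(2)]]
      by (rule G(5)[OF sigma_high_mem[OF i m(1)] sigma_high_mem[OF i m(2)]])
    moreover have "x i * (a * b) = tr (sigma Q i) a * (x i * b)"
      using mult.IH(1) by (simp only: mult.assoc[symmetric])
    ultimately show ?case by (simp only: mult.IH(2) mult.assoc)
  qed
qed

end

section \<open>Commutation, localization and freeness for the new generators\<close>

lemma (in scalars) skew_power:
  assumes "x * g = \<iota> t * (g * x)"
  shows "x ^ n * g = \<iota> (t ^ n) * (g * x ^ n)"
proof (induction n)
  case (Suc n)
  have "x ^ Suc n * g = x * (x ^ n * g)" by (simp only: power_Suc mult.assoc)
  also have "\<dots> = \<iota> (t ^ n) * (x * g * x ^ n)"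
    unfolding Suc by (simp only: iota_left_commute[of x] mult.assoc)
  also have "\<dots> = \<iota> (t ^ Suc n) * (g * x ^ Suc n)"
    unfolding assms by (simp only: power_Suc2[of t] power_Suc[of x] iota_mult mult.assoc)
  finally show ?case .
qed simp

lemma (in scalars) skew_ore:
  assumes "x * g = \<iota> t * (g * x)" "t \<noteq> 0" "g \<in> galg G"
  shows "\<exists>r\<in>galg G. \<exists>k. g * x ^ k = x ^ n * r"
proof -
  have "x ^ n * (\<iota> (inverse (t ^ n)) * g) = \<iota> (inverse (t ^ n)) * (\<iota> (t ^ n) * (g * x ^ n))"
    unfolding iota_left_commute[of "x ^ n"] skew_power[OF assms(1)] ..
  also have "\<dots> = g * x ^ n" using assms(2) by (intro iota_inverse(1)) simp
  finally have "g * x ^ n = x ^ n * (\<iota> (inverse (t ^ n)) * g)" by (rule sym)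
  then show ?thesis using galg_mult[OF galg_scal assms(3)] by blast
qed

context qna_step
begin

lemma x_high_inverse:
  assumes i: "i \<in> {j + 1..N}"
  shows "\<iota> (lam Q i j ^ n) * (x i * D.u ^ n) = D.u ^ n * x i"
proof -
  have "j \<in> {1..<i}" using i j by auto
  then have "D.u * (x i * x j) * D.u = D.u * (\<iota> (lam Q i j) * (x j * x i)) * D.u"
    using inv_comm[OF i] by simp
  also have "\<dots> = \<iota> (lam Q i j) * (x i * D.u)"
    unfolding iota_left_commute[of D.u] by (simp only: mult.assoc D.xu)
  finally have "D.u * x i = \<iota> (lam Q i j) * (x i * D.u)"
    by (simp only: mult.assoc D.xu mult_1_right)
  from skew_power[OF this, of n] show ?thesis by (rule sym)
qed

text \<open>Passing \<open>x i\<close> across the coefficient of degree -n produces the extra factor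
  \<open>lam Q i j ^ n\<close>, by compatibility of the automorphism with \<open>hder\<close>.
  Passing it across \<open>D.u ^ n\<close> removes this factor, so every summand of
  \<open>y l\<close> obeys the same relation.\<close>

lemma comm_high:
  assumes i: "i \<in> {j + 1..N}" and l: "l \<in> {1..j - 1}"
  shows "x i * y l = \<iota> (lam Q i l) * (y l * x i)"
proof -
  have i2: "i \<in> {2..N}" and li: "l \<in> {1..<i}" and lj: "l \<in> {1..N}" "j \<in> {1..N}" using i j l by auto
  note b = x_low[OF l]
  have Dtau: "D.\<tau> (x l) = \<iota> (inverse (lam Q j l)) * x l"
  proof -
    have "tr (sigma Q j) (\<iota> (inverse (lam Q j l)) * x l) = x l"
      unfolding D.sigma_scal[OF b] tr_sigma_x[OF l] by (rule iota_inverse(1)[OF lam(1)[OF lj(2,1)]])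
    then show ?thesis using D.tau_sigma[OF D.BD(9)[OF b]] by metis
  qed
  \<comment> \<open>Only proportionality to \<open>x l\<close> matters: it reduces
    \<open>D.e n (x l)\<close> to a multiple of the transported \<open>hder Q j n\<close> at
    \<open>x l\<close>.\<close>
  have tau_pow: "\<exists>t. (D.\<tau> ^^ n) (x l) = \<iota> t * x l" for n
  proof (induction n)
    case 0
    show ?case by (rule exI[of _ 1]) simp
  next
    case (Suc n)
    then obtain t where "(D.\<tau> ^^ n) (x l) = \<iota> t * x l" by blast
    then have "(D.\<tau> ^^ Suc n) (x l) = \<iota> (t * inverse (lam Q j l)) * x l"
      using D.tau_mult[OF D.BD(1) b, of t] by (simp add: D.tau_scal Dtau iota_mult mult.assoc)
    then show ?case by blast
  qed
  have x_e: "x i * D.e n (x l) = \<iota> (lam Q i l) * (D.e n (x l) * (\<iota> (lam Q i j ^ n) * x i))" for n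
  proof -
    obtain t where t: "(D.\<tau> ^^ n) (x l) = \<iota> t * x l" using tau_pow by blast
    define z where "z = tr (hder Q j n) (x l)"
    have e: "D.e n (x l) = \<iota> t * z" unfolding D.e_def t z_def by (rule D.d_scal[OF b])
    have X: "gen Q l \<in> subalg Q (j - 1)" using h0_mem[OF b] h0(2)[OF l] by simp
    have lin: "linear_on \<iota> (subalg Q (j - 1)) (hder Q j n)"
      using hder(1)[OF j] by (simp add: higher_skew_derivation_def)
    have m: "hder Q j n (gen Q l) \<in> subalg Q (j - 1)" using lin X unfolding linear_on_def by blast
    have zi: "z = inv_into B h0 (hder Q j n (gen Q l))" unfolding z_def dda_transport_def h0(2)[OF l] ..
    have h0z: "h0 z = hder Q j n (gen Q l)"
      unfolding zi by (rule bij_betw_inv_into_right[OF alg_isoD(1)[OF h0(1)] m])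
    have "sigma Q i (h0 z) = \<iota> (lam Q i j ^ n) * hder Q j n (\<iota> (lam Q i l) * gen Q l)"
      unfolding h0z sigma_hder[OF j i X] sigma_gen[OF i2 li] ..
    also have "hder Q j n (\<iota> (lam Q i l) * gen Q l) = \<iota> (lam Q i l) * hder Q j n (gen Q l)"
      using lin X unfolding linear_on_def by blast
    finally have "sigma Q i (h0 z) = \<iota> (lam Q i j ^ n * lam Q i l) * hder Q j n (gen Q l)"
      by (simp only: iota_mult mult.assoc)
    then have "tr (sigma Q i) z = \<iota> (lam Q i j ^ n * lam Q i l) * z"
      unfolding dda_transport_def using inv_h0_scal[OF m] zi by simp
    moreover have "z \<in> B" unfolding z_def by (rule D.d_mem[OF b])
    ultimately have xz: "x i * z = \<iota> (lam Q i l) * (\<iota> (lam Q i j ^ n) * (z * x i))"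
      using x_high_base[OF i] by (simp add: iota_mult mult.assoc iota_left_commute[of "\<iota> (lam Q i j ^ n)"])
    show ?thesis
      unfolding e iota_left_commute[of "x i"] xz
      by (simp only: mult.assoc iota_left_commute[of z] iota_left_commute[of "\<iota> t" "lam Q i l"])
  qed
  obtain M where M: "D.nil M (x l)" by (rule D.nil_exists[OF b])
  have "x i * (\<iota> (D.c n) * D.e n (x l) * D.u ^ n) = \<iota> (lam Q i l) * (\<iota> (D.c n) * D.e n (x l) * D.u ^ n * x i)"
    for n
  proof -
    have "x i * (\<iota> (D.c n) * D.e n (x l) * D.u ^ n) = \<iota> (D.c n) * (x i * D.e n (x l) * D.u ^ n)"
      by (simp only: mult.assoc iota_left_commute[of "x i"])
    also have "x i * D.e n (x l) * D.u ^ n = \<iota> (lam Q i l) * (D.e n (x l) * (D.u ^ n * x i))"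
      unfolding x_e x_high_inverse[OF i, symmetric] by (simp only: mult.assoc)
    finally show ?thesis
      by (simp only: mult.assoc iota_left_commute[of "\<iota> (D.c n)"])
  qed
  then show ?thesis
    unfolding y_low[OF l] D.theta_eq[OF M] by (simp only: sum_distrib_left sum_distrib_right)
qed

lemma y_j: "y j = x j"
  by (rule y_high) simp

lemma comm_new:
  assumes i: "i \<in> {j..N}" and l: "l \<in> {1..<i}"
  shows "y i * y l = \<iota> (lam Q i l) * (y l * y i)"
proof (cases "i = j")
  case True
  then show ?thesis using comm_j[of l] y_j l j by auto
next
  case False
  then have ij: "i \<in> {j + 1..N}" using i by auto
  have yi: "y i = x i" using ij by (intro y_high) auto
  show ?thesis
  proof (cases "l < j")
    case True
    then have "l \<in> {1..j - 1}" using l by auto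
    then show ?thesis unfolding yi by (rule comm_high[OF ij])
  next
    case False
    then have "y l = x l" by (intro y_high) auto
    then show ?thesis unfolding yi using inv_comm[OF ij l] by simp
  qed
qed

text \<open>Deletion leaves no derivation between \<open>x j\<close> and any new generator; the
  nonzero scalar yields the Ore condition through \<open>skew_ore\<close>.\<close>

lemma y_normal:
  assumes l: "l \<in> {1..N}"
  shows "\<exists>t. t \<noteq> 0 \<and> x j * y l = \<iota> t * (y l * x j)"
proof -
  have jN: "j \<in> {1..N}" using j by auto
  consider "l < j" | "l = j" | "l > j" by linarith
  then show ?thesis
  proof cases
    case 1
    then show ?thesis using comm_j[of l] lam(1)[OF jN l] l by auto
  next
    case 2
    then show ?thesis using y_j by (intro exI[of _ 1]) simp
  next
    case 3
    then have "y l * y j = \<iota> (lam Q l j) * (y j * y l)" using comm_new[of l j] l j by auto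
    then have "\<iota> (lam Q j l) * (y l * x j) = \<iota> (lam Q j l) * (\<iota> (lam Q l j) * (x j * y l))"
      unfolding y_j by simp
    also have "\<dots> = x j * y l" using lam(2)[OF jN l] by (simp flip: mult.assoc iota_mult)
    finally show ?thesis using lam(1)[OF jN l] by (intro exI[of _ "lam Q j l"]) simp
  qed
qed

text \<open>All initial segments from \<open>j\<close> on are covered, since \<open>free_new\<close>
  compares the algebras at \<open>i - 1\<close> and \<open>i\<close>.\<close>

lemma localization:
  assumes i: "i \<in> {j..N}"
  shows "same_localization (x j) (galg (x ` {1..i})) (galg (y ` {1..i}))"
proof -
  let ?R = "galg (x ` {1..i})" and ?R' = "galg (y ` {1..i})"
  have xj: "x j \<in> ?R" using i j by (intro galg_incl) auto
  have "y j \<in> ?R'" using i j by (intro galg_incl imageI) auto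
  then have xj': "x j \<in> ?R'" unfolding y_j .
  have BR: "B \<subseteq> ?R" unfolding B_eq by (rule galg_mono) (use i in auto)
  have BR': "D.\<theta> ` B \<subseteq> ?R'" unfolding galg_y_low[symmetric] by (rule galg_mono, rule image_mono) (use i in auto)
  have ore: "ore_powers ?R (x j)"
  proof (rule ore_powers_galg[OF xj D.x0])
    fix g n assume "g \<in> x ` {1..i}"
    then obtain l where l: "g = x l" "l \<in> {1..i}" by blast
    show "\<exists>r\<in>?R. \<exists>k. g * x j ^ k = x j ^ n * r"
    proof (cases "l < j")
      case True
      then have "l \<in> {1..j - 1}" using l by auto
      then show ?thesis unfolding l(1) by (intro D.base_ore[OF subalgebra_on_galg BR xj] x_low)
    next
      case False
      then have yl: "y l = x l" by (intro y_high) auto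
      have "l \<in> {1..N}" using l i by auto
      then obtain t where t: "t \<noteq> 0" "x j * x l = \<iota> t * (x l * x j)" using y_normal unfolding yl[symmetric] by blast
      show ?thesis unfolding l(1) by (rule skew_ore[OF t(2,1)]) (rule galg_incl[OF imageI[OF l(2)]])
    qed
  qed
  have ore': "ore_powers ?R' (x j)"
  proof (rule ore_powers_galg[OF xj' D.x0])
    fix g n assume "g \<in> y ` {1..i}"
    then obtain l where l: "g = y l" "l \<in> {1..i}" by blast
    have "l \<in> {1..N}" using l i by auto
    then obtain t where t: "t \<noteq> 0" "x j * y l = \<iota> t * (y l * x j)" using y_normal by blast
    show "\<exists>r\<in>?R'. \<exists>k. g * x j ^ k = x j ^ n * r"
      unfolding l(1) by (rule skew_ore[OF t(2,1)]) (rule galg_incl[OF imageI[OF l(2)]])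
  qed
  have sub: "?R \<subseteq> localized (x j) ?R'"
  proof (rule galg_least[OF subalgebra_on_localized[OF subalgebra_on_galg ore']], rule subsetI)
    fix g assume "g \<in> x ` {1..i}"
    then obtain l where l: "g = x l" "l \<in> {1..i}" by blast
    show "g \<in> localized (x j) ?R'"
    proof (cases "l < j")
      case True
      then have "l \<in> {1..j - 1}" using l by auto
      then show ?thesis unfolding l(1) by (intro D.base_in_localized[OF subalgebra_on_galg BR' xj'] x_low)
    next
      case False
      then have yl: "y l = x l" by (intro y_high) auto
      have "y l \<in> ?R'" by (rule galg_incl[OF imageI[OF l(2)]])
      then show ?thesis unfolding l(1) yl by (rule subsetD[OF localized_closed(1)[OF subalgebra_on_galg xj' D.x0]])
    qed
  qed
  have sub': "?R' \<subseteq> localized (x j) ?R"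
  proof (rule galg_least[OF subalgebra_on_localized[OF subalgebra_on_galg ore]], rule subsetI)
    fix g assume "g \<in> y ` {1..i}"
    then obtain l where l: "g = y l" "l \<in> {1..i}" by blast
    show "g \<in> localized (x j) ?R"
    proof (cases "l < j")
      case True
      then have lj: "l \<in> {1..j - 1}" using l by auto
      show ?thesis unfolding l(1) y_low[OF lj] by (rule D.theta_in_localized[OF subalgebra_on_galg BR xj x_low[OF lj]])
    next
      case False
      then have yl: "y l = x l" by (intro y_high) auto
      have "x l \<in> ?R" by (rule galg_incl[OF imageI[OF l(2)]])
      then show ?thesis unfolding l(1) yl by (rule subsetD[OF localized_closed(1)[OF subalgebra_on_galg xj D.x0]])
    qed
  qed
  show ?thesis
    unfolding same_localization_def by (intro conjI subring_on_galg ore ore' sub sub')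
qed

lemma free_new:
  assumes i: "i \<in> {j..N}" and r: "r \<in> galg (y ` {1..i})" and ri: "r * y i \<in> galg (y ` {1..i - 1})"
  shows "r = 0"
proof (cases "i = j")
  case True
  have "y ` {1..j} \<subseteq> D.\<theta> ` B \<union> {x j}"
  proof
    fix g assume "g \<in> y ` {1..j}"
    then obtain l where l: "g = y l" "l \<in> {1..j}" by blast
    show "g \<in> D.\<theta> ` B \<union> {x j}"
    proof (cases "l = j")
      case False
      then have lj: "l \<in> {1..j - 1}" using l by auto
      show ?thesis unfolding l(1) y_low[OF lj] using x_low[OF lj] by blast
    qed (simp add: l(1) y_j)
  qed
  then have "galg (y ` {1..j}) \<subseteq> galg (D.\<theta> ` B \<union> {x j})" by (rule galg_mono)
  then have "r \<in> galg (D.\<theta> ` B \<union> {x j})" using r True by blast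
  moreover have "r * x j \<in> D.\<theta> ` B" using ri unfolding True y_j galg_y_low .
  ultimately show ?thesis by (rule D.theta_poly_free)
next
  case False
  then have ij: "i \<in> {j + 1..N}" using i by auto
  then have i1: "i - 1 \<in> {j..N}" and jN: "j \<in> {1..N}" and iN: "i \<in> {1..N}" using j by auto
  let ?R = "galg (x ` {1..i})" and ?R1 = "galg (x ` {1..i - 1})"
  have yi: "y i = x i" using ij by (intro y_high) auto
  \<comment> \<open>Multiplying \<open>r\<close> by \<open>x j ^ (n + m)\<close> clears both
    denominators at once. Moving this power past \<open>x i\<close> costs only a scalar, so freeness
    of the old generators applies.\<close>
  obtain n where n: "r * x j ^ n \<in> ?R"
    using localization[OF i] r unfolding same_localization_def localized_def by blast
  obtain m where m: "r * x i * x j ^ m \<in> ?R1"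
    using localization[OF i1] ri unfolding yi same_localization_def localized_def by blast
  have xj: "x j \<in> ?R" "x j \<in> ?R1" using ij j by (intro galg_incl imageI; auto)+
  have pow: "x j ^ k \<in> ?R" "x j ^ k \<in> ?R1" for k
    by (rule subring_onD(7)[OF subring_on_galg xj(1)], rule subring_onD(7)[OF subring_on_galg xj(2)])
  obtain t where t: "t \<noteq> 0" "x j * x i = \<iota> t * (x i * x j)" using y_normal[OF iN] unfolding yi by blast
  have "r * x j ^ (n + m) * x i = r * (x j ^ (n + m) * x i)" by (rule mult.assoc)
  also have "\<dots> = \<iota> (t ^ (n + m)) * (r * (x i * x j ^ (n + m)))"
    unfolding skew_power[OF t(2)] by (rule iota_left_commute)
  also have "r * (x i * x j ^ (n + m)) = r * x i * x j ^ m * x j ^ n"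
    by (simp only: add.commute[of n m] power_add mult.assoc)
  finally have "r * x j ^ (n + m) * x i \<in> ?R1" using galg_mult[OF galg_scal galg_mult[OF m pow(2)]] by simp
  moreover have "r * x j ^ (n + m) \<in> ?R"
    using galg_mult[OF n pow(1)[of m]] by (simp only: power_add mult.assoc)
  ultimately have "r * x j ^ (n + m) = 0" by (intro inv_free[OF ij])
  then show ?thesis using D.x0 by simp
qed

text \<open>The inverse of \<open>D.\<theta>\<close> takes the low new generators back to the old
  ones, so composing it with \<open>h0\<close> gives the required isomorphism.\<close>

lemma iterated_ore_step: "iterated_ore j y"
proof -
  note theta = D.theta_scal D.theta_add D.theta_mult
  have bij: "bij_betw D.\<theta> B (D.\<theta> ` B)" using D.inj_theta by (simp add: bij_betw_def)
  have iso: "alg_iso \<iota> B (D.\<theta> ` B) D.\<theta>" by (rule alg_isoI[OF D.B bij theta])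
  have "alg_iso \<iota> (D.\<theta> ` B) (subalg Q (j - 1)) (h0 \<circ> inv_into B D.\<theta>)"
    by (rule alg_iso_comp[OF alg_iso_inv(1)[OF iso D.B] h0(1) alg_iso_inv(2)[OF iso D.B]])
  moreover have "(h0 \<circ> inv_into B D.\<theta>) (y l) = gen Q l" if l: "l \<in> {1..j - 1}" for l
    unfolding y_low[OF l] comp_def inv_into_f_f[OF D.inj_theta x_low[OF l]] by (rule h0(2)[OF l])
  moreover have "y i \<noteq> 0" if "i \<in> {j..N}" for i
    using that D.x0 y_high[of i] inv_nz[of i] by (cases "i = j") auto
  ultimately show ?thesis
    unfolding iterated_ore_def galg_y_low using comm_new free_new by blast
qed

lemma graph_low:
  assumes "graph y x {1..j - 1} a c"
  shows "c \<in> B \<and> a = D.\<theta> c"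
  using assms
proof (induction rule: graph.induct)
  case (scal c)
  show ?case using D.BD(1) by simp
next
  case (incl i)
  show ?case using x_low[OF incl] y_low[OF incl] by simp
next
  case (add a c b d)
  then show ?case using D.theta_add[of c d] D.BD(4)[of c d] by simp
next
  case (mult a c b d)
  then show ?case using D.theta_mult[of c d] D.BD(6)[of c d] by simp
qed

text \<open>The induction starts at \<open>j - 1\<close>, where the graph is inverse to the
  injective \<open>D.\<theta>\<close> and 0 has the single partner 0.\<close>

lemma graph_single:
  assumes I: "ideal_on (galg (x ` {1..N})) I" and xI: "x j \<in> I"
    and c: "graph y x {1..N} 0 c"
  shows "c \<in> I"
proof -
  have "c \<in> I" if "j - 1 \<le> n" "n \<le> N" "graph y x {1..n} 0 c" for n c
    using that
  proof (induction n arbitrary: c rule: dec_induct)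
    case (base c)
    have "c = 0" using graph_low[OF base(2)] D.theta_eq_0 by metis
    then show ?case using ideal_onD(3)[OF I] by simp
  next
    case (step n c)
    have n: "Suc n \<in> {j..N}" using step.hyps step.prems(1) j by auto
    let ?C = "galg (x ` {1..N})"
    have mem: "x l \<in> ?C" if "l \<in> {1..N}" for l by (rule galg_incl[OF imageI[OF that]])
    have ins: "{1..Suc n} = insert (Suc n) {1..n}" by auto
    interpret G: graph_step \<iota> y x "{1..n}" "Suc n" ?C I
    proof unfold_locales
      show "subalgebra_on ?C" by (rule subalgebra_on_galg)
      show "ideal_on ?C I" by (rule I)
      show "x (Suc n) \<in> ?C" "x ` {1..n} \<subseteq> ?C" using mem n by auto
      show "graph y x {1..n} 0 c \<Longrightarrow> c \<in> I" for c using step.IH n by auto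
      show "r = 0" if "r \<in> galg (y ` insert (Suc n) {1..n})" "r * y (Suc n) \<in> galg (y ` {1..n})" for r
        using free_new[OF n, of r] that unfolding ins by simp
      fix l assume l: "l \<in> {1..n}"
      then have lN: "l \<in> {1..<Suc n}" and xl: "x l \<in> ?C" using mem n by auto
      show "\<exists>t. y (Suc n) * y l = \<iota> t * (y l * y (Suc n)) \<and> x (Suc n) * x l - \<iota> t * (x l * x (Suc n)) \<in> I"
      proof (intro exI conjI)
        show "y (Suc n) * y l = \<iota> (lam Q (Suc n) l) * (y l * y (Suc n))" by (rule comm_new[OF n lN])
        show "x (Suc n) * x l - \<iota> (lam Q (Suc n) l) * (x l * x (Suc n)) \<in> I"
        \<comment> \<open>At index \<open>j\<close> the old generators still carry a derivation, but
          each monomial of the relation contains \<open>x j\<close> and so lies in \<open>I\<close>.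
          Above \<open>j\<close> the relation is exact.\<close>
        proof (cases "Suc n = j")
          case True
          show ?thesis unfolding True
            by (intro ideal_on_minus(2)[OF subring_on_galg I] ideal_onD(5)[OF I galg_scal] ideal_onD(5,6)[OF I xl xI])
        next
          case False
          then have "Suc n \<in> {j + 1..N}" using n by auto
          then show ?thesis using inv_comm[OF _ lN] ideal_onD(3)[OF I] by simp
        qed
      qed
    qed
    show ?case using step.prems(2) unfolding ins by (rule G.single_insert)
  qed
  from this[OF _ order.refl c] show ?thesis using j by auto
qed

end

section \<open>The maps \<open>psi\<close> on the two strata and on the whole spectrum\<close>

lemma bi_increasing_homeomorphism_cong:
  assumes "\<And>P. P \<in> topspace T \<Longrightarrow> f P = g P"
  shows "bi_increasing_homeomorphism T U f \<longleftrightarrow> bi_increasing_homeomorphism T U g"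
proof -
  have "homeomorphic_map T U f \<longleftrightarrow> homeomorphic_map T U g"
    using assms homeomorphic_map_eq by metis
  moreover have "monotone_on (topspace T) (\<subseteq>) (\<subseteq>) f \<longleftrightarrow> monotone_on (topspace T) (\<subseteq>) (\<subseteq>) g"
    using assms by (simp add: monotone_on_def)
  moreover have "inv_into (topspace T) f = inv_into (topspace T) g"
    using assms unfolding inv_into_def by (intro ext arg_cong[of _ _ Eps]) auto
  ultimately show ?thesis by (simp add: bi_increasing_homeomorphism_def)
qed

context qna
begin

lemma dda_alg_eq: "dda_alg Q m = galg (dda_gen Q m ` {1..N})"
  by (simp add: dda_alg_def)

lemma iterated_ore_dda_gen:
  assumes "m \<in> {2..N + 1}"
  shows "iterated_ore m (dda_gen Q m)"
proof -
  \<comment> \<open>Descending induction from \<open>N + 1\<close>; the guard keeps every step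
    within the range of the algorithm.\<close>
  have "2 \<le> m \<longrightarrow> iterated_ore m (dda_gen Q m)" if "m \<le> N + 1" for m
    using that
  proof (induction m rule: inc_induct)
    case base
    show ?case unfolding dda_gen_top using iterated_ore_top by blast
  next
    case (step m)
    show ?case
    proof
      assume "2 \<le> m"
      then have m: "m \<in> {2..N}" and inv: "iterated_ore (m + 1) (dda_gen Q (m + 1))"
        using step by auto
      interpret qna_step Q m "dda_gen Q (m + 1)" by unfold_locales (rule m, rule inv)
      show "iterated_ore m (dda_gen Q m)" unfolding dda_gen_step[OF m] by (rule iterated_ore_step)
    qed
  qed
  then show ?thesis using assms by simp
qed

context
  fixes j assumes j: "j \<in> {2..N}"
begin

abbreviation x where "x \<equiv> dda_gen Q (j + 1)"
abbreviation y where "y \<equiv> dda_gen Q j"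
abbreviation R where "R \<equiv> dda_alg Q (j + 1)"
abbreviation R' where "R' \<equiv> dda_alg Q j"
abbreviation I where "I \<equiv> dda_ideal Q j"

lemma qna_step: "qna_step Q j x"
  using iterated_ore_dda_gen[of "j + 1"] j by unfold_locales auto

interpretation S: qna_step Q j x
  by (rule qna_step)

lemma y_eq: "dda_step Q j x = y"
  using dda_gen_step[OF j] by simp

lemma y_j: "y j = x j"
  using S.y_j unfolding y_eq .

lemma same_loc: "same_localization (x j) R R'"
  using S.localization[of N] j unfolding y_eq dda_alg_eq by auto

lemma subring: "subring_on R" "subring_on R'"
  unfolding dda_alg_eq by (rule subring_on_galg)+

lemma x_mem: "x j \<in> R"
  unfolding dda_alg_eq using j by (intro galg_incl imageI) auto

lemma ideal_I: "ideal_on R I" "x j \<in> I"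
  using ideal_on_Idl[OF subring(1), of "{x j}"] x_mem unfolding dda_ideal_def by auto

lemma g: "dda_g Q j \<in> ring_hom (ring_on R') (ring_on R Quot I)"
  "dda_g Q j (\<iota> c) = I +>\<^bsub>ring_on R\<^esub> \<iota> c"
  "i \<in> {1..N} \<Longrightarrow> dda_g Q j (y i) = I +>\<^bsub>ring_on R\<^esub> x i"
proof -
  have "\<exists>g. g \<in> ring_hom (ring_on R') (ring_on R Quot I)
     \<and> (\<forall>c. g (\<iota> c) = I +>\<^bsub>ring_on R\<^esub> \<iota> c) \<and> (\<forall>i\<in>{1..N}. g (y i) = I +>\<^bsub>ring_on R\<^esub> x i)"
    unfolding dda_alg_eq
    by (rule graph_ring_hom) (use S.graph_single ideal_I in \<open>unfold y_eq dda_alg_eq, blast+\<close>)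
  then have "dda_g Q j \<in> ring_hom (ring_on R') (ring_on R Quot I)
     \<and> (\<forall>c. dda_g Q j (\<iota> c) = I +>\<^bsub>ring_on R\<^esub> \<iota> c)
     \<and> (\<forall>i\<in>{1..N}. dda_g Q j (y i) = I +>\<^bsub>ring_on R\<^esub> x i)"
    unfolding dda_g_def by (rule someI_ex)
  then show "dda_g Q j \<in> ring_hom (ring_on R') (ring_on R Quot I)"
    "dda_g Q j (\<iota> c) = I +>\<^bsub>ring_on R\<^esub> \<iota> c"
    "i \<in> {1..N} \<Longrightarrow> dda_g Q j (y i) = I +>\<^bsub>ring_on R\<^esub> x i"
    by blast+
qed

definition g_rel :: "'f \<Rightarrow> 'f \<Rightarrow> bool" where
  "g_rel a r \<longleftrightarrow> a \<in> R' \<and> r \<in> R \<and> dda_g Q j a = I +>\<^bsub>ring_on R\<^esub> r"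

lemma correspondence_g_rel: "correspondence R' R g_rel" "{r. g_rel 0 r} = I"
proof -
  have g_rel_eq: "g_rel = (\<lambda>a r. a \<in> R' \<and> r \<in> R \<and> dda_g Q j a = I +>\<^bsub>ring_on R\<^esub> r)"
    by (simp add: fun_eq_iff g_rel_def)
  note * = correspondence_of_ring_hom[OF ideal_I(1)[unfolded dda_alg_eq] g[unfolded dda_alg_eq]]
  show "correspondence R' R g_rel" unfolding g_rel_eq unfolding dda_alg_eq by (rule *(1))
  show "{r. g_rel 0 r} = I" unfolding g_rel_eq unfolding dda_alg_eq by (rule *(2))
qed

lemma g_rel_y_j: "g_rel (y j) 0"
proof -
  have j': "j \<in> {1..N}" using j by auto
  have "y j \<in> R'" unfolding dda_alg_eq by (rule galg_incl[OF imageI[OF j']])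
  moreover have "I +>\<^bsub>ring_on R\<^esub> x j = I +>\<^bsub>ring_on R\<^esub> 0"
    unfolding a_r_coset_eq_iff[OF subring(1) ideal_I(1)] using ideal_I(2) by simp
  ultimately show ?thesis
    unfolding g_rel_def g(3)[OF j'] using subring_onD(2)[OF subring(1)] by simp
qed

lemma psi_0: "P \<in> stratum (ring_on R) (x j) 0 \<Longrightarrow> psi Q j P = localized (x j) P \<inter> R'"
  using localized_eq_fractions[OF S.D.x0, of P] by (simp add: psi_def stratum_def dda_localize_def)

lemma psi_1: "P \<in> stratum (ring_on R) (x j) 1 \<Longrightarrow> psi Q j P = corr_image g_rel P"
proof -
  assume "P \<in> stratum (ring_on R) (x j) 1"
  then have P: "cprime_on R P" "x j \<in> P" unfolding stratum_ring_on(2)[OF subring(1)] by blast+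
  have "P \<subseteq> R" by (rule ideal_onD(1)[OF cprime_onD(1)[OF P(1)]])
  then show ?thesis using P(2) unfolding psi_def corr_image_def g_rel_def by auto
qed

lemma stratum_1_eq: "stratum (ring_on R) (x j) 1 = {P. cprime_on R P \<and> {r. g_rel 0 r} \<subseteq> P}"
proof -
  have "I \<subseteq> P \<longleftrightarrow> x j \<in> P" if "cprime_on R P" for P
    using Idl_subset_cprime_iff[OF subring(1) that, of "{x j}"] x_mem by (simp add: dda_ideal_def)
  then show ?thesis unfolding stratum_ring_on(2)[OF subring(1)] correspondence_g_rel(2) by blast
qed

lemma psi_stratum:
  assumes e: "e \<in> {0, 1}"
  defines "U \<equiv> stratum (ring_on R) (x j) e"
  shows "bi_increasing_homeomorphism (subtopology (zariski (ring_on R)) U)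
      (subtopology (zariski (ring_on R')) (psi Q j ` U)) (psi Q j)"
    and "closedin (subtopology (zariski (ring_on R')) (stratum (ring_on R') (y j) e)) (psi Q j ` U)"
    and "psi Q j ` U \<subseteq> stratum (ring_on R') (y j) e"
    and "inj_on (psi Q j) U"
proof -
  define f where "f P = (if e = 0 then localized (x j) P \<inter> R' else corr_image g_rel P)" for P
  have f: "psi Q j P = f P" if "P \<in> U" for P
    using that e psi_0 psi_1 unfolding U_def f_def by auto
  have UC: "U \<subseteq> CSpec (ring_on R)" "stratum (ring_on R') (y j) e \<subseteq> CSpec (ring_on R')"
    unfolding U_def stratum_def by blast+
  have top: "topspace (subtopology (zariski (ring_on R)) U) = U"
    unfolding topspace_subtopology closedin_zariski_iff(2)[OF subring(1)] using UC(1) by blast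
  have im: "psi Q j ` U = f ` U" by (rule image_cong) (use f in auto)
  have *: "bi_increasing_homeomorphism (subtopology (zariski (ring_on R)) U)
      (subtopology (zariski (ring_on R')) (f ` U)) f
    \<and> (\<exists>H\<subseteq>R'. f ` U = {P \<in> stratum (ring_on R') (y j) e. H \<subseteq> P})"
  proof (cases "e = 0")
    case True
    have ff: "f = (\<lambda>P. localized (x j) P \<inter> R')" by (simp add: fun_eq_iff f_def True)
    note c = contraction_bi_increasing_homeomorphism[OF same_loc]
    \<comment> \<open>Contraction is onto the stratum, so the empty set of conditions describes the
      image.\<close>
    have "f ` U = {P \<in> stratum (ring_on R') (y j) e. {} \<subseteq> P}"
      unfolding ff U_def True y_j c(1) by simp
    then show ?thesis using c(2) unfolding ff U_def True by blast
  next
    case False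
    then have e1: "e = 1" using e by simp
    have ff: "f = corr_image g_rel" by (simp add: fun_eq_iff f_def e1)
    note c = corr_image_bi_increasing_homeomorphism[OF correspondence_g_rel(1), folded stratum_1_eq]
    \<comment> \<open>The image consists of the ideals above the kernel of \<open>dda_g Q j\<close>.
      That kernel contains \<open>y j\<close>, so these ideals lie in the stratum
      automatically.\<close>
    have "f ` U = {P \<in> stratum (ring_on R') (y j) e. {a. g_rel a 0} \<subseteq> P}"
      unfolding ff U_def e1 c(1) stratum_ring_on(2)[OF subring(2)] using g_rel_y_j by blast
    moreover have "{a. g_rel a 0} \<subseteq> R'" unfolding g_rel_def by blast
    ultimately show ?thesis using c(2) unfolding ff U_def e1 by blast
  qed
  show homeo: "bi_increasing_homeomorphism (subtopology (zariski (ring_on R)) U)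
      (subtopology (zariski (ring_on R')) (psi Q j ` U)) (psi Q j)"
    unfolding im using * bi_increasing_homeomorphism_cong[of "subtopology (zariski (ring_on R)) U" "psi Q j" f] f
    unfolding top by blast
  show "closedin (subtopology (zariski (ring_on R')) (stratum (ring_on R') (y j) e)) (psi Q j ` U)"
    unfolding im closedin_subtopology_zariski_iff[OF subring(2) UC(2)] using * by blast
  show "psi Q j ` U \<subseteq> stratum (ring_on R') (y j) e" unfolding im using * by blast
  show "inj_on (psi Q j) U"
    using homeo homeomorphic_imp_injective_map unfolding bi_increasing_homeomorphism_def by (metis top)
qed

lemma CSpec_strata: "CSpec (ring_on R) = stratum (ring_on R) (x j) 0 \<union> stratum (ring_on R) (x j) 1"
  unfolding stratum_def by auto

lemma psi_CSpec: "psi Q j \<in> CSpec (ring_on R) \<rightarrow> CSpec (ring_on R')"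
proof
  fix P assume "P \<in> CSpec (ring_on R)"
  then consider "P \<in> stratum (ring_on R) (x j) 0" | "P \<in> stratum (ring_on R) (x j) 1"
    unfolding CSpec_strata by blast
  then show "psi Q j P \<in> CSpec (ring_on R')"
    using psi_stratum(3)[of 0] psi_stratum(3)[of 1] by cases (auto simp: stratum_def)
qed

text \<open>Membership of \<open>y j\<close> in the image tells the strata apart, so injectivity on
  each of them suffices.\<close>

lemma inj_psi: "inj_on (psi Q j) (CSpec (ring_on R))"
  unfolding CSpec_strata
proof (rule inj_onI)
  fix P P' assume P: "P \<in> stratum (ring_on R) (x j) 0 \<union> stratum (ring_on R) (x j) 1"
    and P': "P' \<in> stratum (ring_on R) (x j) 0 \<union> stratum (ring_on R) (x j) 1"
    and eq: "psi Q j P = psi Q j P'"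
  have y: "y j \<notin> psi Q j P" if "P \<in> stratum (ring_on R) (x j) 0" for P
    using psi_stratum(3)[of 0] that unfolding stratum_def by auto
  have y': "y j \<in> psi Q j P" if "P \<in> stratum (ring_on R) (x j) 1" for P
    using psi_stratum(3)[of 1] that unfolding stratum_def by auto
  show "P = P'"
  proof (cases "y j \<in> psi Q j P")
    case True
    then have "P \<in> stratum (ring_on R) (x j) 1" "P' \<in> stratum (ring_on R) (x j) 1"
      using P P' y eq by auto
    then show ?thesis using inj_onD[OF psi_stratum(4)[of 1] eq] by simp
  next
    case False
    then have "P \<in> stratum (ring_on R) (x j) 0" "P' \<in> stratum (ring_on R) (x j) 0"
      using P P' y' eq by auto
    then show ?thesis using inj_onD[OF psi_stratum(4)[of 0] eq] by simp
  qed
qed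

end

end

theorem proposition3p4:
  fixes Q :: "('k::field, 'f::division_ring) qna_data"
  assumes "quantum_nilpotent_algebra Q"
    and "division_ring_of_fractions (subalg Q (ngens Q))"
  shows "\<forall>j\<in>{2..ngens Q}.
    psi Q j \<in> CSpec (dda_ring Q (j + 1)) \<rightarrow> CSpec (dda_ring Q j)
    \<and> inj_on (psi Q j) (CSpec (dda_ring Q (j + 1)))
    \<and> (\<forall>e\<in>{0, 1}.
        let P = stratum (dda_ring Q (j + 1)) (dda_gen Q (j + 1) j) e;
            P' = stratum (dda_ring Q j) (dda_gen Q j j) e
        in bi_increasing_homeomorphism
             (subtopology (zariski (dda_ring Q (j + 1))) P)
             (subtopology (zariski (dda_ring Q j)) (psi Q j ` P))
             (psi Q j)
           \<and> closedin (subtopology (zariski (dda_ring Q j)) P') (psi Q j ` P))"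
proof -
  interpret qna Q by unfold_locales (rule assms(1))
  show ?thesis
    unfolding Let_def by (intro ballI conjI psi_CSpec inj_psi psi_stratum(1,2))
qed

end
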